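(* For every integer $k>1$, the group $BS(1,k)=\langle a,b\mid b^{-1}ab=a^k\rangle$ (in the group language $\{\cdot,{}^{-1},e\}$) and the ring of integers $\mathbb{Z}$ (in the ring language $\{+,\cdot,0,1\}$) are strongly regularly bi-interpretable.
   Context: All structures are algebraic structures in functional languages (function and constant symbols). For a structure $\mathbb{B}$ and a formula $\phi(\bar x,\bar y)$ of its language, $\phi(\mathbb{B},\bar p)$ denotes the set of tuples satisfying $\phi(\bar x,\bar p)$. Interpretation codes. Let $L_A,L_B$ be languages. A code $\Gamma$ (of an $L_A$-structure in $L_B$-structures) of dimension $n=\dim\Gamma$ and parameter dimension $k'=\dim_{par}\Gamma$ is a set of $L_B$-formulas $U_\Gamma(\bar x,\bar y)$, $E_\Gamma(\bar x,\bar x',\bar y)$, and for each symbol $Q\in L_A$ of arity $t_Q$ (constants have arity $0$) a formula $Q_\Gamma(\bar x_1,\dots,\bar x_{t_Q},\bar x_{t_Q+1},\bar y)$, where all $\bar x$'s are $n$-tuples and $|\bar y|=k'$. For an $L_B$-structure $\mathbb{B}$ and $\bar p\in B^{k'}$, $\Gamma(\mathbb{B},\bar p)$ is the $L_A$-structure (when this is well defined) whose universe is $U_\Gamma(\mathbb{B},\bar p)$ modulo the equivalence relation defined by $E_\Gamma(\cdot,\cdot,\bar p)$, where the graph of the interpretation of $Q$ is given by the preimage $Q_\Gamma(\mathbb{B},\bar p)$. An $L_A$-structure $\mathbb{A}$ is interpreted in $\mathbb{B}$ by $(\Gamma,\bar p)$ if $\Gamma(\mathbb{B},\bar p)$ is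 well defined and isomorphic to $\mathbb{A}$; a coordinate map is then a surjection $\mu:U_\Gamma(\mathbb{B},\bar p)\to A$ inducing an isomorphism $\Gamma(\mathbb{B},\bar p)\to\mathbb{A}$ (it is applied coordinatewise to tuples). The interpretation is absolute if $k'=0$. A regular interpretation $(\Gamma,\phi)$ of $\mathbb{A}$ in $\mathbb{B}$ is a code $\Gamma$ together with an $L_B$-formula $\phi(\bar y)$ such that $\phi(\mathbb{B})\neq\emptyset$ and $\Gamma(\mathbb{B},\bar p)\cong\mathbb{A}$ for every $\bar p\in\phi(\mathbb{B})$. Translation and composition. For each $L_A$-formula $\chi(x_1,\dots,x_m)$ there is an $L_B$-formula $\chi_\Gamma(\bar x_1,\dots,\bar x_m,\bar y)$ (obtained by replacing variables by $n$-tuples restricted to $U_\Gamma$, equality by $E_\Gamma$ and symbols by the $Q_\Gamma$) such that whenever $\mathbb{A}\cong\Gamma(\mathbb{B},\bar p)$ with coordinate map $\mu$, for all $\bar b_i\in U_\Gamma(\mathbb{B},\bar p)$: $\mathbb{A}\models\chi(\mu(\bar b_1),\dots,\mu(\bar b_m))\iff\mathbb{B}\models\chi_\Gamma(\bar b_1,\dots,\bar b_m,\bar p)$. If $\Gamma$ is a code of $L_A$-structures in $L_B$-structures and $\Delta$ a code of $L_B$-structures in $L_C$-structures, the composition $\Gamma\circ\Delta$ is the code $\{(U_\Gamma)_\Delta,(E_\Gamma)_\Delta,(Q_\Gamma)_\Delta: Q\in L_A\}$ (all free variables of $\Gamma$'s formulas, including the parameter variables, replaced by $\dim\Delta$-tuples,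 plus the parameter variables of $\Delta$); $\dim\Gamma\circ\Delta=\dim\Gamma\cdot\dim\Delta$ and $\dim_{par}\Gamma\circ\Delta=\dim_{par}\Gamma\cdot\dim\Delta+\dim_{par}\Delta$. If $\mathbb{A}\cong\Gamma(\mathbb{B},\bar p)$ with coordinate map $\mu_\Gamma$ and $\mathbb{B}\cong\Delta(\mathbb{C},\bar q)$ with coordinate map $\mu_\Delta$, and $\bar{\bar p}\in\mu_\Delta^{-1}(\bar p)$, then $\mathbb{A}\cong\Gamma\circ\Delta(\mathbb{C},(\bar{\bar p},\bar q))$ with coordinate map $\mu_\Gamma\circ\mu_\Delta$ (apply $\mu_\Delta$ to each block, then $\mu_\Gamma$); if $(\Gamma,\phi),(\Delta,\psi)$ are regular then $(\Gamma\circ\Delta,\phi_\Delta\wedge\psi)$ is regular. Strong regular bi-interpretability. Structures $\mathbb{A},\mathbb{B}$ are strongly regularly bi-interpretable if: (1) there are a regular interpretation $(\Gamma,\phi)$ of $\mathbb{A}$ in $\mathbb{B}$ and a regular interpretation $(\Delta,\psi)$ of $\mathbb{B}$ in $\mathbb{A}$; (2) there is an $L_A$-formula $\theta_{\mathbb{A}}(\bar u,x,\bar r)$, $|\bar u|=\dim\Gamma\cdot\dim\Delta$, $|\bar r|=\dim_{par}\Gamma\circ\Delta$, such that for every $\bar r_0\in(\phi_\Delta\wedge\psi)(\mathbb{A})$ the formula $\theta_{\mathbb{A}}(\bar u,x,\bar r_0)$ defines (the graph of) some coordinate map $U_{\Gamma\circ\Delta}(\mathbb{A},\bar r_0)\to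 A$; (3) there is an $L_B$-formula $\theta_{\mathbb{B}}(\bar u,x,\bar t)$, $|\bar t|=\dim_{par}\Delta\circ\Gamma$, such that for every $\bar t_0\in(\psi_\Gamma\wedge\phi)(\mathbb{B})$ the formula $\theta_{\mathbb{B}}(\bar u,x,\bar t_0)$ defines some coordinate map $U_{\Delta\circ\Gamma}(\mathbb{B},\bar t_0)\to B$; (4) for every $\bar p\in\phi(\mathbb{B})$ and $\bar q\in\psi(\mathbb{A})$ there are coordinate maps $\mu_\Gamma$ of $(\Gamma,\bar p)$ and $\mu_\Delta$ of $(\Delta,\bar q)$ such that for all $\bar r_0=(\bar{\bar p},\bar q)$ with $\bar{\bar p}\in\mu_\Delta^{-1}(\bar p)$ and all $\bar t_0=(\bar{\bar q},\bar p)$ with $\bar{\bar q}\in\mu_\Gamma^{-1}(\bar q)$, the maps $\mu_\Gamma\circ\mu_\Delta:U_{\Gamma\circ\Delta}(\mathbb{A},\bar r_0)\to A$ and $\mu_\Delta\circ\mu_\Gamma:U_{\Delta\circ\Gamma}(\mathbb{B},\bar t_0)\to B$ are defined by $\theta_{\mathbb{A}}(\bar u,x,\bar r_0)$ and $\theta_{\mathbb{B}}(\bar u,x,\bar t_0)$ respectively. *)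

theory Defs
  imports Main
begin

datatype 'f trm = Var nat | App 'f "'f trm list"

datatype 'f fm = Eq "'f trm" "'f trm" | Neg "'f fm" | Conj "'f fm" "'f fm" | Ex nat "'f fm"

primrec wf_trm :: "('f \<Rightarrow> nat) \<Rightarrow> 'f trm \<Rightarrow> bool" where
  "wf_trm ar (Var v) = True"
| "wf_trm ar (App f ts) = (length ts = ar f \<and> list_all id (map (wf_trm ar) ts))"

primrec wf_fm :: "('f \<Rightarrow> nat) \<Rightarrow> 'f fm \<Rightarrow> bool" where
  "wf_fm ar (Eq s t) = (wf_trm ar s \<and> wf_trm ar t)"
| "wf_fm ar (Neg \<phi>) = wf_fm ar \<phi>"
| "wf_fm ar (Conj \<phi> \<psi>) = (wf_fm ar \<phi> \<and> wf_fm ar \<psi>)"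
| "wf_fm ar (Ex v \<phi>) = wf_fm ar \<phi>"

primrec fv_trm :: "'f trm \<Rightarrow> nat set" where
  "fv_trm (Var v) = {v}"
| "fv_trm (App f ts) = \<Union> (set (map fv_trm ts))"

primrec fv_fm :: "'f fm \<Rightarrow> nat set" where
  "fv_fm (Eq s t) = fv_trm s \<union> fv_trm t"
| "fv_fm (Neg \<phi>) = fv_fm \<phi>"
| "fv_fm (Conj \<phi> \<psi>) = fv_fm \<phi> \<union> fv_fm \<psi>"
| "fv_fm (Ex v \<phi>) = fv_fm \<phi> - {v}"

definition formula_of :: "('f \<Rightarrow> nat) \<Rightarrow> nat \<Rightarrow> 'f fm \<Rightarrow> bool" where
  "formula_of ar m \<phi> \<longleftrightarrow> wf_fm ar \<phi> \<and> fv_fm \<phi> \<subseteq> {..<m}"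

type_synonym ('f, 'a) struct = "'a set \<times> ('f \<Rightarrow> 'a list \<Rightarrow> 'a)"

definition carrier :: "('f, 'a) struct \<Rightarrow> 'a set" where "carrier S = fst S"
definition interp :: "('f, 'a) struct \<Rightarrow> 'f \<Rightarrow> 'a list \<Rightarrow> 'a" where "interp S = snd S"

definition is_struct :: "('f \<Rightarrow> nat) \<Rightarrow> ('f, 'a) struct \<Rightarrow> bool" where
  "is_struct ar S \<longleftrightarrow> carrier S \<noteq> {} \<and>
     (\<forall>f xs. length xs = ar f \<and> set xs \<subseteq> carrier S \<longrightarrow> interp S f xs \<in> carrier S)"

primrec eval :: "('f, 'a) struct \<Rightarrow> (nat \<Rightarrow> 'a) \<Rightarrow> 'f trm \<Rightarrow> 'a" where
  "eval S \<rho> (Var v) = \<rho> v"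
| "eval S \<rho> (App f ts) = interp S f (map (eval S \<rho>) ts)"

primrec sat :: "('f, 'a) struct \<Rightarrow> (nat \<Rightarrow> 'a) \<Rightarrow> 'f fm \<Rightarrow> bool" where
  "sat S \<rho> (Eq s t) = (eval S \<rho> s = eval S \<rho> t)"
| "sat S \<rho> (Neg \<phi>) = (\<not> sat S \<rho> \<phi>)"
| "sat S \<rho> (Conj \<phi> \<psi>) = (sat S \<rho> \<phi> \<and> sat S \<rho> \<psi>)"
| "sat S \<rho> (Ex v \<phi>) = (\<exists>a\<in>carrier S. sat S (\<rho>(v := a)) \<phi>)"

definition holds :: "('f, 'a) struct \<Rightarrow> 'a list \<Rightarrow> 'f fm \<Rightarrow> bool" where
  "holds S xs \<phi> \<longleftrightarrow> sat S (\<lambda>i. xs ! i) \<phi>"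

definition tuples :: "('f, 'a) struct \<Rightarrow> nat \<Rightarrow> 'a list set" where
  "tuples S m = {xs. length xs = m \<and> set xs \<subseteq> carrier S}"

definition defset :: "('f, 'a) struct \<Rightarrow> nat \<Rightarrow> 'f fm \<Rightarrow> 'a list set" where
  "defset S m \<phi> = {xs \<in> tuples S m. holds S xs \<phi>}"

record ('fa, 'fb) code =
  cdim :: nat
  cpar :: nat
  cU :: "'fb fm"
  cE :: "'fb fm"
  cQ :: "'fa \<Rightarrow> 'fb fm"

text \<open>Variable conventions: \<open>U(x,y)\<close>: x = 0..n-1, y = n..n+k'-1;
  \<open>E(x,x',y)\<close>: 2n+k' variables; \<open>Q(x_1,...,x_{t+1},y)\<close>: (t+1)n+k' variables.\<close>
definition wf_code :: "('fa \<Rightarrow> nat) \<Rightarrow> ('fb \<Rightarrow> nat) \<Rightarrow> ('fa, 'fb) code \<Rightarrow> bool" where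
  "wf_code arA arB \<Gamma> \<longleftrightarrow>
     formula_of arB (cdim \<Gamma> + cpar \<Gamma>) (cU \<Gamma>) \<and>
     formula_of arB (2 * cdim \<Gamma> + cpar \<Gamma>) (cE \<Gamma>) \<and>
     (\<forall>Q. formula_of arB ((arA Q + 1) * cdim \<Gamma> + cpar \<Gamma>) (cQ \<Gamma> Q))"

definition Uset :: "('fa, 'fb) code \<Rightarrow> ('fb, 'b) struct \<Rightarrow> 'b list \<Rightarrow> 'b list set" where
  "Uset \<Gamma> B p = {xs \<in> tuples B (cdim \<Gamma>). holds B (xs @ p) (cU \<Gamma>)}"

text \<open>\<open>\<mu>\<close> is a coordinate map of the interpretation of A in B by \<open>(\<Gamma>,p)\<close>: \<open>\<Gamma>(B,p)\<close> is
  well defined and \<open>\<mu>\<close> is a surjection \<open>U_\<Gamma>(B,p) \<rightarrow> A\<close> inducing an isomorphism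
  \<open>\<Gamma>(B,p) \<rightarrow> A\<close>.  Here \<open>E_\<Gamma>(B,p)\<close> is the equivalence relation (on \<open>U_\<Gamma>(B,p)\<close>) and
  \<open>Q_\<Gamma>(B,p)\<close> is the full preimage of the graph of \<open>Q^A\<close>.\<close>
definition coord_map ::
  "('fa \<Rightarrow> nat) \<Rightarrow> ('fa, 'fb) code \<Rightarrow> ('fb, 'b) struct \<Rightarrow> 'b list \<Rightarrow> ('fa, 'a) struct
     \<Rightarrow> ('b list \<Rightarrow> 'a) \<Rightarrow> bool" where
  "coord_map arA \<Gamma> B p A \<mu> \<longleftrightarrow>
     p \<in> tuples B (cpar \<Gamma>) \<and>
     \<mu> ` Uset \<Gamma> B p = carrier A \<and>
     (\<forall>xs\<in>tuples B (cdim \<Gamma>). \<forall>ys\<in>tuples B (cdim \<Gamma>).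
        holds B (xs @ ys @ p) (cE \<Gamma>) \<longleftrightarrow>
        xs \<in> Uset \<Gamma> B p \<and> ys \<in> Uset \<Gamma> B p \<and> \<mu> xs = \<mu> ys) \<and>
     (\<forall>Q xss. length xss = arA Q + 1 \<and> (\<forall>xs\<in>set xss. xs \<in> tuples B (cdim \<Gamma>)) \<longrightarrow>
        (holds B (concat xss @ p) (cQ \<Gamma> Q) \<longleftrightarrow>
         (\<forall>xs\<in>set xss. xs \<in> Uset \<Gamma> B p) \<and>
         interp A Q (map \<mu> (butlast xss)) = \<mu> (last xss)))"

definition interprets ::
  "('fa \<Rightarrow> nat) \<Rightarrow> ('fa, 'fb) code \<Rightarrow> ('fb, 'b) struct \<Rightarrow> 'b list \<Rightarrow> ('fa, 'a) struct \<Rightarrow> bool" where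
  "interprets arA \<Gamma> B p A \<longleftrightarrow> (\<exists>\<mu>. coord_map arA \<Gamma> B p A \<mu>)"

definition regular_interp ::
  "('fa \<Rightarrow> nat) \<Rightarrow> ('fb \<Rightarrow> nat) \<Rightarrow> ('fa, 'fb) code \<Rightarrow> 'fb fm \<Rightarrow> ('fa, 'a) struct
     \<Rightarrow> ('fb, 'b) struct \<Rightarrow> bool" where
  "regular_interp arA arB \<Gamma> \<phi> A B \<longleftrightarrow>
     wf_code arA arB \<Gamma> \<and> formula_of arB (cpar \<Gamma>) \<phi> \<and>
     defset B (cpar \<Gamma>) \<phi> \<noteq> {} \<and>
     (\<forall>p\<in>defset B (cpar \<Gamma>) \<phi>. interprets arA \<Gamma> B p A)"

primrec rename_trm :: "(nat \<Rightarrow> nat) \<Rightarrow> 'f trm \<Rightarrow> 'f trm" where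
  "rename_trm g (Var v) = Var (g v)"
| "rename_trm g (App f ts) = App f (map (rename_trm g) ts)"

text \<open>Renaming of all variable occurrences (free and bound); used with injective maps.\<close>
primrec rename_fm :: "(nat \<Rightarrow> nat) \<Rightarrow> 'f fm \<Rightarrow> 'f fm" where
  "rename_fm g (Eq s t) = Eq (rename_trm g s) (rename_trm g t)"
| "rename_fm g (Neg \<phi>) = Neg (rename_fm g \<phi>)"
| "rename_fm g (Conj \<phi> \<psi>) = Conj (rename_fm g \<phi>) (rename_fm g \<psi>)"
| "rename_fm g (Ex v \<phi>) = Ex (g v) (rename_fm g \<phi>)"

definition Exs :: "nat list \<Rightarrow> 'f fm \<Rightarrow> 'f fm" where
  "Exs vs \<phi> = foldr Ex vs \<phi>"

definition TT :: "'f fm" where "TT = Eq (Var 0) (Var 0)"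

definition Conjs :: "'f fm list \<Rightarrow> 'f fm" where
  "Conjs \<phi>s = foldr Conj \<phi>s TT"

definition block :: "nat \<Rightarrow> nat \<Rightarrow> nat list" where
  "block b n = [b..<b + n]"

text \<open>Instance of a formula \<open>\<phi>\<close> with free variables 0..m-1 at the variables \<open>targets\<close>
  (m = length targets), using fresh variables \<open>\<ge> c\<close> (all targets are \<open>< c\<close>).\<close>
definition inst :: "nat \<Rightarrow> 'f fm \<Rightarrow> nat list \<Rightarrow> 'f fm" where
  "inst c \<phi> targets =
     Exs [c..<c + length targets]
       (Conj (Conjs (map (\<lambda>s. Eq (Var (c + s)) (Var (targets ! s))) [0..<length targets]))
             (rename_fm (\<lambda>v. c + v) \<phi>))"

text \<open>\<open>trm_tr \<Gamma> t env ps c b\<close>: the L_B-formula saying that the n-block of variables starting at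
  b codes the value of the L_A-term t; env maps L_A-variables to the start of their blocks,
  ps are the parameter variables, and variables \<open>\<ge> c\<close> are fresh.\<close>
primrec trm_tr :: "('fa, 'fb) code \<Rightarrow> 'fa trm \<Rightarrow> (nat \<Rightarrow> nat) \<Rightarrow> nat list \<Rightarrow> nat \<Rightarrow> nat \<Rightarrow> 'fb fm" where
  "trm_tr \<Gamma> (Var v) env ps c b =
     inst c (cE \<Gamma>) (block (env v) (cdim \<Gamma>) @ block b (cdim \<Gamma>) @ ps)"
| "trm_tr \<Gamma> (App Q ts) env ps c b =
     (let n = cdim \<Gamma>; k = length ts; c' = c + k * n in
      Exs [c..<c'] (Conjs
        (map2 (\<lambda>F i. F env ps c' (c + i * n)) (map (trm_tr \<Gamma>) ts) [0..<k] @
         [inst c' (cQ \<Gamma> Q) (concat (map (\<lambda>i. block (c + i * n) n) [0..<k]) @ block b n @ ps)])))"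

primrec fm_tr :: "('fa, 'fb) code \<Rightarrow> 'fa fm \<Rightarrow> (nat \<Rightarrow> nat) \<Rightarrow> nat list \<Rightarrow> nat \<Rightarrow> 'fb fm" where
  "fm_tr \<Gamma> (Eq s t) env ps c =
     (let n = cdim \<Gamma> in
      Exs [c..<c + 2 * n] (Conjs
        [trm_tr \<Gamma> s env ps (c + 2 * n) c, trm_tr \<Gamma> t env ps (c + 2 * n) (c + n),
         inst (c + 2 * n) (cE \<Gamma>) (block c n @ block (c + n) n @ ps)]))"
| "fm_tr \<Gamma> (Neg \<phi>) env ps c = Neg (fm_tr \<Gamma> \<phi> env ps c)"
| "fm_tr \<Gamma> (Conj \<phi> \<psi>) env ps c = Conj (fm_tr \<Gamma> \<phi> env ps c) (fm_tr \<Gamma> \<psi> env ps c)"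
| "fm_tr \<Gamma> (Ex v \<phi>) env ps c =
     (let n = cdim \<Gamma> in
      Exs [c..<c + n]
        (Conj (inst (c + n) (cU \<Gamma>) (block c n @ ps)) (fm_tr \<Gamma> \<phi> (env(v := c)) ps (c + n))))"

text \<open>The translation \<open>\<chi>_\<Gamma>(x_1,...,x_N,y)\<close> of an L_A-formula \<open>\<chi>(x_1,...,x_N)\<close>: the i-th
  variable becomes the n-tuple of variables i*n..i*n+n-1, and the parameter variables of
  \<Gamma> are N*n..N*n+k'-1.\<close>
definition translate :: "('fa, 'fb) code \<Rightarrow> nat \<Rightarrow> 'fa fm \<Rightarrow> 'fb fm" where
  "translate \<Gamma> N \<chi> =
     fm_tr \<Gamma> \<chi> (\<lambda>i. i * cdim \<Gamma>) [N * cdim \<Gamma>..<N * cdim \<Gamma> + cpar \<Gamma>]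
       (N * cdim \<Gamma> + cpar \<Gamma>)"

definition comp_code :: "('fa \<Rightarrow> nat) \<Rightarrow> ('fa, 'fb) code \<Rightarrow> ('fb, 'fc) code \<Rightarrow> ('fa, 'fc) code" where
  "comp_code arA \<Gamma> \<Delta> =
     \<lparr> cdim = cdim \<Gamma> * cdim \<Delta>,
       cpar = cpar \<Gamma> * cdim \<Delta> + cpar \<Delta>,
       cU = translate \<Delta> (cdim \<Gamma> + cpar \<Gamma>) (cU \<Gamma>),
       cE = translate \<Delta> (2 * cdim \<Gamma> + cpar \<Gamma>) (cE \<Gamma>),
       cQ = (\<lambda>Q. translate \<Delta> ((arA Q + 1) * cdim \<Gamma> + cpar \<Gamma>) (cQ \<Gamma> Q)) \<rparr>"

definition comp_par_fm :: "('fa, 'fb) code \<Rightarrow> 'fb fm \<Rightarrow> ('fb, 'fc) code \<Rightarrow> 'fc fm \<Rightarrow> 'fc fm" where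
  "comp_par_fm \<Gamma> \<phi> \<Delta> \<psi> =
     Conj (translate \<Delta> (cpar \<Gamma>) \<phi>) (rename_fm (\<lambda>v. v + cpar \<Gamma> * cdim \<Delta>) \<psi>)"

definition chunks :: "nat \<Rightarrow> nat \<Rightarrow> 'a list \<Rightarrow> 'a list list" where
  "chunks n m xs = map (\<lambda>i. take n (drop (i * n) xs)) [0..<m]"

definition defines_map ::
  "('f, 'a) struct \<Rightarrow> 'f fm \<Rightarrow> nat \<Rightarrow> 'a list \<Rightarrow> 'a list set \<Rightarrow> ('a list \<Rightarrow> 'a) \<Rightarrow> bool" where
  "defines_map S \<theta> m r U \<mu> \<longleftrightarrow>
     (\<forall>u\<in>tuples S m. \<forall>x\<in>carrier S. holds S (u @ [x] @ r) \<theta> \<longleftrightarrow> u \<in> U \<and> \<mu> u = x)"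

definition strongly_regularly_biinterpretable ::
  "('fa \<Rightarrow> nat) \<Rightarrow> ('fa, 'a) struct \<Rightarrow> ('fb \<Rightarrow> nat) \<Rightarrow> ('fb, 'b) struct \<Rightarrow> bool" where
  "strongly_regularly_biinterpretable arA A arB B \<longleftrightarrow>
   (\<exists>(\<Gamma> :: ('fa, 'fb) code) \<phi> (\<Delta> :: ('fb, 'fa) code) \<psi> \<theta>A \<theta>B.
      let GD = comp_code arA \<Gamma> \<Delta>; DG = comp_code arB \<Delta> \<Gamma>;
          nn = cdim \<Gamma> * cdim \<Delta>;
          rA = comp_par_fm \<Gamma> \<phi> \<Delta> \<psi>; tB = comp_par_fm \<Delta> \<psi> \<Gamma> \<phi> in
      \<comment> \<open>(1)\<close>
      regular_interp arA arB \<Gamma> \<phi> A B \<and>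
      regular_interp arB arA \<Delta> \<psi> B A \<and>
      \<comment> \<open>(2)\<close>
      formula_of arA (nn + 1 + cpar GD) \<theta>A \<and>
      (\<forall>r0\<in>defset A (cpar GD) rA.
         \<exists>\<mu>. coord_map arA GD A r0 A \<mu> \<and> defines_map A \<theta>A nn r0 (Uset GD A r0) \<mu>) \<and>
      \<comment> \<open>(3)\<close>
      formula_of arB (nn + 1 + cpar DG) \<theta>B \<and>
      (\<forall>t0\<in>defset B (cpar DG) tB.
         \<exists>\<mu>. coord_map arB DG B t0 B \<mu> \<and> defines_map B \<theta>B nn t0 (Uset DG B t0) \<mu>) \<and>
      \<comment> \<open>(4)\<close>
      (\<forall>p\<in>defset B (cpar \<Gamma>) \<phi>. \<forall>q\<in>defset A (cpar \<Delta>) \<psi>.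
         \<exists>\<mu>\<Gamma> \<mu>\<Delta>. coord_map arA \<Gamma> B p A \<mu>\<Gamma> \<and> coord_map arB \<Delta> A q B \<mu>\<Delta> \<and>
           (\<forall>pp. length pp = cpar \<Gamma> * cdim \<Delta> \<and>
                 (\<forall>c\<in>set (chunks (cdim \<Delta>) (cpar \<Gamma>) pp). c \<in> Uset \<Delta> A q) \<and>
                 map \<mu>\<Delta> (chunks (cdim \<Delta>) (cpar \<Gamma>) pp) = p \<longrightarrow>
              defines_map A \<theta>A nn (pp @ q) (Uset GD A (pp @ q))
                (\<lambda>u. \<mu>\<Gamma> (map \<mu>\<Delta> (chunks (cdim \<Delta>) (cdim \<Gamma>) u)))) \<and>
           (\<forall>qq. length qq = cpar \<Delta> * cdim \<Gamma> \<and>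
                 (\<forall>c\<in>set (chunks (cdim \<Gamma>) (cpar \<Delta>) qq). c \<in> Uset \<Gamma> B p) \<and>
                 map \<mu>\<Gamma> (chunks (cdim \<Gamma>) (cpar \<Delta>) qq) = q \<longrightarrow>
              defines_map B \<theta>B nn (qq @ p) (Uset DG B (qq @ p))
                (\<lambda>u. \<mu>\<Delta> (map \<mu>\<Gamma> (chunks (cdim \<Gamma>) (cdim \<Delta>) u))))))"

datatype ring_sym = RAdd | RMul | RZero | ROne

fun ring_arity :: "ring_sym \<Rightarrow> nat" where
  "ring_arity RAdd = 2" | "ring_arity RMul = 2" | "ring_arity RZero = 0" | "ring_arity ROne = 0"

fun int_interp :: "ring_sym \<Rightarrow> int list \<Rightarrow> int" where
  "int_interp RAdd xs = xs ! 0 + xs ! 1"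
| "int_interp RMul xs = xs ! 0 * xs ! 1"
| "int_interp RZero xs = 0"
| "int_interp ROne xs = 1"

definition Zring :: "(ring_sym, int) struct" where
  "Zring = (UNIV, int_interp)"

datatype grp_sym = GMul | GInv | GE

fun grp_arity :: "grp_sym \<Rightarrow> nat" where
  "grp_arity GMul = 2" | "grp_arity GInv = 1" | "grp_arity GE = 0"

text \<open>Group presentations: words over generators and their inverses (letter (g,True) is g,
  (g,False) is g^-1); the group is the quotient of words by the least congruence
  containing free cancellation and the relators.\<close>
type_synonym 'g word = "('g \<times> bool) list"

definition word_inv :: "'g word \<Rightarrow> 'g word" where
  "word_inv w = rev (map (\<lambda>(g, s). (g, \<not> s)) w)"

inductive pres_eq :: "('g word \<times> 'g word) set \<Rightarrow> 'g word \<Rightarrow> 'g word \<Rightarrow> bool"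
  for R :: "('g word \<times> 'g word) set" where
  refl: "pres_eq R w w"
| sym: "pres_eq R u v \<Longrightarrow> pres_eq R v u"
| trans: "pres_eq R u v \<Longrightarrow> pres_eq R v w \<Longrightarrow> pres_eq R u w"
| cancel: "pres_eq R [(g, s), (g, \<not> s)] []"
| rel: "(u, v) \<in> R \<Longrightarrow> pres_eq R u v"
| cong: "pres_eq R u v \<Longrightarrow> pres_eq R (x @ u @ y) (x @ v @ y)"

definition pres_class :: "('g word \<times> 'g word) set \<Rightarrow> 'g word \<Rightarrow> 'g word set" where
  "pres_class R w = {v. pres_eq R w v}"

definition pres_rep :: "'g word set \<Rightarrow> 'g word" where
  "pres_rep X = (SOME w. w \<in> X)"

fun pres_interp :: "('g word \<times> 'g word) set \<Rightarrow> grp_sym \<Rightarrow> 'g word set list \<Rightarrow> 'g word set" where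
  "pres_interp R GMul Xs = pres_class R (pres_rep (Xs ! 0) @ pres_rep (Xs ! 1))"
| "pres_interp R GInv Xs = pres_class R (word_inv (pres_rep (Xs ! 0)))"
| "pres_interp R GE Xs = pres_class R []"

definition presented_group :: "('g word \<times> 'g word) set \<Rightarrow> (grp_sym, 'g word set) struct" where
  "presented_group R = (range (pres_class R), pres_interp R)"

datatype bs_gen = GenA | GenB

definition BS :: "nat \<Rightarrow> (grp_sym, bs_gen word set) struct" where
  "BS k = presented_group {([(GenB, False), (GenA, True), (GenB, True)], replicate k (GenA, True))}"

end

(* The Baumslag-Solitar group is Z[1/k] x| Z, with the generator of Z acting on Z[1/k] as multiplication
   by a power of k.  In the ring Z, a triple (i, p, q) with p, q powers of k codes the element
   (i/q, log_k (p/q)); all operations are polynomial, and the set of powers of k is definable by a divisor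
   coding of finite sets.  In the group, the integer n is coded by a^n.  Heights (second components)
   carry addition and, since (k^m - 1) divides (k^n - 1) iff m divides n, also divisibility, hence
   multiplication via lcm (x, x + 1) = x (x + 1).  The expansion k^(mn) = 1 + n (k^m - 1) mod (k^m - 1)^2
   then links the height n to the element a^n, so <a> and its ring structure are definable.
   Parameters (a, b) are the images of the standard generators under automorphisms: a generates
   Z[1/k] as a Z[1/k]-module and b has height 1.  Conjugation turns a into a^(k^m), so both
   compositions of the interpretations are definable from (a, b). *)
theory Submission
  imports Defs Complex_Main
begin

section \<open>Renaming, instances and translations\<close>

text \<open>Invariance under automorphisms shapes the argument. A formula \<open>\<theta>A\<close>
  that decodes triples of powers of a for the standard generators defines, for another basis (a, b),
  that decoding followed by the automorphism taking the standard generators to (a, b). Hence one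
  fixed coordinate map of \<open>\<Gamma>\<close> cannot serve all bases, although
  \<open>\<Gamma>\<close> has no parameters: each basis gets the map twisted by its automorphism
  \<open>sig a b\<close>. Condition (4) permits this, since its coordinate maps are chosen after the
  parameters. On the integer side the twist acts on Z[1/k] as a dilation, and integers are read off
  there as ratios, so it cancels and one formula \<open>\<theta>B\<close> serves all twists. Heights
  are coded by powers p and q, not by integers, because the group law needs k^m, which is no
  polynomial in m; the common denominator q keeps the codes at three coordinates. Divisibility of
  heights ignores signs, so the condition on lcm (x, x + 1) leaves an ambiguity, which a second
  condition with x - 1 removes.\<close>

lemma eval_cong: "(\<And>v. v \<in> fv_trm t \<Longrightarrow> \<rho> v = \<sigma> v) \<Longrightarrow> eval S \<rho> t = eval S \<sigma> t"
proof (induction t)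
  case (App f ts)
  have "map (eval S \<rho>) ts = map (eval S \<sigma>) ts"
    by (rule map_cong) (use App in auto)
  then show ?case by (simp only: eval.simps)
qed simp

lemma sat_cong: "(\<And>v. v \<in> fv_fm \<phi> \<Longrightarrow> \<rho> v = \<sigma> v) \<Longrightarrow> sat S \<rho> \<phi> = sat S \<sigma> \<phi>"
proof (induction \<phi> arbitrary: \<rho> \<sigma>)
  case (Eq s t)
  have "eval S \<rho> s = eval S \<sigma> s" "eval S \<rho> t = eval S \<sigma> t"
    by (rule eval_cong, use Eq in simp)+
  then show ?case by simp
next
  case (Conj \<phi> \<psi>)
  have "sat S \<rho> \<phi> = sat S \<sigma> \<phi>" "sat S \<rho> \<psi> = sat S \<sigma> \<psi>"
    using Conj.prems by (auto intro!: Conj.IH)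
  then show ?case by simp
next
  case (Ex v \<phi>)
  have "sat S (\<rho>(v := a)) \<phi> = sat S (\<sigma>(v := a)) \<phi>" for a
    by (rule Ex.IH) (use Ex.prems in auto)
  then show ?case by simp
next
  case (Neg \<phi>)
  have "sat S \<rho> \<phi> = sat S \<sigma> \<phi>"
    by (rule Neg.IH) (use Neg.prems in simp)
  then show ?case by simp
qed

lemma eval_closed:
  assumes "is_struct ar S" "wf_trm ar t" "\<And>v. v \<in> fv_trm t \<Longrightarrow> \<rho> v \<in> carrier S"
  shows "eval S \<rho> t \<in> carrier S"
  using assms(2,3)
proof (induction t)
  case (App f ts)
  have "set (map (eval S \<rho>) ts) \<subseteq> carrier S"
    using App by (auto simp: list_all_iff)
  then show ?case using assms(1) App.prems(1) unfolding is_struct_def by auto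
qed auto

lemma eval_rename: "eval S \<rho> (rename_trm g t) = eval S (\<rho> \<circ> g) t"
proof (induction t)
  case (App f ts)
  then have "map (eval S \<rho>) (map (rename_trm g) ts) = map (eval S (\<rho> \<circ> g)) ts"
    by (simp add: comp_def)
  then show ?case by (simp only: eval.simps rename_trm.simps)
qed simp

text \<open>Bound variables are renamed along with free ones. Injectivity prevents capture: updating
  \<open>g v\<close> must leave every other \<open>g w\<close> alone.\<close>

lemma sat_rename: "inj g \<Longrightarrow> sat S \<rho> (rename_fm g \<phi>) = sat S (\<rho> \<circ> g) \<phi>"
proof (induction \<phi> arbitrary: \<rho>)
  case (Ex v \<phi>)
  have "\<rho>(g v := a) \<circ> g = (\<rho> \<circ> g)(v := a)" for a
    using Ex.prems by (auto simp: fun_eq_iff inj_eq)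
  then show ?case by (simp only: sat.simps rename_fm.simps Ex.IH[OF Ex.prems])
qed (simp_all add: eval_rename)

lemma fv_rename_trm: "fv_trm (rename_trm g t) = g ` fv_trm t"
  by (induction t) auto

lemma fv_rename_fm: "inj g \<Longrightarrow> fv_fm (rename_fm g \<phi>) = g ` fv_fm \<phi>"
  by (induction \<phi>) (auto simp: fv_rename_trm inj_eq)

lemma wf_rename_trm: "wf_trm ar (rename_trm g t) = wf_trm ar t"
  by (induction t) (auto simp: list_all_iff)

lemma wf_rename_fm: "wf_fm ar (rename_fm g \<phi>) = wf_fm ar \<phi>"
  by (induction \<phi>) (auto simp: wf_rename_trm)

text \<open>The environment reached after the consecutive quantifiers of
  \<open>Exs [c..<c + m]\<close> have been instantiated by the entries of \<open>xs\<close>.\<close>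

definition upd :: "(nat \<Rightarrow> 'a) \<Rightarrow> nat \<Rightarrow> 'a list \<Rightarrow> nat \<Rightarrow> 'a" where
  "upd \<rho> c xs i = (if c \<le> i \<and> i < c + length xs then xs ! (i - c) else \<rho> i)"

lemma tuples_Suc: "xs \<in> tuples S (Suc m) \<longleftrightarrow> (\<exists>a ys. xs = a # ys \<and> a \<in> carrier S \<and> ys \<in> tuples S m)"
  by (cases xs) (auto simp: tuples_def)

lemma tuples_append:
  "xs \<in> tuples S m \<Longrightarrow> ys \<in> tuples S n \<Longrightarrow> xs @ ys \<in> tuples S (m + n)"
  by (auto simp: tuples_def)

lemma sat_Exs:
  "sat S \<rho> (Exs [c..<c + m] \<phi>) \<longleftrightarrow> (\<exists>xs\<in>tuples S m. sat S (upd \<rho> c xs) \<phi>)"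
proof (induction m arbitrary: c \<rho>)
  case 0
  have "upd \<rho> c [] = \<rho>" by (rule ext) (auto simp: upd_def)
  then show ?case by (simp add: Exs_def tuples_def)
next
  case (Suc m)
  have *: "upd \<rho> c (a # xs) = upd (\<rho>(c := a)) (Suc c) xs" for a xs
    by (auto simp: upd_def fun_eq_iff nth_Cons')
  have "sat S \<rho> (Exs [c..<c + Suc m] \<phi>)
      \<longleftrightarrow> (\<exists>a\<in>carrier S. sat S (\<rho>(c := a)) (Exs [Suc c..<Suc c + m] \<phi>))"
    by (simp add: Exs_def upt_conv_Cons del: upt_Suc)
  also have "\<dots> \<longleftrightarrow> (\<exists>a\<in>carrier S. \<exists>xs\<in>tuples S m. sat S (upd \<rho> c (a # xs)) \<phi>)"
    by (simp only: Suc.IH *)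
  also have "\<dots> \<longleftrightarrow> (\<exists>xs\<in>tuples S (Suc m). sat S (upd \<rho> c xs) \<phi>)"
    unfolding Bex_def tuples_Suc by blast
  finally show ?case .
qed

lemma sat_Conjs: "sat S \<rho> (Conjs \<phi>s) \<longleftrightarrow> (\<forall>\<phi>\<in>set \<phi>s. sat S \<rho> \<phi>)"
  by (induction \<phi>s) (auto simp: Conjs_def TT_def)

text \<open>The fresh block is forced to copy the targets, so the quantifiers have exactly one
  possible witness; it is admissible because the targets take values in the carrier. Copying instead
  of substituting avoids capture and allows repeated targets.\<close>

lemma sat_inst:
  assumes targets: "\<And>t. t \<in> set ts \<Longrightarrow> t < c \<and> \<rho> t \<in> carrier S"
    and fv: "fv_fm \<phi> \<subseteq> {..<length ts}"
  shows "sat S \<rho> (inst c \<phi> ts) \<longleftrightarrow> holds S (map \<rho> ts) \<phi>"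
proof -
  have low: "upd \<rho> c xs (ts ! s) = \<rho> (ts ! s)" if "s < length ts" for s xs
    using targets[OF nth_mem[OF that]] by (simp add: upd_def)
  have iff: "(\<forall>s<length ts. upd \<rho> c xs (c + s) = upd \<rho> c xs (ts ! s)) \<longleftrightarrow> xs = map \<rho> ts"
    if "xs \<in> tuples S (length ts)" for xs
    using that by (auto simp: low tuples_def list_eq_iff_nth_eq) (auto simp: upd_def)
  have tup: "map \<rho> ts \<in> tuples S (length ts)"
    using targets by (auto simp: tuples_def)
  have "sat S \<rho> (inst c \<phi> ts) \<longleftrightarrow> (\<exists>xs\<in>tuples S (length ts). xs = map \<rho> ts \<and>
      sat S (upd \<rho> c xs) (rename_fm (\<lambda>v. c + v) \<phi>))"
    unfolding inst_def sat_Exs by (rule bex_cong) (auto simp: sat_Conjs iff[symmetric])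
  also have "\<dots> \<longleftrightarrow> sat S (upd \<rho> c (map \<rho> ts)) (rename_fm (\<lambda>v. c + v) \<phi>)"
    using tup by auto
  also have "\<dots> \<longleftrightarrow> sat S (upd \<rho> c (map \<rho> ts) \<circ> (\<lambda>v. c + v)) \<phi>"
    by (rule sat_rename) (auto simp: inj_def)
  also have "\<dots> \<longleftrightarrow> sat S (\<lambda>i. map \<rho> ts ! i) \<phi>"
    by (rule sat_cong) (use fv in \<open>auto simp: upd_def\<close>)
  finally show ?thesis unfolding holds_def .
qed

abbreviation blk :: "nat \<Rightarrow> (nat \<Rightarrow> 'a) \<Rightarrow> nat \<Rightarrow> 'a list" where
  "blk n \<rho> b \<equiv> map \<rho> (block b n)"

lemma blk_upd_below: "b + n \<le> c \<Longrightarrow> blk n (upd \<rho> c xs) b = blk n \<rho> b"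
  by (auto simp: block_def upd_def)

lemma blk_in_carrier:
  assumes "b + n \<le> c" "blk n \<rho> b \<in> tuples S n" "t \<in> set (block b n)"
  shows "t < c \<and> \<rho> t \<in> carrier S"
proof
  show "t < c" using assms(1,3) by (simp add: block_def)
  have "\<rho> t \<in> set (blk n \<rho> b)" using assms(3) by simp
  then show "\<rho> t \<in> carrier S" using assms(2) unfolding tuples_def by blast
qed

lemma map_upd_below: "(\<And>p. p \<in> set ps \<Longrightarrow> p < c) \<Longrightarrow> map (upd \<rho> c xs) ps = map \<rho> ps"
  by (rule map_cong[OF HOL.refl]) (force simp: upd_def)

lemma blk_upd:
  assumes "i * n + n \<le> length xs"
  shows "blk n (upd \<rho> c xs) (c + i * n) = take n (drop (i * n) xs)"
proof (rule nth_equalityI)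
  fix j assume "j < length (blk n (upd \<rho> c xs) (c + i * n))"
  then have "j < n" by (simp add: block_def)
  then show "blk n (upd \<rho> c xs) (c + i * n) ! j = take n (drop (i * n) xs) ! j"
    using assms by (simp add: block_def upd_def add.assoc)
qed (use assms in \<open>simp add: block_def\<close>)

lemma take_drop_concat:
  assumes "\<And>x. x \<in> set xss \<Longrightarrow> length x = n" "i < length xss"
  shows "take n (drop (i * n) (concat xss)) = xss ! i"
  using assms
proof (induction xss arbitrary: i)
  case (Cons x xss)
  show ?case
  proof (cases i)
    case (Suc j)
    then have "drop (i * n) (concat (x # xss)) = drop (j * n) (concat xss)"
      using Cons.prems(1)[of x] by simp
    then show ?thesis using Cons Suc by simp
  qed (use Cons.prems in auto)
qed simp

lemma length_concat_const: "(\<And>x. x \<in> set xss \<Longrightarrow> length x = n) \<Longrightarrow> length (concat xss) = length xss * n"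
  by (induction xss) auto

lemma tuples_take_drop:
  assumes "xs \<in> tuples S (m * n)" "i < m"
  shows "take n (drop (i * n) xs) \<in> tuples S n"
proof -
  have "Suc i * n \<le> m * n" using assms(2) by (intro mult_le_mono1) simp
  then show ?thesis using assms(1) unfolding tuples_def
    by (auto dest: in_set_takeD in_set_dropD)
qed

lemma coord_mapD:
  assumes "coord_map ar \<Gamma> B p A \<mu>"
  shows "p \<in> tuples B (cpar \<Gamma>)" "\<mu> ` Uset \<Gamma> B p = carrier A"
    "\<And>xs ys. xs \<in> tuples B (cdim \<Gamma>) \<Longrightarrow> ys \<in> tuples B (cdim \<Gamma>) \<Longrightarrow>
      holds B (xs @ ys @ p) (cE \<Gamma>) \<longleftrightarrow> xs \<in> Uset \<Gamma> B p \<and> ys \<in> Uset \<Gamma> B p \<and> \<mu> xs = \<mu> ys"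
    "\<And>Q xss. length xss = ar Q + 1 \<Longrightarrow> (\<And>xs. xs \<in> set xss \<Longrightarrow> xs \<in> tuples B (cdim \<Gamma>)) \<Longrightarrow>
      holds B (concat xss @ p) (cQ \<Gamma> Q) \<longleftrightarrow>
        (\<forall>xs\<in>set xss. xs \<in> Uset \<Gamma> B p) \<and> interp A Q (map \<mu> (butlast xss)) = \<mu> (last xss)"
  using assms unfolding coord_map_def by auto

section \<open>Evaluation of translated terms and formulas through a coordinate map\<close>

locale interpreted =
  fixes arB :: "'fb \<Rightarrow> nat" and arC :: "'fc \<Rightarrow> nat" and \<Delta> :: "('fb, 'fc) code"
    and C :: "('fc, 'c) struct" and q :: "'c list" and B :: "('fb, 'b) struct"
    and \<mu> :: "'c list \<Rightarrow> 'b"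
  assumes coord: "coord_map arB \<Delta> C q B \<mu>"
    and wf: "wf_code arB arC \<Delta>"
    and struct: "is_struct arB B"
begin

abbreviation "n \<equiv> cdim \<Delta>"
abbreviation "U \<equiv> Uset \<Delta> C q"

lemma U_tuples: "xs \<in> U \<Longrightarrow> xs \<in> tuples C n"
  by (simp add: Uset_def)

lemma q_tuples: "q \<in> tuples C (cpar \<Delta>)"
  using coord coord_mapD(1) by blast

lemma mu_carrier: "xs \<in> U \<Longrightarrow> \<mu> xs \<in> carrier B"
  using coord_mapD(2)[OF coord] by blast

lemma sat_inst_E:
  assumes "b + n \<le> c" "b' + n \<le> c" "blk n \<rho> b \<in> tuples C n" "blk n \<rho> b' \<in> tuples C n"
    "\<And>p. p \<in> set ps \<Longrightarrow> p < c" "map \<rho> ps = q"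
  shows "sat C \<rho> (inst c (cE \<Delta>) (block b n @ block b' n @ ps)) \<longleftrightarrow>
    blk n \<rho> b \<in> U \<and> blk n \<rho> b' \<in> U \<and> \<mu> (blk n \<rho> b) = \<mu> (blk n \<rho> b')"
proof -
  have len: "length ps = cpar \<Delta>" using q_tuples assms(6) by (auto simp: tuples_def)
  have car: "\<rho> t \<in> carrier C" if "t \<in> set ps" for t
    using q_tuples assms(6) that by (auto simp: tuples_def)
  have "sat C \<rho> (inst c (cE \<Delta>) (block b n @ block b' n @ ps)) \<longleftrightarrow>
    holds C (map \<rho> (block b n @ block b' n @ ps)) (cE \<Delta>)"
  proof (rule sat_inst)
    show "fv_fm (cE \<Delta>) \<subseteq> {..<length (block b n @ block b' n @ ps)}"
      using wf len by (auto simp: wf_code_def formula_of_def block_def mult_2)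
  next
    fix t assume "t \<in> set (block b n @ block b' n @ ps)"
    then show "t < c \<and> \<rho> t \<in> carrier C"
      using blk_in_carrier assms car by (metis Un_iff set_append)
  qed
  then show ?thesis using coord_mapD(3)[OF coord assms(3,4)] assms(6) by simp
qed

lemma sat_inst_U:
  assumes "b + n \<le> c" "blk n \<rho> b \<in> tuples C n" "\<And>p. p \<in> set ps \<Longrightarrow> p < c" "map \<rho> ps = q"
  shows "sat C \<rho> (inst c (cU \<Delta>) (block b n @ ps)) \<longleftrightarrow> blk n \<rho> b \<in> U"
proof -
  have len: "length ps = cpar \<Delta>" using q_tuples assms(4) by (auto simp: tuples_def)
  have car: "\<rho> t \<in> carrier C" if "t \<in> set ps" for t
    using q_tuples assms(4) that by (auto simp: tuples_def)
  have "sat C \<rho> (inst c (cU \<Delta>) (block b n @ ps)) \<longleftrightarrow> holds C (map \<rho> (block b n @ ps)) (cU \<Delta>)"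
  proof (rule sat_inst)
    show "fv_fm (cU \<Delta>) \<subseteq> {..<length (block b n @ ps)}"
      using wf len by (auto simp: wf_code_def formula_of_def block_def)
  next
    fix t assume "t \<in> set (block b n @ ps)"
    then show "t < c \<and> \<rho> t \<in> carrier C"
      using blk_in_carrier assms car by (metis Un_iff set_append)
  qed
  then show ?thesis using assms by (simp add: Uset_def)
qed

lemma sat_inst_Q:
  assumes "\<And>b. b \<in> set bs \<Longrightarrow> b + n \<le> c \<and> blk n \<rho> b \<in> tuples C n" "length bs = arB Q + 1"
    "\<And>p. p \<in> set ps \<Longrightarrow> p < c" "map \<rho> ps = q"
  shows "sat C \<rho> (inst c (cQ \<Delta> Q) (concat (map (\<lambda>b. block b n) bs) @ ps)) \<longleftrightarrow>
    (\<forall>b\<in>set bs. blk n \<rho> b \<in> U) \<and>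
    interp B Q (map (\<lambda>b. \<mu> (blk n \<rho> b)) (butlast bs)) = \<mu> (blk n \<rho> (last bs))"
proof -
  have len: "length ps = cpar \<Delta>" using q_tuples assms(4) by (auto simp: tuples_def)
  have car: "\<rho> t \<in> carrier C" if "t \<in> set ps" for t
    using q_tuples assms(4) that by (auto simp: tuples_def)
  have ne: "bs \<noteq> []" using assms(2) by auto
  have lc: "length (concat (map (\<lambda>b. block b n) bs)) = (arB Q + 1) * n"
    by (subst length_concat_const[where n = n]) (use assms(2) in \<open>auto simp: block_def\<close>)
  have "sat C \<rho> (inst c (cQ \<Delta> Q) (concat (map (\<lambda>b. block b n) bs) @ ps)) \<longleftrightarrow>
    holds C (map \<rho> (concat (map (\<lambda>b. block b n) bs) @ ps)) (cQ \<Delta> Q)"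
  proof (rule sat_inst)
    show "fv_fm (cQ \<Delta> Q) \<subseteq> {..<length (concat (map (\<lambda>b. block b n) bs) @ ps)}"
      using wf len lc by (auto simp: wf_code_def formula_of_def)
  next
    fix t assume "t \<in> set (concat (map (\<lambda>b. block b n) bs) @ ps)"
    then consider "t \<in> set ps" | d where "d \<in> set bs" "t \<in> set (block d n)" by auto
    then show "t < c \<and> \<rho> t \<in> carrier C"
    proof cases
      case 1
      then show ?thesis using assms(3) car by blast
    next
      case 2
      then show ?thesis using blk_in_carrier[of d n c \<rho> C t] assms(1) by blast
    qed
  qed
  also have "map \<rho> (concat (map (\<lambda>b. block b n) bs) @ ps) = concat (map (blk n \<rho>) bs) @ q"
    using assms(4) by (simp add: map_concat comp_def)
  also have "holds C \<dots> (cQ \<Delta> Q) \<longleftrightarrow> (\<forall>xs\<in>set (map (blk n \<rho>) bs). xs \<in> U) \<and>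
     interp B Q (map \<mu> (butlast (map (blk n \<rho>) bs))) = \<mu> (last (map (blk n \<rho>) bs))"
    by (rule coord_mapD(4)[OF coord]) (use assms in auto)
  also have "\<dots> \<longleftrightarrow> (\<forall>b\<in>set bs. blk n \<rho> b \<in> U) \<and>
     interp B Q (map (\<lambda>b. \<mu> (blk n \<rho> b)) (butlast bs)) = \<mu> (blk n \<rho> (last bs))"
    using ne by (simp add: map_butlast[symmetric] last_map comp_def)
  finally show ?thesis .
qed

text \<open>Each argument of a function symbol receives a fresh block. Any codes of the argument
  values may fill these blocks, since \<open>cQ\<close> defines the full preimage of the graph, and
  surjectivity of \<open>\<mu>\<close> provides some. The block at \<open>b\<close> is not assumed
  to be in \<open>U\<close>: the formulas \<open>cE\<close> and \<open>cQ\<close> enforce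
  it.\<close>

lemma sat_trm_tr:
  assumes "wf_trm arB t" "\<And>v. v \<in> fv_trm t \<Longrightarrow> env v + n \<le> c \<and> blk n \<rho> (env v) \<in> U \<and> \<mu> (blk n \<rho> (env v)) = \<sigma> v"
    "b + n \<le> c" "blk n \<rho> b \<in> tuples C n" "\<And>p. p \<in> set ps \<Longrightarrow> p < c" "map \<rho> ps = q"
  shows "sat C \<rho> (trm_tr \<Delta> t env ps c b) \<longleftrightarrow> blk n \<rho> b \<in> U \<and> \<mu> (blk n \<rho> b) = eval B \<sigma> t"
  using assms
proof (induction t arbitrary: c b \<rho>)
  case (Var v)
  then show ?case using U_tuples by (auto simp: sat_inst_E)
next
  case (App Q ts)
  define k where "k = length ts"
  define c' where "c' = c + k * n"
  have k: "k = arB Q" using App.prems(1) by (simp add: k_def)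
  have wfs: "wf_trm arB t" if "t \<in> set ts" for t using App.prems(1) that by (simp add: list_all_iff)
  have vals: "eval B \<sigma> t \<in> carrier B" if "t \<in> set ts" for t
    by (rule eval_closed[OF struct wfs[OF that]])
      (use App.prems(2) that mu_carrier in \<open>fastforce\<close>)
  have le: "i * n + n \<le> k * n" if "i < k" for i
    using mult_le_mono1[of "Suc i" k n] that by simp
  define bs where "bs = map (\<lambda>i. c + i * n) [0..<k] @ [b]"
  have bs: "concat (map (\<lambda>i. block (c + i * n) n) [0..<k]) @ block b n = concat (map (\<lambda>b. block b n) bs)"
    by (simp add: bs_def comp_def)
  have main: "sat C (upd \<rho> c xs) (Conjs
        (map2 (\<lambda>F i. F env ps c' (c + i * n)) (map (trm_tr \<Delta>) ts) [0..<k] @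
         [inst c' (cQ \<Delta> Q) (concat (map (\<lambda>i. block (c + i * n) n) [0..<k]) @ block b n @ ps)])) \<longleftrightarrow>
      (\<forall>i<k. take n (drop (i * n) xs) \<in> U \<and> \<mu> (take n (drop (i * n) xs)) = eval B \<sigma> (ts ! i)) \<and>
      blk n \<rho> b \<in> U \<and> interp B Q (map (eval B \<sigma>) ts) = \<mu> (blk n \<rho> b)" (is "?L \<longleftrightarrow> ?R")
    if xs: "xs \<in> tuples C (k * n)" for xs
  proof -
    let ?\<rho> = "upd \<rho> c xs"
    have lx: "length xs = k * n" using xs by (simp add: tuples_def)
    have bi: "blk n ?\<rho> (c + i * n) = take n (drop (i * n) xs)" if "i < k" for i
      using blk_upd[of i n xs] le[OF that] lx by simp
    have sub: "sat C ?\<rho> (trm_tr \<Delta> (ts ! i) env ps c' (c + i * n)) \<longleftrightarrow>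
        take n (drop (i * n) xs) \<in> U \<and> \<mu> (take n (drop (i * n) xs)) = eval B \<sigma> (ts ! i)"
      if i: "i < k" for i
    proof -
      have m: "ts ! i \<in> set ts" using i by (simp add: k_def)
      have "sat C ?\<rho> (trm_tr \<Delta> (ts ! i) env ps c' (c + i * n)) \<longleftrightarrow>
        blk n ?\<rho> (c + i * n) \<in> U \<and> \<mu> (blk n ?\<rho> (c + i * n)) = eval B \<sigma> (ts ! i)"
      proof (rule App.IH[OF m wfs[OF m]])
        fix v assume "v \<in> fv_trm (ts ! i)"
        then have "v \<in> fv_trm (App Q ts)" using m by auto
        from App.prems(2)[OF this] show "env v + n \<le> c' \<and> blk n ?\<rho> (env v) \<in> U \<and> \<mu> (blk n ?\<rho> (env v)) = \<sigma> v"
          by (auto simp: blk_upd_below c'_def)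
      next
        show "c + i * n + n \<le> c'" using le[OF i] by (simp add: c'_def)
        show "blk n ?\<rho> (c + i * n) \<in> tuples C n"
          unfolding bi[OF i] by (rule tuples_take_drop[OF xs i])
        show "p < c'" if "p \<in> set ps" for p using App.prems(5)[OF that] by (simp add: c'_def)
        show "map ?\<rho> ps = q" using App.prems(5,6) by (simp add: map_upd_below)
      qed
      then show ?thesis by (simp only: bi[OF i])
    qed
    have inst: "sat C ?\<rho> (inst c' (cQ \<Delta> Q) (concat (map (\<lambda>b. block b n) bs) @ ps)) \<longleftrightarrow>
      (\<forall>b\<in>set bs. blk n ?\<rho> b \<in> U) \<and>
      interp B Q (map (\<lambda>b. \<mu> (blk n ?\<rho> b)) (butlast bs)) = \<mu> (blk n ?\<rho> (last bs))"
    proof (rule sat_inst_Q)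
      fix d assume "d \<in> set bs"
      then consider "d = b" | i where "i < k" "d = c + i * n" by (auto simp: bs_def)
      then show "d + n \<le> c' \<and> blk n ?\<rho> d \<in> tuples C n"
      proof cases
        case 1
        then show ?thesis using App.prems(3,4) by (auto simp: c'_def blk_upd_below)
      next
        case 2
        then show ?thesis using le[OF 2(1)] tuples_take_drop[OF xs 2(1)] by (auto simp: c'_def bi)
      qed
    next
      show "map ?\<rho> ps = q" using App.prems(5,6) by (simp add: map_upd_below)
    qed (use App.prems(5) in \<open>auto simp: c'_def bs_def k intro: trans_less_add1\<close>)
    have b: "blk n ?\<rho> b = blk n \<rho> b" by (rule blk_upd_below[OF App.prems(3)])
    have "(\<forall>F\<in>set (map2 (\<lambda>F i. F env ps c' (c + i * n)) (map (trm_tr \<Delta>) ts) [0..<k]). sat C ?\<rho> F) \<longleftrightarrow>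
       (\<forall>i<k. sat C ?\<rho> (trm_tr \<Delta> (ts ! i) env ps c' (c + i * n)))"
      by (auto simp: set_conv_nth k_def)
    then have L: "?L \<longleftrightarrow> (\<forall>i<k. sat C ?\<rho> (trm_tr \<Delta> (ts ! i) env ps c' (c + i * n))) \<and>
       sat C ?\<rho> (inst c' (cQ \<Delta> Q) (concat (map (\<lambda>b. block b n) bs) @ ps))"
      unfolding sat_Conjs append_assoc[symmetric] bs by auto
    show ?thesis
    proof (cases "\<forall>i<k. take n (drop (i * n) xs) \<in> U \<and> \<mu> (take n (drop (i * n) xs)) = eval B \<sigma> (ts ! i)")
      case True
      have args: "map (\<lambda>b. \<mu> (blk n ?\<rho> b)) (butlast bs) = map (eval B \<sigma>) ts"
      proof -
        have "butlast bs = map (\<lambda>i. c + i * n) [0..<k]" by (simp add: bs_def)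
        then have "map (\<lambda>b. \<mu> (blk n ?\<rho> b)) (butlast bs) = map (\<lambda>i. eval B \<sigma> (ts ! i)) [0..<k]"
          using True bi by simp
        also have "\<dots> = map (eval B \<sigma>) (map ((!) ts) [0..<length ts])"
          by (simp add: k_def comp_def)
        finally show ?thesis by (simp only: map_nth)
      qed
      show ?thesis unfolding L inst args
        using True by (auto simp: sub bs_def bi b)
    qed (auto simp: L sub)
  qed
  have "sat C \<rho> (trm_tr \<Delta> (App Q ts) env ps c b) \<longleftrightarrow>
      (\<exists>xs\<in>tuples C (k * n). (\<forall>i<k. take n (drop (i * n) xs) \<in> U \<and> \<mu> (take n (drop (i * n) xs)) = eval B \<sigma> (ts ! i)) \<and>
      blk n \<rho> b \<in> U \<and> interp B Q (map (eval B \<sigma>) ts) = \<mu> (blk n \<rho> b))"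
    unfolding trm_tr.simps Let_def k_def[symmetric] c'_def[symmetric]
    unfolding c'_def sat_Exs by (rule bex_cong[OF HOL.refl], fold c'_def, rule main)
  also have "\<dots> \<longleftrightarrow> blk n \<rho> b \<in> U \<and> interp B Q (map (eval B \<sigma>) ts) = \<mu> (blk n \<rho> b)"
  proof -
    have "\<forall>t\<in>set ts. \<exists>xs. xs \<in> U \<and> \<mu> xs = eval B \<sigma> t"
    proof
      fix t assume "t \<in> set ts"
      then have "eval B \<sigma> t \<in> \<mu> ` U" using vals coord_mapD(2)[OF coord] by simp
      then show "\<exists>xs. xs \<in> U \<and> \<mu> xs = eval B \<sigma> t" by (force simp: image_iff)
    qed
    then obtain f where f: "\<And>t. t \<in> set ts \<Longrightarrow> f t \<in> U \<and> \<mu> (f t) = eval B \<sigma> t"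
      by metis
    let ?xs = "concat (map f ts)"
    have len: "length x = n" if "x \<in> set (map f ts)" for x
      using that f U_tuples by (auto simp: tuples_def)
    have "?xs \<in> tuples C (k * n)"
      using length_concat_const[of "map f ts" n] len f U_tuples
      by (fastforce simp: tuples_def k_def)
    moreover have "take n (drop (i * n) ?xs) = f (ts ! i)" if "i < k" for i
      using take_drop_concat[of "map f ts" n i] len that by (auto simp: k_def)
    moreover have "f (ts ! i) \<in> U \<and> \<mu> (f (ts ! i)) = eval B \<sigma> (ts ! i)" if "i < k" for i
      using f[of "ts ! i"] that by (simp add: k_def)
    ultimately show ?thesis by (metis (lifting))
  qed
  finally show ?case by auto
qed

text \<open>Quantified blocks are relativised by the translation itself, and their values run
  through the whole carrier of \<open>B\<close> because \<open>\<mu>\<close> is onto. Nothing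
  relativises the free blocks, so their membership in \<open>U\<close> has to be assumed.\<close>

lemma sat_fm_tr:
  assumes "wf_fm arB \<chi>" "\<And>v. v \<in> fv_fm \<chi> \<Longrightarrow> env v + n \<le> c \<and> blk n \<rho> (env v) \<in> U \<and> \<mu> (blk n \<rho> (env v)) = \<sigma> v"
    "\<And>p. p \<in> set ps \<Longrightarrow> p < c" "map \<rho> ps = q"
  shows "sat C \<rho> (fm_tr \<Delta> \<chi> env ps c) \<longleftrightarrow> sat B \<sigma> \<chi>"
  using assms
proof (induction \<chi> arbitrary: env c \<rho> \<sigma>)
  case (Eq s t)
  have "sat C \<rho> (fm_tr \<Delta> (Eq s t) env ps c) \<longleftrightarrow> (\<exists>xs\<in>tuples C (2 * n).
      take n xs \<in> U \<and> \<mu> (take n xs) = eval B \<sigma> s \<and> drop n xs \<in> U \<and> \<mu> (drop n xs) = eval B \<sigma> t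
      \<and> \<mu> (take n xs) = \<mu> (drop n xs))" (is "_ \<longleftrightarrow> (\<exists>xs\<in>_. ?R xs)")
    unfolding fm_tr.simps Let_def sat_Exs
  proof (rule bex_cong[OF HOL.refl])
    fix xs assume xs: "xs \<in> tuples C (2 * n)"
    let ?\<rho> = "upd \<rho> c xs"
    have b0: "blk n ?\<rho> c = take n xs" and b1: "blk n ?\<rho> (c + n) = drop n xs"
      using blk_upd[of 0 n xs \<rho> c] blk_upd[of 1 n xs \<rho> c] xs by (auto simp: tuples_def)
    have t0: "take n xs \<in> tuples C n" and t1: "drop n xs \<in> tuples C n"
      using xs by (auto simp: tuples_def dest: in_set_takeD in_set_dropD)
    have psq: "map ?\<rho> ps = q" using Eq.prems(3,4) by (simp add: map_upd_below)
    have pl: "p < c + 2 * n" if "p \<in> set ps" for p using Eq.prems(3)[OF that] by simp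
    have ev: "env v + n \<le> c + 2 * n \<and> blk n ?\<rho> (env v) \<in> U \<and> \<mu> (blk n ?\<rho> (env v)) = \<sigma> v"
      if "v \<in> fv_trm s \<union> fv_trm t" for v
      using Eq.prems(2)[of v] that by (auto simp: blk_upd_below)
    have "sat C ?\<rho> (trm_tr \<Delta> s env ps (c + 2 * n) c) \<longleftrightarrow> blk n ?\<rho> c \<in> U \<and> \<mu> (blk n ?\<rho> c) = eval B \<sigma> s"
      by (rule sat_trm_tr) (use Eq.prems(1) ev pl psq t0 b0 in auto)
    moreover have "sat C ?\<rho> (trm_tr \<Delta> t env ps (c + 2 * n) (c + n)) \<longleftrightarrow>
        blk n ?\<rho> (c + n) \<in> U \<and> \<mu> (blk n ?\<rho> (c + n)) = eval B \<sigma> t"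
      by (rule sat_trm_tr) (use Eq.prems(1) ev pl psq t1 b1 in auto)
    moreover have "sat C ?\<rho> (inst (c + 2 * n) (cE \<Delta>) (block c n @ block (c + n) n @ ps)) \<longleftrightarrow>
        blk n ?\<rho> c \<in> U \<and> blk n ?\<rho> (c + n) \<in> U \<and> \<mu> (blk n ?\<rho> c) = \<mu> (blk n ?\<rho> (c + n))"
      by (rule sat_inst_E) (use pl psq t0 t1 b0 b1 in auto)
    ultimately show "sat C ?\<rho> (Conjs
        [trm_tr \<Delta> s env ps (c + 2 * n) c, trm_tr \<Delta> t env ps (c + 2 * n) (c + n),
         inst (c + 2 * n) (cE \<Delta>) (block c n @ block (c + n) n @ ps)]) \<longleftrightarrow> ?R xs"
      unfolding sat_Conjs b0 b1 by auto
  qed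
  also have "\<dots> \<longleftrightarrow> eval B \<sigma> s = eval B \<sigma> t"
  proof
    assume e: "eval B \<sigma> s = eval B \<sigma> t"
    have "eval B \<sigma> s \<in> carrier B"
      by (rule eval_closed[OF struct]) (use Eq.prems(1,2) mu_carrier in fastforce)+
    then have "eval B \<sigma> s \<in> \<mu> ` U" using coord_mapD(2)[OF coord] by simp
    then obtain x where x: "x \<in> U" "\<mu> x = eval B \<sigma> s" by force
    then have "x \<in> tuples C n" using U_tuples by blast
    then have "x @ x \<in> tuples C (2 * n)" "take n (x @ x) = x" "drop n (x @ x) = x"
      by (auto simp: tuples_def)
    then show "\<exists>xs\<in>tuples C (2 * n). ?R xs"
      by (intro bexI[of _ "x @ x"]) (use x e in auto)
  qed auto
  finally show ?case by simp
next
  case (Ex v \<chi>)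
  have "sat C \<rho> (fm_tr \<Delta> (Ex v \<chi>) env ps c) \<longleftrightarrow>
      (\<exists>xs\<in>tuples C n. xs \<in> U \<and> sat B (\<sigma>(v := \<mu> xs)) \<chi>)"
    unfolding fm_tr.simps Let_def sat_Exs
  proof (rule bex_cong[OF HOL.refl])
    fix xs assume xs: "xs \<in> tuples C n"
    let ?\<rho> = "upd \<rho> c xs"
    have b0: "blk n ?\<rho> c = xs"
      using blk_upd[of 0 n xs \<rho> c] xs by (auto simp: tuples_def)
    have psq: "map ?\<rho> ps = q" using Ex.prems(3,4) by (simp add: map_upd_below)
    have pl: "p < c + n" if "p \<in> set ps" for p using Ex.prems(3)[OF that] by simp
    have "sat C ?\<rho> (inst (c + n) (cU \<Delta>) (block c n @ ps)) \<longleftrightarrow> blk n ?\<rho> c \<in> U"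
      by (rule sat_inst_U) (use pl psq xs b0 in auto)
    moreover have "sat C ?\<rho> (fm_tr \<Delta> \<chi> (env(v := c)) ps (c + n)) \<longleftrightarrow> sat B (\<sigma>(v := \<mu> xs)) \<chi>"
      if "xs \<in> U"
    proof (rule Ex.IH)
      fix w assume w: "w \<in> fv_fm \<chi>"
      show "(env(v := c)) w + n \<le> c + n \<and> blk n ?\<rho> ((env(v := c)) w) \<in> U \<and>
          \<mu> (blk n ?\<rho> ((env(v := c)) w)) = (\<sigma>(v := \<mu> xs)) w"
      proof (cases "w = v")
        case False
        then show ?thesis using Ex.prems(2)[of w] w by (auto simp: blk_upd_below)
      qed (use that b0 in auto)
    qed (use Ex.prems(1) pl psq in auto)
    ultimately show "sat C ?\<rho> (Conj (inst (c + n) (cU \<Delta>) (block c n @ ps))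
        (fm_tr \<Delta> \<chi> (env(v := c)) ps (c + n))) \<longleftrightarrow> xs \<in> U \<and> sat B (\<sigma>(v := \<mu> xs)) \<chi>"
      unfolding b0 by auto
  qed
  also have "\<dots> \<longleftrightarrow> (\<exists>a\<in>\<mu> ` U. sat B (\<sigma>(v := a)) \<chi>)"
    using U_tuples by auto
  finally show ?case unfolding coord_mapD(2)[OF coord] by simp
next
  case (Neg \<chi>)
  have "sat C \<rho> (fm_tr \<Delta> \<chi> env ps c) \<longleftrightarrow> sat B \<sigma> \<chi>"
    by (rule Neg.IH) (use Neg.prems in auto)
  then show ?case by simp
next
  case (Conj \<chi>1 \<chi>2)
  have "sat C \<rho> (fm_tr \<Delta> \<chi>1 env ps c) \<longleftrightarrow> sat B \<sigma> \<chi>1"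
    by (rule Conj.IH(1)) (use Conj.prems in auto)
  moreover have "sat C \<rho> (fm_tr \<Delta> \<chi>2 env ps c) \<longleftrightarrow> sat B \<sigma> \<chi>2"
    by (rule Conj.IH(2)) (use Conj.prems in auto)
  ultimately show ?case by simp
qed

text \<open>Off \<open>U\<close> the translation of an equation is false, which is what makes guards work.\<close>
lemma sat_fm_tr_Eq_Var:
  assumes "env v + n \<le> c" "blk n \<rho> (env v) \<in> tuples C n" "\<And>p. p \<in> set ps \<Longrightarrow> p < c" "map \<rho> ps = q"
    "sat C \<rho> (fm_tr \<Delta> (Eq (Var v) (Var v)) env ps c)"
  shows "blk n \<rho> (env v) \<in> U"
proof -
  from assms(5) obtain xs where xs: "xs \<in> tuples C (2 * n)"
    "sat C (upd \<rho> c xs) (inst (c + 2 * n) (cE \<Delta>) (block (env v) n @ block c n @ ps))"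
    by (auto simp: Let_def sat_Exs sat_Conjs)
  have "blk n (upd \<rho> c xs) c = take n xs"
    using blk_upd[of 0 n xs \<rho> c] xs(1) by (auto simp: tuples_def)
  then have t: "blk n (upd \<rho> c xs) c \<in> tuples C n"
    using xs(1) by (auto simp: tuples_def dest: in_set_takeD)
  show ?thesis
    using sat_inst_E[of "env v" "c + 2 * n" c "upd \<rho> c xs" ps] xs(2) t assms
    by (auto simp: blk_upd_below map_upd_below trans_less_add1)
qed

end

section \<open>Composition of guarded codes\<close>

text \<open>The translation of a formula does not relativise its free variables to \<open>U\<close>; adding
  the equations \<open>x\<^sub>i = x\<^sub>i\<close>, whose translations hold only on \<open>U\<close>, repairs this.\<close>
primrec guard :: "nat \<Rightarrow> 'f fm \<Rightarrow> 'f fm" where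
  "guard 0 \<phi> = \<phi>"
| "guard (Suc m) \<phi> = Conj (Eq (Var m) (Var m)) (guard m \<phi>)"

definition guarded :: "('f \<Rightarrow> nat) \<Rightarrow> nat \<Rightarrow> 'f fm \<Rightarrow> bool" where
  "guarded ar N \<chi> \<longleftrightarrow> (\<exists>\<phi>. formula_of ar N \<phi> \<and> \<chi> = guard N \<phi>)"

definition guarded_code :: "('fa \<Rightarrow> nat) \<Rightarrow> ('fb \<Rightarrow> nat) \<Rightarrow> ('fa, 'fb) code \<Rightarrow> bool" where
  "guarded_code arA arB \<Gamma> \<longleftrightarrow>
     guarded arB (cdim \<Gamma> + cpar \<Gamma>) (cU \<Gamma>) \<and>
     guarded arB (2 * cdim \<Gamma> + cpar \<Gamma>) (cE \<Gamma>) \<and>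
     (\<forall>Q. guarded arB ((arA Q + 1) * cdim \<Gamma> + cpar \<Gamma>) (cQ \<Gamma> Q))"

lemma sat_guard: "sat S \<rho> (guard m \<phi>) = sat S \<rho> \<phi>"
  by (induction m) auto

lemma wf_guard: "wf_fm ar (guard m \<phi>) = wf_fm ar \<phi>"
  by (induction m) auto

lemma fv_guard: "fv_fm (guard m \<phi>) = {..<m} \<union> fv_fm \<phi>"
  by (induction m) (auto simp: lessThan_Suc)

lemma guarded_formula_of: "guarded ar N \<chi> \<Longrightarrow> formula_of ar N \<chi>"
  by (auto simp: guarded_def formula_of_def wf_guard fv_guard)

lemma guarded_wf_code: "guarded_code arA arB \<Gamma> \<Longrightarrow> wf_code arA arB \<Gamma>"
  by (auto simp: guarded_code_def wf_code_def guarded_formula_of)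

lemma length_chunks [simp]: "length (chunks n m xs) = m"
  by (simp add: chunks_def)

lemma chunks_append:
  assumes "length xs = m1 * n"
  shows "chunks n (m1 + m2) (xs @ ys) = chunks n m1 xs @ chunks n m2 ys"
proof (rule nth_equalityI)
  fix i assume i: "i < length (chunks n (m1 + m2) (xs @ ys))"
  show "chunks n (m1 + m2) (xs @ ys) ! i = (chunks n m1 xs @ chunks n m2 ys) ! i"
  proof (cases "i < m1")
    case True
    then have "Suc i * n \<le> m1 * n" by (intro mult_le_mono1) simp
    then show ?thesis using True assms by (simp add: chunks_def nth_append)
  next
    case False
    then obtain j where "i = m1 + j" using le_Suc_ex not_less by blast
    then show ?thesis using i assms by (simp add: chunks_def nth_append algebra_simps)
  qed
qed simp

lemma chunks_concat:
  assumes "\<And>xs. xs \<in> set xss \<Longrightarrow> length xs = m * n"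
  shows "chunks n (length xss * m) (concat xss) = concat (map (chunks n m) xss)"
  using assms
proof (induction xss)
  case (Cons xs xss)
  then show ?case using chunks_append[of xs m n "length xss * m" "concat xss"] by simp
qed (simp add: chunks_def)

lemma chunks_tuples:
  "xs \<in> tuples S (m * n) \<Longrightarrow> c \<in> set (chunks n m xs) \<Longrightarrow> c \<in> tuples S n"
  by (auto simp: chunks_def intro: tuples_take_drop)

lemma chunks_of_concat:
  assumes "\<And>x. x \<in> set xss \<Longrightarrow> length x = n"
  shows "chunks n (length xss) (concat xss) = xss"
  by (rule nth_equalityI) (use assms in \<open>auto simp: chunks_def take_drop_concat\<close>)

text \<open>The translated guards say that every block lies in \<open>U\<close>; once they hold,
  \<open>sat_fm_tr\<close> evaluates the rest. The equivalence is thus valid for all tuples over the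
  carrier, which is the range over which \<open>coord_map\<close> tests \<open>cE\<close> and
  \<open>cQ\<close>.\<close>

lemma (in interpreted) holds_translate:
  assumes "guarded arB N \<chi>" "xs \<in> tuples C (N * n)"
  shows "holds C (xs @ q) (translate \<Delta> N \<chi>) \<longleftrightarrow>
    set (chunks n N xs) \<subseteq> U \<and> holds B (map \<mu> (chunks n N xs)) \<chi>"
proof -
  obtain \<phi> where \<phi>: "formula_of arB N \<phi>" "\<chi> = guard N \<phi>"
    using assms(1) by (auto simp: guarded_def)
  let ?\<rho> = "\<lambda>i. (xs @ q) ! i" and ?env = "\<lambda>i. i * n" and ?c = "N * n + cpar \<Delta>"
  let ?ps = "[N * n..<?c]"
  have lx: "length xs = N * n" using assms(2) by (simp add: tuples_def)
  have lq: "length q = cpar \<Delta>" using q_tuples by (simp add: tuples_def)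
  have le: "i * n + n \<le> N * n" if "i < N" for i
    using mult_le_mono1[of "Suc i" N n] that by simp
  have blk: "blk n ?\<rho> (?env i) = chunks n N xs ! i" if "i < N" for i
    by (rule nth_equalityI) (use le[OF that] that lx in \<open>auto simp: chunks_def block_def nth_append\<close>)
  have chunk: "chunks n N xs ! i \<in> tuples C n" if "i < N" for i
    using chunks_tuples[OF assms(2)] that by simp
  have envc: "?env i + n \<le> ?c" if "i < N" for i using le[OF that] by simp
  have psq: "map ?\<rho> ?ps = q"
    by (rule nth_equalityI) (use lx lq in \<open>auto simp: nth_append\<close>)
  have Eq: "sat C ?\<rho> (fm_tr \<Delta> (Eq (Var i) (Var i)) ?env ?ps ?c) \<longleftrightarrow> chunks n N xs ! i \<in> U"
    if i: "i < N" for i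
  proof
    assume "sat C ?\<rho> (fm_tr \<Delta> (Eq (Var i) (Var i)) ?env ?ps ?c)"
    then have "blk n ?\<rho> (?env i) \<in> U"
      by (rule sat_fm_tr_Eq_Var[rotated 4]) (use i envc psq chunk blk in auto)
    then show "chunks n N xs ! i \<in> U" by (simp only: blk[OF i])
  next
    assume "chunks n N xs ! i \<in> U"
    then have "sat C ?\<rho> (fm_tr \<Delta> (Eq (Var i) (Var i)) ?env ?ps ?c) \<longleftrightarrow>
      sat B (\<lambda>j. \<mu> (chunks n N xs ! j)) (Eq (Var i) (Var i))"
      by (intro sat_fm_tr) (use i envc psq blk in auto)
    then show "sat C ?\<rho> (fm_tr \<Delta> (Eq (Var i) (Var i)) ?env ?ps ?c)" by simp
  qed
  have split: "sat C ?\<rho> (fm_tr \<Delta> (guard m \<phi>) ?env ?ps ?c) \<longleftrightarrow>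
     (\<forall>i<m. sat C ?\<rho> (fm_tr \<Delta> (Eq (Var i) (Var i)) ?env ?ps ?c)) \<and>
     sat C ?\<rho> (fm_tr \<Delta> \<phi> ?env ?ps ?c)" for m
    by (induction m) (auto simp: less_Suc_eq simp del: fm_tr.simps(1))
  have set: "set (chunks n N xs) \<subseteq> U \<longleftrightarrow> (\<forall>i<N. chunks n N xs ! i \<in> U)"
    by (auto simp: set_conv_nth)
  have body: "sat C ?\<rho> (fm_tr \<Delta> \<phi> ?env ?ps ?c) \<longleftrightarrow> holds B (map \<mu> (chunks n N xs)) \<chi>"
    if "set (chunks n N xs) \<subseteq> U"
  proof -
    have "sat C ?\<rho> (fm_tr \<Delta> \<phi> ?env ?ps ?c) \<longleftrightarrow> sat B (\<lambda>i. map \<mu> (chunks n N xs) ! i) \<phi>"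
    proof (rule sat_fm_tr)
      fix v assume "v \<in> fv_fm \<phi>"
      then have v: "v < N" using \<phi>(1) by (auto simp: formula_of_def)
      show "v * n + n \<le> ?c \<and> blk n ?\<rho> (v * n) \<in> U \<and> \<mu> (blk n ?\<rho> (v * n)) = map \<mu> (chunks n N xs) ! v"
        unfolding blk[OF v] using envc[OF v] that set v by auto
    qed (use \<phi>(1) psq in \<open>auto simp: formula_of_def\<close>)
    then show ?thesis by (simp add: \<phi>(2) holds_def sat_guard)
  qed
  have "holds C (xs @ q) (translate \<Delta> N \<chi>) \<longleftrightarrow> set (chunks n N xs) \<subseteq> U \<and>
     sat C ?\<rho> (fm_tr \<Delta> \<phi> ?env ?ps ?c)"
    unfolding holds_def translate_def \<phi>(2) split set using Eq by auto
  then show ?thesis using body by blast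
qed

text \<open>Every formula of the composed code translates a guarded formula, so
  \<open>holds_translate\<close> reduces it to the original formula of \<open>\<Gamma>\<close> at
  the \<open>\<mu>\<close>-images of the blocks. Any codes \<open>pp\<close> of the parameters
  \<open>p\<close> may be used.\<close>

lemma (in interpreted) comp_coord_map:
  assumes \<Gamma>: "coord_map arA \<Gamma> B p A \<nu>" "guarded_code arA arB \<Gamma>"
    and pp: "length pp = cpar \<Gamma> * n" "set (chunks n (cpar \<Gamma>) pp) \<subseteq> U"
      "map \<mu> (chunks n (cpar \<Gamma>) pp) = p"
  shows Uset_comp: "Uset (comp_code arA \<Gamma> \<Delta>) C (pp @ q) = {xs \<in> tuples C (cdim \<Gamma> * n).
      set (chunks n (cdim \<Gamma>) xs) \<subseteq> U \<and> map \<mu> (chunks n (cdim \<Gamma>) xs) \<in> Uset \<Gamma> B p}" (is ?U)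
    and coord_map_comp: "coord_map arA (comp_code arA \<Gamma> \<Delta>) C (pp @ q) A
      (\<lambda>u. \<nu> (map \<mu> (chunks n (cdim \<Gamma>) u)))" (is ?map)
proof -
  let ?G = "comp_code arA \<Gamma> \<Delta>" and ?ch = "\<lambda>xs. chunks n (cdim \<Gamma>) xs"
  let ?UG = "{xs \<in> tuples C (cdim \<Gamma> * n). set (?ch xs) \<subseteq> U \<and> map \<mu> (?ch xs) \<in> Uset \<Gamma> B p}"
  \<comment> \<open>Only the blocks of \<open>pp\<close> are known to be codes; as \<open>pp\<close>
    is their concatenation, its entries lie in the carrier.\<close>
  have pp_tuples: "pp \<in> tuples C (cpar \<Gamma> * n)"
  proof -
    have "concat (chunks n (cpar \<Gamma>) pp) = pp"
    proof -
      have *: "take (m * n) pp = concat (chunks n m pp)" if "m * n \<le> length pp" for m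
        using that
      proof (induction m)
        case (Suc m)
        have "take (Suc m * n) pp = take (m * n) pp @ take n (drop (m * n) pp)"
          by (simp only: mult_Suc add.commute[of n] take_add)
        then show ?case using Suc by (simp add: chunks_def)
      qed (simp add: chunks_def)
      then show ?thesis using pp(1) by (metis order_refl take_all)
    qed
    moreover have "set (concat (chunks n (cpar \<Gamma>) pp)) \<subseteq> carrier C"
      using pp(2) U_tuples by (fastforce simp: tuples_def)
    ultimately show ?thesis using pp(1) by (simp add: tuples_def)
  qed
  have img: "map \<mu> (?ch xs) \<in> tuples B (cdim \<Gamma>)" if "set (?ch xs) \<subseteq> U" for xs
    using that mu_carrier by (auto simp: tuples_def)
  have U_mem: "xs \<in> Uset ?G C (pp @ q) \<longleftrightarrow> xs \<in> ?UG" for xs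
  proof (cases "xs \<in> tuples C (cdim \<Gamma> * n)")
    case True
    have "holds C ((xs @ pp) @ q) (translate \<Delta> (cdim \<Gamma> + cpar \<Gamma>) (cU \<Gamma>)) \<longleftrightarrow>
      set (chunks n (cdim \<Gamma> + cpar \<Gamma>) (xs @ pp)) \<subseteq> U \<and>
      holds B (map \<mu> (chunks n (cdim \<Gamma> + cpar \<Gamma>) (xs @ pp))) (cU \<Gamma>)"
      by (rule holds_translate)
        (use \<Gamma>(2) tuples_append[OF True pp_tuples] in \<open>auto simp: guarded_code_def add_mult_distrib\<close>)
    moreover have "chunks n (cdim \<Gamma> + cpar \<Gamma>) (xs @ pp) = ?ch xs @ chunks n (cpar \<Gamma>) pp"
      by (rule chunks_append) (use True in \<open>simp add: tuples_def\<close>)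
    ultimately show ?thesis
      using True pp img[of xs] by (auto simp: Uset_def comp_code_def)
  qed (simp add: Uset_def comp_code_def)
  then show U: ?U by blast
  have dim: "cdim ?G = cdim \<Gamma> * n" "cpar ?G = cpar \<Gamma> * n + cpar \<Delta>"
    by (simp_all add: comp_code_def)
  have par: "pp @ q \<in> tuples C (cpar ?G)"
    unfolding dim by (rule tuples_append[OF pp_tuples q_tuples])
  have onto: "(\<lambda>u. \<nu> (map \<mu> (?ch u))) ` Uset ?G C (pp @ q) = carrier A"
  proof
    show "(\<lambda>u. \<nu> (map \<mu> (?ch u))) ` Uset ?G C (pp @ q) \<subseteq> carrier A"
      unfolding U coord_mapD(2)[OF \<Gamma>(1), symmetric] by auto
    show "carrier A \<subseteq> (\<lambda>u. \<nu> (map \<mu> (?ch u))) ` Uset ?G C (pp @ q)"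
    proof
      fix a assume "a \<in> carrier A"
      then have "a \<in> \<nu> ` Uset \<Gamma> B p" using coord_mapD(2)[OF \<Gamma>(1)] by simp
      then obtain ys where ys: "ys \<in> Uset \<Gamma> B p" "\<nu> ys = a" by force
      have "\<forall>y\<in>set ys. \<exists>x. x \<in> U \<and> \<mu> x = y"
      proof
        fix y assume "y \<in> set ys"
        then have "y \<in> carrier B" using ys(1) by (auto simp: Uset_def tuples_def)
        then have "y \<in> \<mu> ` U" using coord_mapD(2)[OF coord] by simp
        then show "\<exists>x. x \<in> U \<and> \<mu> x = y" by force
      qed
      then obtain f where f: "\<And>y. y \<in> set ys \<Longrightarrow> f y \<in> U \<and> \<mu> (f y) = y" by metis
      let ?u = "concat (map f ys)"
      have len: "length x = n" if "x \<in> set (map f ys)" for x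
        using that f U_tuples by (auto simp: tuples_def)
      have lys: "length ys = cdim \<Gamma>" using ys(1) by (simp add: Uset_def tuples_def)
      have ch: "?ch ?u = map f ys"
        using chunks_of_concat[of "map f ys" n] len lys by simp
      have "length ?u = cdim \<Gamma> * n"
        using length_concat_const[of "map f ys" n] len lys by simp
      moreover have "set ?u \<subseteq> carrier C"
        using f U_tuples by (fastforce simp: tuples_def)
      moreover have "map \<mu> (?ch ?u) = ys"
        unfolding ch by (simp add: f map_idI)
      ultimately have "?u \<in> ?UG" "\<nu> (map \<mu> (?ch ?u)) = a"
        using ys f by (auto simp: ch tuples_def)
      then show "a \<in> (\<lambda>u. \<nu> (map \<mu> (?ch u))) ` Uset ?G C (pp @ q)"
        unfolding U by blast
    qed
  qed
  have E: "holds C (xs @ ys @ pp @ q) (cE ?G) \<longleftrightarrow> xs \<in> Uset ?G C (pp @ q) \<and>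
      ys \<in> Uset ?G C (pp @ q) \<and> \<nu> (map \<mu> (?ch xs)) = \<nu> (map \<mu> (?ch ys))"
    if xy: "xs \<in> tuples C (cdim \<Gamma> * n)" "ys \<in> tuples C (cdim \<Gamma> * n)" for xs ys
  proof -
    have lxy: "length xs = cdim \<Gamma> * n" "length ys = cdim \<Gamma> * n" using xy by (auto simp: tuples_def)
    have "holds C ((xs @ ys @ pp) @ q) (translate \<Delta> (2 * cdim \<Gamma> + cpar \<Gamma>) (cE \<Gamma>)) \<longleftrightarrow>
      set (chunks n (2 * cdim \<Gamma> + cpar \<Gamma>) (xs @ ys @ pp)) \<subseteq> U \<and>
      holds B (map \<mu> (chunks n (2 * cdim \<Gamma> + cpar \<Gamma>) (xs @ ys @ pp))) (cE \<Gamma>)"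
      by (rule holds_translate)
        (use \<Gamma>(2) tuples_append[OF xy(1) tuples_append[OF xy(2) pp_tuples]]
          in \<open>auto simp: guarded_code_def add_mult_distrib mult_2 add.assoc\<close>)
    moreover have "chunks n (2 * cdim \<Gamma> + cpar \<Gamma>) (xs @ ys @ pp) = ?ch xs @ ?ch ys @ chunks n (cpar \<Gamma>) pp"
      using chunks_append[OF lxy(1), of "cdim \<Gamma> + cpar \<Gamma>" "ys @ pp"] chunks_append[OF lxy(2), of "cpar \<Gamma>" pp]
      by (simp add: mult_2 add.assoc)
    ultimately have "holds C (xs @ ys @ pp @ q) (cE ?G) \<longleftrightarrow> set (?ch xs) \<subseteq> U \<and> set (?ch ys) \<subseteq> U \<and>
       holds B (map \<mu> (?ch xs) @ map \<mu> (?ch ys) @ p) (cE \<Gamma>)"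
      using pp by (auto simp: comp_code_def)
    also have "\<dots> \<longleftrightarrow> set (?ch xs) \<subseteq> U \<and> set (?ch ys) \<subseteq> U \<and> map \<mu> (?ch xs) \<in> Uset \<Gamma> B p \<and>
       map \<mu> (?ch ys) \<in> Uset \<Gamma> B p \<and> \<nu> (map \<mu> (?ch xs)) = \<nu> (map \<mu> (?ch ys))"
      using coord_mapD(3)[OF \<Gamma>(1) img img] by blast
    finally show ?thesis unfolding U using xy by blast
  qed
  have Q: "holds C (concat xss @ pp @ q) (cQ ?G Q) \<longleftrightarrow> (\<forall>xs\<in>set xss. xs \<in> Uset ?G C (pp @ q)) \<and>
      interp A Q (map (\<lambda>u. \<nu> (map \<mu> (?ch u))) (butlast xss)) = \<nu> (map \<mu> (?ch (last xss)))"
    if len: "length xss = arA Q + 1" and xss: "\<forall>xs\<in>set xss. xs \<in> tuples C (cdim \<Gamma> * n)" for Q xss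
  proof -
    let ?N = "(arA Q + 1) * cdim \<Gamma>"
    have lx: "length xs = cdim \<Gamma> * n" if "xs \<in> set xss" for xs using xss that by (auto simp: tuples_def)
    have lc: "length (concat xss) = ?N * n"
      using length_concat_const[OF lx] len by (simp add: algebra_simps)
    then have "concat xss \<in> tuples C (?N * n)"
      using xss by (fastforce simp: tuples_def)
    from tuples_append[OF this pp_tuples]
    have "holds C ((concat xss @ pp) @ q) (translate \<Delta> (?N + cpar \<Gamma>) (cQ \<Gamma> Q)) \<longleftrightarrow>
      set (chunks n (?N + cpar \<Gamma>) (concat xss @ pp)) \<subseteq> U \<and>
      holds B (map \<mu> (chunks n (?N + cpar \<Gamma>) (concat xss @ pp))) (cQ \<Gamma> Q)"
      by (intro holds_translate) (use \<Gamma>(2) in \<open>auto simp: guarded_code_def add_mult_distrib\<close>)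
    moreover have "chunks n (?N + cpar \<Gamma>) (concat xss @ pp) = concat (map ?ch xss) @ chunks n (cpar \<Gamma>) pp"
      using chunks_append[OF lc, of "cpar \<Gamma>" pp] chunks_concat[of xss "cdim \<Gamma>" n] lx len by simp
    ultimately have "holds C (concat xss @ pp @ q) (cQ ?G Q) \<longleftrightarrow> (\<forall>xs\<in>set xss. set (?ch xs) \<subseteq> U) \<and>
       holds B (concat (map (\<lambda>xs. map \<mu> (?ch xs)) xss) @ p) (cQ \<Gamma> Q)"
      using pp by (auto simp: comp_code_def map_concat comp_def)
    also have "\<dots> \<longleftrightarrow> (\<forall>xs\<in>set xss. set (?ch xs) \<subseteq> U) \<and>
       (\<forall>ys\<in>set (map (\<lambda>xs. map \<mu> (?ch xs)) xss). ys \<in> Uset \<Gamma> B p) \<and>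
       interp A Q (map \<nu> (butlast (map (\<lambda>xs. map \<mu> (?ch xs)) xss))) = \<nu> (last (map (\<lambda>xs. map \<mu> (?ch xs)) xss))"
    proof (rule conj_cong[OF HOL.refl])
      assume sub: "\<forall>xs\<in>set xss. set (?ch xs) \<subseteq> U"
      show "holds B (concat (map (\<lambda>xs. map \<mu> (?ch xs)) xss) @ p) (cQ \<Gamma> Q) \<longleftrightarrow>
       (\<forall>ys\<in>set (map (\<lambda>xs. map \<mu> (?ch xs)) xss). ys \<in> Uset \<Gamma> B p) \<and>
       interp A Q (map \<nu> (butlast (map (\<lambda>xs. map \<mu> (?ch xs)) xss))) = \<nu> (last (map (\<lambda>xs. map \<mu> (?ch xs)) xss))"
        by (rule coord_mapD(4)[OF \<Gamma>(1)]) (use len sub img in auto)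
    qed
    moreover have "xss \<noteq> []" using len by auto
    ultimately show ?thesis unfolding U using xss
      by (auto simp: map_butlast[symmetric] last_map comp_def)
  qed
  show ?map unfolding coord_map_def dim using par[unfolded dim] onto E Q by blast
qed

lemma coord_map_interpreted:
  "coord_map arB \<Delta> C q B \<mu> \<Longrightarrow> guarded_code arB arC \<Delta> \<Longrightarrow> is_struct arB B \<Longrightarrow>
    interpreted arB arC \<Delta> C q B \<mu>"
  by (simp add: interpreted_def guarded_wf_code)

lemma chunks_mult_0 [simp]: "chunks n 0 xs = []"
  by (simp add: chunks_def)

text \<open>The maps \<open>M q\<close> are the coordinate maps of \<open>\<Gamma>\<close>, chosen depending on the parameters \<open>q\<close>
  of \<open>\<Delta>\<close>.  In the hypothesis on \<open>\<theta>B\<close> the pair \<open>(q, q')\<close> ranges over all pairs of parameters,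
  since condition (3) concerns codes of \<open>q'\<close> with respect to one fixed coordinate map of \<open>\<Gamma>\<close>.\<close>
lemma strongly_regularly_biinterpretableI:
  fixes A :: "('fa, 'a) struct" and B :: "('fb, 'b) struct"
    and M :: "'a list \<Rightarrow> 'b list \<Rightarrow> 'a" and D :: "'a list \<Rightarrow> 'a list \<Rightarrow> 'b"
  assumes A: "is_struct arA A" and B: "is_struct arB B"
    and \<Gamma>: "guarded_code arA arB \<Gamma>" "cpar \<Gamma> = 0" and \<Delta>: "guarded_code arB arA \<Delta>"
    and \<phi>: "formula_of arB 0 \<phi>" "holds B [] \<phi>"
    and \<psi>: "guarded arA (cpar \<Delta>) \<psi>" "q0 \<in> defset A (cpar \<Delta>) \<psi>"
    and \<theta>A: "formula_of arA (cdim \<Gamma> * cdim \<Delta> + 1 + cpar \<Delta>) \<theta>A"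
    and \<theta>B: "formula_of arB (cdim \<Gamma> * cdim \<Delta> + 1 + cpar \<Delta> * cdim \<Gamma>) \<theta>B"
    and M: "\<And>q. q \<in> defset A (cpar \<Delta>) \<psi> \<Longrightarrow> coord_map arA \<Gamma> B [] A (M q)"
    and D: "\<And>q. q \<in> defset A (cpar \<Delta>) \<psi> \<Longrightarrow> coord_map arB \<Delta> A q B (D q)"
    and defA: "\<And>q. q \<in> defset A (cpar \<Delta>) \<psi> \<Longrightarrow> defines_map A \<theta>A (cdim \<Gamma> * cdim \<Delta>) q
      {u \<in> tuples A (cdim \<Gamma> * cdim \<Delta>). set (chunks (cdim \<Delta>) (cdim \<Gamma>) u) \<subseteq> Uset \<Delta> A q \<and>
         map (D q) (chunks (cdim \<Delta>) (cdim \<Gamma>) u) \<in> Uset \<Gamma> B []}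
      (\<lambda>u. M q (map (D q) (chunks (cdim \<Delta>) (cdim \<Gamma>) u)))"
    and defB: "\<And>q q' qq. q \<in> defset A (cpar \<Delta>) \<psi> \<Longrightarrow> q' \<in> defset A (cpar \<Delta>) \<psi> \<Longrightarrow>
      length qq = cpar \<Delta> * cdim \<Gamma> \<Longrightarrow> set (chunks (cdim \<Gamma>) (cpar \<Delta>) qq) \<subseteq> Uset \<Gamma> B [] \<Longrightarrow>
      map (M q) (chunks (cdim \<Gamma>) (cpar \<Delta>) qq) = q' \<Longrightarrow>
      defines_map B \<theta>B (cdim \<Gamma> * cdim \<Delta>) qq
      {u \<in> tuples B (cdim \<Delta> * cdim \<Gamma>). set (chunks (cdim \<Gamma>) (cdim \<Delta>) u) \<subseteq> Uset \<Gamma> B [] \<and>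
         map (M q) (chunks (cdim \<Gamma>) (cdim \<Delta>) u) \<in> Uset \<Delta> A q'}
      (\<lambda>u. D q' (map (M q) (chunks (cdim \<Gamma>) (cdim \<Delta>) u)))"
  shows "strongly_regularly_biinterpretable arA A arB B"
proof -
  let ?GD = "comp_code arA \<Gamma> \<Delta>" and ?DG = "comp_code arB \<Delta> \<Gamma>"
  let ?rA = "comp_par_fm \<Gamma> \<phi> \<Delta> \<psi>" and ?tB = "comp_par_fm \<Delta> \<psi> \<Gamma> \<phi>"
  let ?nn = "cdim \<Gamma> * cdim \<Delta>" and ?Psi = "defset A (cpar \<Delta>) \<psi>"
  have cGD: "cpar ?GD = cpar \<Delta>" and cDG: "cpar ?DG = cpar \<Delta> * cdim \<Gamma>"
    using \<Gamma>(2) by (simp_all add: comp_code_def)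
  \<comment> \<open>With no parameters for \<open>\<Gamma>\<close>, the empty tuple is the only one,
    so the parameters of the composition \<open>?GD\<close> are just those of
    \<open>\<Delta>\<close>.\<close>
  have Phi: "defset B (cpar \<Gamma>) \<phi> = {[]}"
    using \<phi>(2) \<Gamma>(2) by (auto simp: defset_def tuples_def)
  have iD: "interpreted arB arA \<Delta> A q B (D q)" if "q \<in> ?Psi" for q
    by (rule coord_map_interpreted[OF D[OF that] \<Delta> B])
  have iM: "interpreted arA arB \<Gamma> B [] A (M q)" if "q \<in> ?Psi" for q
    by (rule coord_map_interpreted[OF M[OF that] \<Gamma>(1) A])
  note compA = interpreted.comp_coord_map[OF iD M \<Gamma>(1), of _ _ "[]", simplified \<Gamma>(2), simplified]
  have compB: "Uset ?DG B qq = {u \<in> tuples B (cdim \<Delta> * cdim \<Gamma>).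
       set (chunks (cdim \<Gamma>) (cdim \<Delta>) u) \<subseteq> Uset \<Gamma> B [] \<and>
       map (M q) (chunks (cdim \<Gamma>) (cdim \<Delta>) u) \<in> Uset \<Delta> A q'} \<and>
      coord_map arB ?DG B qq B (\<lambda>u. D q' (map (M q) (chunks (cdim \<Gamma>) (cdim \<Delta>) u)))"
    if "q \<in> ?Psi" "q' \<in> ?Psi" "length qq = cpar \<Delta> * cdim \<Gamma>"
      "set (chunks (cdim \<Gamma>) (cpar \<Delta>) qq) \<subseteq> Uset \<Gamma> B []"
      "map (M q) (chunks (cdim \<Gamma>) (cpar \<Delta>) qq) = q'" for q q' qq
    using interpreted.comp_coord_map[OF iM[OF that(1)] D[OF that(2)] \<Delta> that(3-5)] by simp
  have one: "regular_interp arA arB \<Gamma> \<phi> A B" "regular_interp arB arA \<Delta> \<psi> B A"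
    using \<Gamma> \<Delta> \<phi>(1) \<psi> M D Phi by (auto simp: regular_interp_def guarded_wf_code guarded_formula_of interprets_def)
  have two: "\<exists>\<mu>. coord_map arA ?GD A r0 A \<mu> \<and> defines_map A \<theta>A ?nn r0 (Uset ?GD A r0) \<mu>"
    if "r0 \<in> defset A (cpar ?GD) ?rA" for r0
  proof -
    \<comment> \<open>The shift by \<open>cpar \<Gamma> * cdim \<Delta>\<close> in
      \<open>comp_par_fm\<close> is zero here.\<close>
    have "r0 \<in> tuples A (cpar \<Delta>)" "holds A r0 (rename_fm (\<lambda>v. v) \<psi>)"
      using that cGD \<Gamma>(2) by (auto simp: defset_def comp_par_fm_def holds_def)
    then have q: "r0 \<in> ?Psi"
      by (simp add: defset_def holds_def sat_rename comp_def)
    show ?thesis using compA[OF q q] defA[OF q] by auto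
  qed
  have three: "\<exists>\<mu>. coord_map arB ?DG B t0 B \<mu> \<and> defines_map B \<theta>B ?nn t0 (Uset ?DG B t0) \<mu>"
    if "t0 \<in> defset B (cpar ?DG) ?tB" for t0
  proof -
    \<comment> \<open>Condition (3) asks for some coordinate map only, so the codes
      \<open>t0\<close> may be decoded with the map of the known parameter \<open>q0\<close>. The
      decoded tuple \<open>?q\<close> is in general a different parameter, which is why
      \<open>defB\<close> treats pairs.\<close>
    interpret interpreted arA arB \<Gamma> B "[]" A "M q0" by (rule iM[OF \<psi>(2)])
    have t: "t0 \<in> tuples B (cpar \<Delta> * cdim \<Gamma>)" "holds B (t0 @ []) (translate \<Gamma> (cpar \<Delta>) \<psi>)"
      using that cDG by (auto simp: defset_def comp_par_fm_def holds_def)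
    let ?q = "map (M q0) (chunks (cdim \<Gamma>) (cpar \<Delta>) t0)"
    from t have u: "set (chunks (cdim \<Gamma>) (cpar \<Delta>) t0) \<subseteq> Uset \<Gamma> B []" "holds A ?q \<psi>"
      using holds_translate[OF \<psi>(1) t(1)] by auto
    then have q: "?q \<in> ?Psi"
      using mu_carrier by (auto simp: defset_def tuples_def)
    have "length t0 = cpar \<Delta> * cdim \<Gamma>" using t(1) by (simp add: tuples_def)
    from compB[OF \<psi>(2) q this u(1) HOL.refl] defB[OF \<psi>(2) q this u(1) HOL.refl]
    show ?thesis by (auto simp: mult.commute)
  qed
  have four: "\<exists>\<mu>\<Gamma> \<mu>\<Delta>. coord_map arA \<Gamma> B p A \<mu>\<Gamma> \<and> coord_map arB \<Delta> A q B \<mu>\<Delta> \<and>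
           (\<forall>pp. length pp = cpar \<Gamma> * cdim \<Delta> \<and>
                 (\<forall>c\<in>set (chunks (cdim \<Delta>) (cpar \<Gamma>) pp). c \<in> Uset \<Delta> A q) \<and>
                 map \<mu>\<Delta> (chunks (cdim \<Delta>) (cpar \<Gamma>) pp) = p \<longrightarrow>
              defines_map A \<theta>A ?nn (pp @ q) (Uset ?GD A (pp @ q))
                (\<lambda>u. \<mu>\<Gamma> (map \<mu>\<Delta> (chunks (cdim \<Delta>) (cdim \<Gamma>) u)))) \<and>
           (\<forall>qq. length qq = cpar \<Delta> * cdim \<Gamma> \<and>
                 (\<forall>c\<in>set (chunks (cdim \<Gamma>) (cpar \<Delta>) qq). c \<in> Uset \<Gamma> B p) \<and>
                 map \<mu>\<Gamma> (chunks (cdim \<Gamma>) (cpar \<Delta>) qq) = q \<longrightarrow>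
              defines_map B \<theta>B ?nn (qq @ p) (Uset ?DG B (qq @ p))
                (\<lambda>u. \<mu>\<Delta> (map \<mu>\<Gamma> (chunks (cdim \<Gamma>) (cdim \<Delta>) u))))"
    if "p \<in> defset B (cpar \<Gamma>) \<phi>" and q: "q \<in> ?Psi" for p q
  proof (intro exI[of _ "M q"] exI[of _ "D q"] conjI allI impI)
    have p: "p = []" using that(1) Phi by simp
    show "coord_map arA \<Gamma> B p A (M q)" using M[OF q] p by simp
    show "coord_map arB \<Delta> A q B (D q)" by (rule D[OF q])
    show "defines_map A \<theta>A ?nn (pp @ q) (Uset ?GD A (pp @ q))
          (\<lambda>u. M q (map (D q) (chunks (cdim \<Delta>) (cdim \<Gamma>) u)))"
      if "length pp = cpar \<Gamma> * cdim \<Delta> \<and> (\<forall>c\<in>set (chunks (cdim \<Delta>) (cpar \<Gamma>) pp). c \<in> Uset \<Delta> A q) \<and>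
        map (D q) (chunks (cdim \<Delta>) (cpar \<Gamma>) pp) = p" for pp
      using that \<Gamma>(2) compA[OF q q] defA[OF q] by simp
    show "defines_map B \<theta>B ?nn (qq @ p) (Uset ?DG B (qq @ p))
          (\<lambda>u. D q (map (M q) (chunks (cdim \<Gamma>) (cdim \<Delta>) u)))"
      if "length qq = cpar \<Delta> * cdim \<Gamma> \<and> (\<forall>c\<in>set (chunks (cdim \<Gamma>) (cpar \<Delta>) qq). c \<in> Uset \<Gamma> B p) \<and>
        map (M q) (chunks (cdim \<Gamma>) (cpar \<Delta>) qq) = q" for qq
      using that compB[OF q q, of qq] defB[OF q q, of qq] p by (auto simp: subset_iff)
  qed
  show ?thesis
    unfolding strongly_regularly_biinterpretable_def Let_def
    by (intro exI[of _ \<Gamma>] exI[of _ \<phi>] exI[of _ \<Delta>] exI[of _ \<psi>] exI[of _ \<theta>A] exI[of _ \<theta>B] conjI ballI)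
      (use one two three four \<theta>A \<theta>B cGD cDG in auto)
qed

section \<open>Definable relations\<close>

text \<open>Structures are viewed through an injection \<open>h\<close> of the carrier into a convenient type.
  Environments are de Bruijn: a quantifier binds index 0 and shifts the others.\<close>
locale viewed =
  fixes ar :: "'f \<Rightarrow> nat" and S :: "('f, 'a) struct" and h :: "'a \<Rightarrow> 'v"
  assumes struct: "is_struct ar S" and inj: "inj_on h (carrier S)"
begin

definition env :: "nat \<Rightarrow> (nat \<Rightarrow> 'a) \<Rightarrow> bool" where
  "env n \<rho> \<longleftrightarrow> (\<forall>i<n. \<rho> i \<in> carrier S)"

text \<open>Terms and formulas are represented by the functions and relations that they induce on
  views. Definability then becomes a goal about lambda terms that introduction rules can decompose,
  and no formula has to be written down.\<close>

definition T :: "nat \<Rightarrow> ((nat \<Rightarrow> 'v) \<Rightarrow> 'v) \<Rightarrow> bool" where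
  "T n t \<longleftrightarrow> (\<exists>s. wf_trm ar s \<and> fv_trm s \<subseteq> {..<n} \<and>
     (\<forall>\<rho>. env n \<rho> \<longrightarrow> h (eval S \<rho> s) = t (\<lambda>i. h (\<rho> i))))"

definition D :: "nat \<Rightarrow> ((nat \<Rightarrow> 'v) \<Rightarrow> bool) \<Rightarrow> bool" where
  "D n R \<longleftrightarrow> (\<exists>\<phi>. formula_of ar n \<phi> \<and> (\<forall>\<rho>. env n \<rho> \<longrightarrow> sat S \<rho> \<phi> = R (\<lambda>i. h (\<rho> i))))"

lemma D_formula:
  assumes "D n R"
  obtains \<phi> where "formula_of ar n \<phi>" "\<And>xs. xs \<in> tuples S n \<Longrightarrow> holds S xs \<phi> \<longleftrightarrow> R (\<lambda>i. h (xs ! i))"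
proof -
  obtain \<phi> where \<phi>: "formula_of ar n \<phi>" "\<forall>\<rho>. env n \<rho> \<longrightarrow> sat S \<rho> \<phi> = R (\<lambda>i. h (\<rho> i))"
    using assms by (auto simp: D_def)
  moreover have "holds S xs \<phi> \<longleftrightarrow> R (\<lambda>i. h (xs ! i))" if "xs \<in> tuples S n" for xs
  proof -
    have "env n (\<lambda>i. xs ! i)" using that by (auto simp: env_def tuples_def)
    then show ?thesis using \<phi>(2) by (simp add: holds_def)
  qed
  ultimately show ?thesis using that by blast
qed

lemma D_guarded:
  assumes "D n R"
  obtains \<phi> where "guarded ar n \<phi>" "\<And>xs. xs \<in> tuples S n \<Longrightarrow> holds S xs \<phi> \<longleftrightarrow> R (\<lambda>i. h (xs ! i))"
proof -
  obtain \<phi> where \<phi>: "formula_of ar n \<phi>" "\<And>xs. xs \<in> tuples S n \<Longrightarrow> holds S xs \<phi> \<longleftrightarrow> R (\<lambda>i. h (xs ! i))"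
    using D_formula[OF assms] by blast
  then show ?thesis
    by (intro that[of "guard n \<phi>"]) (auto simp: guarded_def holds_def sat_guard)
qed

lemma T_var: "i < n \<Longrightarrow> T n (\<lambda>\<rho>. \<rho> i)"
  unfolding T_def by (rule exI[of _ "Var i"]) auto

lemma T_app0:
  assumes "ar f = 0" "h (interp S f []) = c"
  shows "T n (\<lambda>\<rho>. c)"
  unfolding T_def by (rule exI[of _ "App f []"]) (use assms in auto)

lemma T_app1:
  assumes "ar f = 1" "\<And>x. x \<in> carrier S \<Longrightarrow> h (interp S f [x]) = F (h x)" "T n t"
  shows "T n (\<lambda>\<rho>. F (t \<rho>))"
proof -
  obtain s where s: "wf_trm ar s" "fv_trm s \<subseteq> {..<n}"
    "\<And>\<rho>. env n \<rho> \<Longrightarrow> h (eval S \<rho> s) = t (\<lambda>i. h (\<rho> i))"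
    using assms(3) by (auto simp: T_def)
  have "eval S \<rho> s \<in> carrier S" if "env n \<rho>" for \<rho>
    by (rule eval_closed[OF struct s(1)]) (use s(2) that in \<open>auto simp: env_def\<close>)
  then show ?thesis unfolding T_def
    by (intro exI[of _ "App f [s]"]) (use s assms in auto)
qed

lemma T_app2:
  assumes "ar f = 2" "\<And>x y. x \<in> carrier S \<Longrightarrow> y \<in> carrier S \<Longrightarrow> h (interp S f [x, y]) = F (h x) (h y)"
    "T n t" "T n t'"
  shows "T n (\<lambda>\<rho>. F (t \<rho>) (t' \<rho>))"
proof -
  obtain s where s: "wf_trm ar s" "fv_trm s \<subseteq> {..<n}"
    "\<And>\<rho>. env n \<rho> \<Longrightarrow> h (eval S \<rho> s) = t (\<lambda>i. h (\<rho> i))"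
    using assms(3) by (auto simp: T_def)
  obtain s' where s': "wf_trm ar s'" "fv_trm s' \<subseteq> {..<n}"
    "\<And>\<rho>. env n \<rho> \<Longrightarrow> h (eval S \<rho> s') = t' (\<lambda>i. h (\<rho> i))"
    using assms(4) by (auto simp: T_def)
  have "eval S \<rho> s \<in> carrier S" if "env n \<rho>" for \<rho>
    by (rule eval_closed[OF struct s(1)]) (use s(2) that in \<open>auto simp: env_def\<close>)
  moreover have "eval S \<rho> s' \<in> carrier S" if "env n \<rho>" for \<rho>
    by (rule eval_closed[OF struct s'(1)]) (use s'(2) that in \<open>auto simp: env_def\<close>)
  ultimately show ?thesis unfolding T_def
    by (intro exI[of _ "App f [s, s']"]) (use s s' assms in auto)
qed

lemma D_cong:
  assumes "D n R" "\<And>\<rho>. (\<And>i. i < n \<Longrightarrow> \<rho> i \<in> h ` carrier S) \<Longrightarrow> R' \<rho> \<longleftrightarrow> R \<rho>"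
  shows "D n R'"
proof -
  from assms(1) obtain \<phi> where \<phi>: "formula_of ar n \<phi>" "\<forall>\<rho>. env n \<rho> \<longrightarrow> sat S \<rho> \<phi> = R (\<lambda>i. h (\<rho> i))"
    by (auto simp: D_def)
  have "sat S \<rho> \<phi> = R' (\<lambda>i. h (\<rho> i))" if "env n \<rho>" for \<rho>
    using \<phi>(2) that assms(2)[of "\<lambda>i. h (\<rho> i)"] by (auto simp: env_def)
  then show ?thesis unfolding D_def using \<phi>(1) by blast
qed

text \<open>Injectivity of \<open>h\<close> makes equality of views the same as equality of
  elements.\<close>

lemma D_eq:
  assumes "T n t" "T n t'"
  shows "D n (\<lambda>\<rho>. t \<rho> = t' \<rho>)"
proof -
  obtain s where s: "wf_trm ar s" "fv_trm s \<subseteq> {..<n}"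
    "\<And>\<rho>. env n \<rho> \<Longrightarrow> h (eval S \<rho> s) = t (\<lambda>i. h (\<rho> i))"
    using assms(1) by (auto simp: T_def)
  obtain s' where s': "wf_trm ar s'" "fv_trm s' \<subseteq> {..<n}"
    "\<And>\<rho>. env n \<rho> \<Longrightarrow> h (eval S \<rho> s') = t' (\<lambda>i. h (\<rho> i))"
    using assms(2) by (auto simp: T_def)
  have "eval S \<rho> s = eval S \<rho> s' \<longleftrightarrow> t (\<lambda>i. h (\<rho> i)) = t' (\<lambda>i. h (\<rho> i))" if "env n \<rho>" for \<rho>
  proof -
    have "eval S \<rho> s \<in> carrier S"
      by (rule eval_closed[OF struct s(1)]) (use s(2) that in \<open>auto simp: env_def\<close>)
    moreover have "eval S \<rho> s' \<in> carrier S"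
      by (rule eval_closed[OF struct s'(1)]) (use s'(2) that in \<open>auto simp: env_def\<close>)
    ultimately have "eval S \<rho> s = eval S \<rho> s' \<longleftrightarrow> h (eval S \<rho> s) = h (eval S \<rho> s')"
      using inj by (auto dest: inj_onD)
    then show ?thesis using s(3) s'(3) that by simp
  qed
  then show ?thesis unfolding D_def
    by (intro exI[of _ "Eq s s'"]) (use s s' in \<open>auto simp: formula_of_def\<close>)
qed

lemma D_neg:
  assumes "D n R"
  shows "D n (\<lambda>\<rho>. \<not> R \<rho>)"
proof -
  from assms obtain \<phi> where "formula_of ar n \<phi>" "\<forall>\<rho>. env n \<rho> \<longrightarrow> sat S \<rho> \<phi> = R (\<lambda>i. h (\<rho> i))"
    by (auto simp: D_def)
  then show ?thesis unfolding D_def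
    by (intro exI[of _ "Neg \<phi>"]) (auto simp: formula_of_def)
qed

lemma D_conj:
  assumes "D n R" "D n R'"
  shows "D n (\<lambda>\<rho>. R \<rho> \<and> R' \<rho>)"
proof -
  from assms obtain \<phi> \<phi>' where "formula_of ar n \<phi>" "\<forall>\<rho>. env n \<rho> \<longrightarrow> sat S \<rho> \<phi> = R (\<lambda>i. h (\<rho> i))"
    "formula_of ar n \<phi>'" "\<forall>\<rho>. env n \<rho> \<longrightarrow> sat S \<rho> \<phi>' = R' (\<lambda>i. h (\<rho> i))"
    by (auto simp: D_def)
  then show ?thesis unfolding D_def
    by (intro exI[of _ "Conj \<phi> \<phi>'"]) (auto simp: formula_of_def)
qed

lemma D_disj: "D n R \<Longrightarrow> D n R' \<Longrightarrow> D n (\<lambda>\<rho>. R \<rho> \<or> R' \<rho>)"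
  using D_neg[OF D_conj[OF D_neg D_neg], of n R R'] by simp

lemma D_imp: "D n R \<Longrightarrow> D n R' \<Longrightarrow> D n (\<lambda>\<rho>. R \<rho> \<longrightarrow> R' \<rho>)"
  unfolding imp_conv_disj by (intro D_disj D_neg)

lemma D_iff: "D n R \<Longrightarrow> D n R' \<Longrightarrow> D n (\<lambda>\<rho>. R \<rho> \<longleftrightarrow> R' \<rho>)"
  unfolding iff_conv_conj_imp by (intro D_conj D_imp)

lemma D_ex:
  assumes "D (Suc n) (\<lambda>\<rho>. R (\<rho> 0) (\<lambda>i. \<rho> (Suc i)))"
  shows "D n (\<lambda>\<rho>. \<exists>a\<in>h ` carrier S. R a \<rho>)"
proof -
  obtain \<phi> where \<phi>: "wf_fm ar \<phi>" "fv_fm \<phi> \<subseteq> {..<Suc n}"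
    "\<And>\<rho>. env (Suc n) \<rho> \<Longrightarrow> sat S \<rho> \<phi> = R (h (\<rho> 0)) (\<lambda>i. h (\<rho> (Suc i)))"
    using assms by (auto simp: D_def formula_of_def)
  \<comment> \<open>A cyclic permutation of 0, ..., n: the de Bruijn index 0 becomes the named
    variable n, and the other indices move down by one. Fixing everything above n makes it injective
    on all variables, as \<open>sat_rename\<close> demands.\<close>
  define g where "g i = (if i = 0 then n else if i \<le> n then i - 1 else i)" for i
  have inj: "inj g" by (auto simp: inj_def g_def split: if_splits)
  have "sat S \<rho> (Ex n (rename_fm g \<phi>)) \<longleftrightarrow> (\<exists>a\<in>h ` carrier S. R a (\<lambda>i. h (\<rho> i)))"
    if \<rho>: "env n \<rho>" for \<rho>
  proof -
    have "sat S (\<rho>(n := a)) (rename_fm g \<phi>) \<longleftrightarrow> R (h a) (\<lambda>i. h (\<rho> i))" if "a \<in> carrier S" for a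
    proof -
      have "sat S (\<rho>(n := a)) (rename_fm g \<phi>) \<longleftrightarrow> sat S (case_nat a \<rho>) \<phi>"
        unfolding sat_rename[OF inj]
        by (rule sat_cong) (use \<phi>(2) in \<open>auto simp: g_def split: nat.split\<close>)
      also have "\<dots> \<longleftrightarrow> R (h a) (\<lambda>i. h (\<rho> i))"
        using \<phi>(3)[of "case_nat a \<rho>"] \<rho> that by (auto simp: env_def split: nat.split)
      finally show ?thesis .
    qed
    then show ?thesis by simp
  qed
  moreover have "formula_of ar n (Ex n (rename_fm g \<phi>))"
    using \<phi>(1,2) inj by (auto simp: formula_of_def wf_rename_fm fv_rename_fm g_def)
  ultimately show ?thesis unfolding D_def by blast
qed

lemma D_all:
  assumes "D (Suc n) (\<lambda>\<rho>. R (\<rho> 0) (\<lambda>i. \<rho> (Suc i)))"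
  shows "D n (\<lambda>\<rho>. \<forall>a\<in>h ` carrier S. R a \<rho>)"
  using D_neg[OF D_ex[of n "\<lambda>a \<rho>. \<not> R a \<rho>"]] D_neg[OF assms] by simp

end

section \<open>Powers of \<open>k\<close> in the ring of integers\<close>

text \<open>A common divisor divides (s - t) m, while 1 + t m is coprime to m and hence also to its
  divisor s - t. This is the coprimality behind Goedel's beta function.\<close>

lemma coprime_arith_progression:
  fixes s t m :: int
  assumes "(s - t) dvd m"
  shows "coprime (1 + s * m) (1 + t * m)"
proof -
  have m: "coprime (1 + t * m) m"
  proof (rule coprimeI)
    fix c assume "c dvd 1 + t * m" "c dvd m"
    then show "is_unit c" by (metis dvd_add_left_iff dvd_mult)
  qed
  then have "coprime (1 + t * m) (s - t)"
    using assms by (metis coprime_divisors dvd_refl)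
  with m have "coprime (1 + t * m) ((s - t) * m)" by simp
  moreover have "1 + s * m = (s - t) * m + (1 + t * m)" by (simp add: algebra_simps)
  ultimately show ?thesis by (metis coprime_commute coprime_iff_gcd_eq_1 gcd_add1)
qed

definition kpow :: "nat \<Rightarrow> int \<Rightarrow> bool" where
  "kpow k z \<longleftrightarrow> (\<exists>n. z = int k ^ n)"

text \<open>The set \<open>{s. s dvd z \<and> (1 + s * m) dvd c}\<close> encodes \<open>{1, k, \<dots>, z}\<close>; a descent on \<open>\<bar>s\<bar>\<close> replaces
  the order of \<open>\<int>\<close>, which is not needed.\<close>
lemma kpow_iff:
  assumes "k > 1"
  shows "kpow k z \<longleftrightarrow> z \<noteq> 0 \<and> (\<exists>m c. (1 + z * m) dvd c \<and>
    (\<forall>s. s dvd z \<and> (1 + s * m) dvd c \<longrightarrow> s = 1 \<or> (\<exists>t. s = int k * t \<and> (1 + t * m) dvd c)))"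
proof
  assume "kpow k z"
  then obtain n where z: "z = int k ^ n" by (auto simp: kpow_def)
  define N where "N = k ^ n"
  \<comment> \<open>The factorial is divisible by every nonzero difference s - k^i with s dividing
    z, because both terms are at most N in absolute value. The factor 3 rules out s m = -2, so that
    1 + s m is a unit only for s = 0.\<close>
  define m :: int where "m = 3 * fact (2 * N)"
  define c where "c = (\<Prod>i\<le>n. 1 + int k ^ i * m)"
  have z0: "z > 0" using z assms by simp
  have mem: "\<exists>i\<le>n. s = int k ^ i" if s: "s dvd z" "(1 + s * m) dvd c" for s
  proof (rule ccontr)
    assume neg: "\<not> (\<exists>i\<le>n. s = int k ^ i)"
    have "coprime (1 + s * m) (1 + int k ^ i * m)" if "i \<le> n" for i
    proof (rule coprime_arith_progression)
      have "\<bar>s\<bar> \<le> int N" using dvd_imp_le_int[OF _ s(1)] z z0 by (simp add: N_def)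
      moreover have "int k ^ i \<le> int N"
        using that assms by (simp add: N_def power_increasing)
      ultimately have "\<bar>s - int k ^ i\<bar> \<le> int (2 * N)"
        using zero_le_power[of "int k" i] by linarith
      moreover have "s - int k ^ i \<noteq> 0" using neg that by auto
      ultimately have "nat \<bar>s - int k ^ i\<bar> dvd fact (2 * N)"
        by (intro dvd_fact) auto
      then have "s - int k ^ i dvd int (fact (2 * N))"
        by (metis int_dvd_int_iff dvd_abs_iff abs_dvd_iff nat_0_le abs_ge_zero int_nat_eq)
      then show "s - int k ^ i dvd m" by (simp add: m_def)
    qed
    \<comment> \<open>A divisor s of z that is no power of k makes 1 + s m coprime to every factor
      of c. As it also divides c, it is a unit.\<close>
    then have "coprime (1 + s * m) c" unfolding c_def by (intro prod_coprime_right) auto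
    with s(2) have "is_unit (1 + s * m)"
      by (metis coprime_common_divisor dvd_refl)
    then have "\<bar>1 + s * m\<bar> = 1" by simp
    then have "1 + s * m = 1 \<or> 1 + s * m = - 1" by arith
    then have "s * m = 0 \<or> s * m = - 2" by linarith
    moreover have "s \<noteq> 0" using s(1) z0 by auto
    moreover have "m \<noteq> 0" by (simp add: m_def)
    ultimately have "s * m = - 2" by simp
    then have "m dvd 2" by (metis dvd_triv_right dvd_minus_iff)
    then have "\<bar>m\<bar> \<le> 2" using dvd_imp_le_int[of 2 m] by simp
    moreover have "m \<ge> 3" unfolding m_def using fact_ge_1[of "2 * N", where 'a = int] by linarith
    ultimately show False by linarith
  qed
  have fin: "(1 + int k ^ i * m) dvd c" if "i \<le> n" for i
    unfolding c_def using that by (intro dvd_prodI) auto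
  have "s = 1 \<or> (\<exists>t. s = int k * t \<and> (1 + t * m) dvd c)" if s: "s dvd z" "(1 + s * m) dvd c" for s
  proof -
    obtain i where i: "i \<le> n" "s = int k ^ i" using mem[OF s] by blast
    show ?thesis
    proof (cases i)
      case (Suc j)
      then show ?thesis using i fin[of j] by auto
    qed (use i in simp)
  qed
  then show "z \<noteq> 0 \<and> (\<exists>m c. (1 + z * m) dvd c \<and>
    (\<forall>s. s dvd z \<and> (1 + s * m) dvd c \<longrightarrow> s = 1 \<or> (\<exists>t. s = int k * t \<and> (1 + t * m) dvd c)))"
    using z0 fin[of n] z by (intro conjI exI[of _ m] exI[of _ c]) auto
next
  assume "z \<noteq> 0 \<and> (\<exists>m c. (1 + z * m) dvd c \<and>
    (\<forall>s. s dvd z \<and> (1 + s * m) dvd c \<longrightarrow> s = 1 \<or> (\<exists>t. s = int k * t \<and> (1 + t * m) dvd c)))"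
  then obtain m c where z: "z \<noteq> 0" "(1 + z * m) dvd c"
    and step: "\<And>s. s dvd z \<Longrightarrow> (1 + s * m) dvd c \<Longrightarrow> s = 1 \<or> (\<exists>t. s = int k * t \<and> (1 + t * m) dvd c)"
    by blast
  have "kpow k s" if "s dvd z" "(1 + s * m) dvd c" for s
    using that
  proof (induction "nat \<bar>s\<bar>" arbitrary: s rule: less_induct)
    case less
    from step[OF less.prems] show ?case
    proof (elim disjE exE conjE)
      assume "s = 1"
      then show ?thesis unfolding kpow_def by (intro exI[of _ 0]) simp
    next
      fix t assume t: "s = int k * t" "(1 + t * m) dvd c"
      have "s \<noteq> 0" using less.prems(1) z(1) by auto
      then have "\<bar>t\<bar> < \<bar>s\<bar>" using t(1) assms by (simp add: abs_mult)
      moreover have "t dvd z" using less.prems(1) t(1) by (metis dvd_mult_right)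
      ultimately have "kpow k t" using less.hyps[of t] t(2) by simp
      then obtain n where "t = int k ^ n" by (auto simp: kpow_def)
      then show ?thesis unfolding kpow_def by (intro exI[of _ "Suc n"]) (simp add: t(1))
    qed
  qed
  from this[OF dvd_refl z(2)] show "kpow k z" .
qed

section \<open>The ring \<open>\<int>[1/k]\<close>\<close>

locale baumslag_solitar =
  fixes k :: nat
  assumes k: "k > 1"
begin

definition e :: "int \<Rightarrow> rat" where "e m = of_nat k powi m"

definition R :: "rat set" where "R = {x. \<exists>(n::nat) (i::int). x * of_nat k ^ n = of_int i}"

lemma e_add: "e (m + n) = e m * e n"
  unfolding e_def using k by (intro power_int_add) auto

lemma e_0 [simp]: "e 0 = 1"
  by (simp add: e_def)

lemma e_1 [simp]: "e 1 = of_nat k"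
  by (simp add: e_def)

lemma e_of_nat: "e (int n) = of_nat k ^ n"
  by (simp add: e_def)

lemma e_pos: "e m > 0"
  using k by (simp add: e_def)

lemma e_ne [simp]: "e m \<noteq> 0"
  using e_pos[of m] by simp

lemma e_minus: "e (- m) = inverse (e m)"
  by (simp add: e_def power_int_minus)

lemma e_eq_iff [simp]: "e m = e n \<longleftrightarrow> m = n"
proof -
  have "e a < e b" if "a < b" for a b
    unfolding e_def by (rule power_int_strict_increasing) (use k that in auto)
  then show ?thesis by (metis less_irrefl linorder_neqE)
qed

lemma e_eq_1 [simp]: "e m = 1 \<longleftrightarrow> m = 0"
  using e_eq_iff[of m 0] by (simp del: e_eq_iff)

lemma R_int [simp]: "of_int i \<in> R"
  unfolding R_def by (rule CollectI, rule exI[of _ 0]) auto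

lemma R_0 [simp]: "0 \<in> R" and R_1 [simp]: "1 \<in> R"
  using R_int[of 0] R_int[of 1] by simp_all

lemma R_common:
  assumes "x \<in> R" "y \<in> R"
  obtains n i j where "x * of_nat k ^ n = of_int i" "y * of_nat k ^ n = of_int j"
proof -
  obtain n i n' i' where *: "x * of_nat k ^ n = of_int i" "y * of_nat k ^ n' = of_int i'"
    using assms by (auto simp: R_def)
  have "x * of_nat k ^ (n + n') = of_int (i * int k ^ n')"
    using * by (simp add: power_add flip: mult.assoc)
  moreover have "y * of_nat k ^ (n + n') = of_int (i' * int k ^ n)"
    using * by (simp add: power_add mult.left_commute[of _ "of_nat k ^ n"] mult.commute)
  ultimately show ?thesis by (rule that)
qed

lemma R_add [simp]: assumes "x \<in> R" "y \<in> R" shows "x + y \<in> R"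
proof -
  obtain n i j where "x * of_nat k ^ n = of_int i" "y * of_nat k ^ n = of_int j"
    by (rule R_common[OF assms])
  then have "(x + y) * of_nat k ^ n = of_int (i + j)" by (simp add: distrib_right)
  then show ?thesis unfolding R_def by blast
qed

lemma R_uminus [simp]: assumes "x \<in> R" shows "- x \<in> R"
proof -
  obtain n i where "x * of_nat k ^ n = of_int i" using assms by (auto simp: R_def)
  then have "(- x) * of_nat k ^ n = of_int (- i)" by simp
  then show ?thesis unfolding R_def by blast
qed

lemma R_diff [simp]: "x \<in> R \<Longrightarrow> y \<in> R \<Longrightarrow> x - y \<in> R"
  using R_add[of x "- y"] by simp

lemma R_mult [simp]: assumes "x \<in> R" "y \<in> R" shows "x * y \<in> R"
proof -
  obtain n i j where "x * of_nat k ^ n = of_int i" "y * of_nat k ^ n = of_int j"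
    by (rule R_common[OF assms])
  then have "x * y * of_nat k ^ (n + n) = of_int (i * j)"
    by (simp add: power_add) (metis mult.assoc mult.commute)
  then show ?thesis unfolding R_def by blast
qed

lemma R_e [simp]: "e m \<in> R"
proof (cases "m \<ge> 0")
  case True
  then have "e m = of_int (int k ^ nat m)" using e_of_nat[of "nat m"] by simp
  then show ?thesis using R_int[of "int k ^ nat m"] by simp
next
  case False
  then have "e m * of_nat k ^ nat (- m) = of_int 1"
    using e_of_nat[of "nat (- m)"] e_add[of m "- m"] by simp
  then show ?thesis unfolding R_def by blast
qed

text \<open>Clearing the denominator of x multiplies i by a power of k. Since m is positive, k is
  coprime to k^m - 1, so the divisibility descends from Z[1/k] to the integers.\<close>

lemma dvd_if_multiple_in_R:
  assumes "m \<ge> 1" "x \<in> R" "of_int i = (of_nat k ^ m - 1) * x"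
  shows "(int k ^ m - 1) dvd i"
proof -
  obtain n j where "x * of_nat k ^ n = of_int j" using assms(2) by (auto simp: R_def)
  then have "of_int (i * int k ^ n) = (of_int ((int k ^ m - 1) * j) :: rat)"
    using assms(3) by simp
  then have "i * int k ^ n = (int k ^ m - 1) * j" by (simp only: of_int_eq_iff)
  moreover have "coprime (int k ^ m - 1) (int k ^ n)"
  proof -
    have "coprime (int k ^ m - 1) (int k ^ m)"
      by (metis coprime_diff_one_left)
    then have "coprime (int k ^ m - 1) (int k)"
      using assms(1) by (simp add: coprime_power_right_iff)
    then show ?thesis by simp
  qed
  ultimately show ?thesis by (metis coprime_dvd_mult_left_iff dvd_triv_left)
qed

text \<open>The expansion of \<open>u\<^sup>n\<close> to second order at \<open>u = 1\<close> makes multiplication by \<open>n\<close> visible in \<open>\<int>[1/k]\<close>.\<close>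
lemma e_mult_expansion:
  "\<exists>r\<in>R. e (m * n) = 1 + of_int n * (e m - 1) + (e m - 1)\<^sup>2 * r"
proof (induction n rule: int_induct[of _ 0])
  case base
  then show ?case by (intro bexI[of _ 0]) auto
next
  case (step1 n)
  then obtain r where r: "r \<in> R" "e (m * n) = 1 + of_int n * (e m - 1) + (e m - 1)\<^sup>2 * r" by blast
  have "e (m * (n + 1)) = e (m * n) * e m" by (simp add: distrib_left e_add)
  also have "\<dots> = 1 + of_int (n + 1) * (e m - 1) + (e m - 1)\<^sup>2 * (of_int n + r * e m)"
    unfolding r(2) by (simp add: algebra_simps power2_eq_square)
  finally show ?case using r(1) by (intro bexI[of _ "of_int n + r * e m"]) auto
next
  case (step2 n)
  then obtain r where r: "r \<in> R" "e (m * n) = 1 + of_int n * (e m - 1) + (e m - 1)\<^sup>2 * r" by blast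
  \<comment> \<open>Going down means dividing by \<open>e m\<close>, a unit of Z[1/k]; its inverse
    is absorbed into the remainder coefficient.\<close>
  have i: "e m * e (- m) = 1" using e_add[of m "- m"] by simp
  have "e (m * (n - 1)) * e m = e (m * n)" by (simp add: right_diff_distrib flip: e_add)
  also have "\<dots> = (1 + of_int (n - 1) * (e m - 1)) * e m + (e m - 1)\<^sup>2 * (r - of_int (n - 1))"
    unfolding r(2) by (simp add: algebra_simps power2_eq_square)
  also have "\<dots> = (1 + of_int (n - 1) * (e m - 1)) * e m +
      (e m - 1)\<^sup>2 * (r - of_int (n - 1)) * (e m * e (- m))"
    unfolding i by simp
  also have "\<dots> = (1 + of_int (n - 1) * (e m - 1) + (e m - 1)\<^sup>2 * ((r - of_int (n - 1)) * e (- m))) * e m"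
    by (simp only: algebra_simps)
  finally have "e (m * (n - 1)) = 1 + of_int (n - 1) * (e m - 1) + (e m - 1)\<^sup>2 * ((r - of_int (n - 1)) * e (- m))"
    using e_ne[of m] by (simp only: mult_cancel_right) simp
  then show ?case using r(1) by (intro bexI[of _ "(r - of_int (n - 1)) * e (- m)"]) auto
qed

text \<open>For negative m, the elements u - 1 and 1/u - 1 with u = \<open>e m\<close> differ by the
  unit - 1/u. Statements about integer exponents thereby reduce to natural powers of k.\<close>

lemma e_nat_abs: "\<exists>c\<in>R. c \<noteq> 0 \<and> inverse c \<in> R \<and> of_nat k ^ nat \<bar>m\<bar> - 1 = c * (e m - 1)"
proof (cases "m \<ge> 0")
  case True
  then show ?thesis using e_of_nat[of "nat m"] by (intro bexI[of _ 1]) auto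
next
  case False
  then have "of_nat k ^ nat \<bar>m\<bar> - 1 = - e (- m) * (e m - 1)"
    using e_of_nat[of "nat (- m)"] e_add[of m "- m"] by (simp add: algebra_simps)
  moreover have "inverse (- e (- m)) \<in> R" by (simp add: e_minus)
  ultimately show ?thesis by (intro bexI[of _ "- e (- m)"]) auto
qed

text \<open>Reducing the exponent modulo m leaves k^r - 1 with r < m, a multiple of k^m - 1 that is
  nonnegative and smaller; so it vanishes and r = 0.\<close>

lemma power_minus_1_dvd:
  assumes "int k ^ m - 1 dvd int k ^ n - 1"
  shows "m dvd n"
proof (cases "m = 0")
  case True
  then show ?thesis using assms k one_less_power[of "int k" n] by (cases "n = 0") auto
next
  case False
  let ?a = "int k ^ m - 1" and ?r = "n mod m"
  have a: "?a dvd int k ^ (m * (n div m)) - 1"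
    using power_mult[of "int k" m "n div m"] by (metis dvd_triv_left power_diff_1_eq)
  have "int k ^ n - 1 = (int k ^ (m * (n div m)) - 1) * int k ^ ?r + (int k ^ ?r - 1)"
  proof -
    have "int k ^ n = int k ^ (m * (n div m)) * int k ^ ?r"
      by (metis mult_div_mod_eq power_add)
    then show ?thesis by (simp add: algebra_simps)
  qed
  then have "?a dvd int k ^ ?r - 1"
    using assms a by (metis dvd_add_right_iff dvd_mult2)
  moreover have "int k ^ ?r < int k ^ m"
    using False k by (intro power_strict_increasing) auto
  moreover have "int k ^ ?r \<ge> 1" using k by simp
  ultimately have "int k ^ ?r - 1 = 0"
    by (smt (verit) zdvd_imp_le)
  then have "?r = 0" using k one_less_power[of "int k" ?r] by (cases "?r = 0") auto
  then show ?thesis by auto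
qed

text \<open>The left side is an inclusion of principal ideals of Z[1/k]. Ideals are compared,
  instead of the numbers \<open>e m - 1\<close> themselves, because the group distinguishes no
  element as 1: quantifying over all t keeps the resulting formula free of parameters.\<close>

lemma dvd_iff_R: "(\<forall>t\<in>R. \<exists>s\<in>R. (e n - 1) * t = (e m - 1) * s) \<longleftrightarrow> m dvd n"
proof
  assume "m dvd n"
  then obtain c where c: "n = m * c" by blast
  obtain r where r: "r \<in> R" "e n = 1 + of_int c * (e m - 1) + (e m - 1)\<^sup>2 * r"
    using e_mult_expansion[of m c] c by blast
  show "\<forall>t\<in>R. \<exists>s\<in>R. (e n - 1) * t = (e m - 1) * s"
  proof
    fix t assume t: "t \<in> R"
    have "(e n - 1) * t = (e m - 1) * ((of_int c + (e m - 1) * r) * t)"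
      unfolding r(2) by (simp add: algebra_simps power2_eq_square)
    then show "\<exists>s\<in>R. (e n - 1) * t = (e m - 1) * s"
      using r(1) t by (intro bexI[of _ "(of_int c + (e m - 1) * r) * t"]) auto
  qed
next
  assume "\<forall>t\<in>R. \<exists>s\<in>R. (e n - 1) * t = (e m - 1) * s"
  then obtain s where s: "s \<in> R" "e n - 1 = (e m - 1) * s" using R_1 by (metis mult_1_right)
  show "m dvd n"
  proof (cases "m = 0")
    case True
    then show ?thesis using s(2) by simp
  next
    case False
    obtain c where c: "c \<in> R" "c \<noteq> 0" "inverse c \<in> R" "of_nat k ^ nat \<bar>m\<bar> - 1 = c * (e m - 1)"
      using e_nat_abs by blast
    obtain d where d: "d \<in> R" "of_nat k ^ nat \<bar>n\<bar> - 1 = d * (e n - 1)"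
      using e_nat_abs by blast
    have "of_int (int k ^ nat \<bar>n\<bar> - 1) = d * ((e m - 1) * s)"
      using d(2) s(2) by simp
    also have "\<dots> = (of_nat k ^ nat \<bar>m\<bar> - 1) * (inverse c * d * s)"
      unfolding c(4) using c(2) by simp
    finally have "of_int (int k ^ nat \<bar>n\<bar> - 1) = (of_nat k ^ nat \<bar>m\<bar> - 1) * (inverse c * d * s)" .
    moreover have "inverse c * d * s \<in> R" using c d s by simp
    ultimately have "int k ^ nat \<bar>m\<bar> - 1 dvd int k ^ nat \<bar>n\<bar> - 1"
      using False by (intro dvd_if_multiple_in_R) auto
    then have "nat \<bar>m\<bar> dvd nat \<bar>n\<bar>" by (rule power_minus_1_dvd)
    then show ?thesis by simp
  qed
qed

text \<open>By \<open>e_mult_expansion\<close>, the condition at m says, after cancelling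
  \<open>e m - 1\<close>, that y and n times \<open>\<alpha>\<close> agree modulo
  \<open>e m - 1\<close>. Agreement for all m is equality, since a fixed numerator cannot be
  divisible by arbitrarily large k^m - 1.\<close>

lemma int_multiple_iff_R:
  assumes "\<alpha> \<in> R" "y \<in> R"
  shows "(\<forall>m l. l = m * n \<longrightarrow> (\<exists>t\<in>R. (e l - 1) * \<alpha> = (e m - 1) * (y + (e m - 1) * t)))
    \<longleftrightarrow> y = of_int n * \<alpha>"
proof
  assume y: "y = of_int n * \<alpha>"
  show "\<forall>m l. l = m * n \<longrightarrow> (\<exists>t\<in>R. (e l - 1) * \<alpha> = (e m - 1) * (y + (e m - 1) * t))"
  proof (intro allI impI)
    fix m l :: int assume "l = m * n"
    then obtain r where r: "r \<in> R" "e l = 1 + of_int n * (e m - 1) + (e m - 1)\<^sup>2 * r"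
      using e_mult_expansion[of m n] by blast
    have "(e l - 1) * \<alpha> = (e m - 1) * (y + (e m - 1) * (r * \<alpha>))"
      unfolding r(2) y by (simp add: algebra_simps power2_eq_square)
    then show "\<exists>t\<in>R. (e l - 1) * \<alpha> = (e m - 1) * (y + (e m - 1) * t)"
      using assms r(1) by (intro bexI[of _ "r * \<alpha>"]) auto
  qed
next
  assume *: "\<forall>m l. l = m * n \<longrightarrow> (\<exists>t\<in>R. (e l - 1) * \<alpha> = (e m - 1) * (y + (e m - 1) * t))"
  define z where "z = y - of_int n * \<alpha>"
  have "z \<in> R" using assms by (simp add: z_def)
  then obtain j i where i: "z * of_nat k ^ j = of_int i" by (auto simp: R_def)
  have "(int k ^ m - 1) dvd i" if "m \<ge> 1" for m
  proof -
    obtain t where t: "t \<in> R" "(e (int m * n) - 1) * \<alpha> = (e (int m) - 1) * (y + (e (int m) - 1) * t)"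
      using * by blast
    obtain r where r: "r \<in> R" "e (int m * n) = 1 + of_int n * (e (int m) - 1) + (e (int m) - 1)\<^sup>2 * r"
      using e_mult_expansion by blast
    have "(e (int m) - 1) * (of_int n * \<alpha> + (e (int m) - 1) * r * \<alpha>) = (e (int m) - 1) * (y + (e (int m) - 1) * t)"
      unfolding t(2)[symmetric] r(2) by (simp add: algebra_simps power2_eq_square)
    moreover have "e (int m) - 1 \<noteq> 0" using that by simp
    ultimately have "of_int n * \<alpha> + (e (int m) - 1) * r * \<alpha> = y + (e (int m) - 1) * t"
      by (metis mult_left_cancel)
    then have "z = (e (int m) - 1) * (r * \<alpha> - t)" by (simp add: z_def algebra_simps)
    then have "of_int i = (of_nat k ^ m - 1) * ((r * \<alpha> - t) * e (int j))"
      by (simp only: i[symmetric] e_of_nat mult.assoc)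
    moreover have "(r * \<alpha> - t) * e (int j) \<in> R" using r t assms by simp
    ultimately show ?thesis using that by (intro dvd_if_multiple_in_R)
  qed
  \<comment> \<open>From k^m > m it follows that k^m - 1 exceeds the absolute value of i, so a
    nonzero i could not be its multiple.\<close>
  moreover define m where "m = Suc (nat \<bar>i\<bar>)"
  moreover have "int k ^ m > int m"
    using power_gt_expt[of k m] k by (simp flip: of_nat_power)
  ultimately have "i = 0"
    using dvd_imp_le_int[of i "int k ^ m - 1"] by force
  then show "y = of_int n * \<alpha>" using i k by (simp add: z_def)
qed

text \<open>As x is coprime to x + 1 and to x - 1, common multiples are multiples of the product,
  and the two conditions fix z + x and z - x up to sign. One correct sign already yields z = x x;
  two wrong ones force x = 0, where the claim holds as well.\<close>

lemma square_iff_dvd: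
  fixes x z :: int
  shows "z = x * x \<longleftrightarrow> (\<forall>w. x dvd w \<and> (x + 1) dvd w \<longleftrightarrow> (z + x) dvd w) \<and>
    (\<forall>w. x dvd w \<and> (x - 1) dvd w \<longleftrightarrow> (z - x) dvd w)"
proof -
  have eq: "(\<forall>w. x dvd w \<and> d dvd w \<longleftrightarrow> y dvd w) \<longleftrightarrow> y = x * d \<or> y = - (x * d)"
    if "coprime x d" for d y :: int
  proof -
    have "x dvd w \<and> d dvd w \<longleftrightarrow> x * d dvd w" for w
      using that by (metis divides_mult dvd_mult_left dvd_mult_right)
    then have "(\<forall>w. x dvd w \<and> d dvd w \<longleftrightarrow> y dvd w) \<longleftrightarrow> x * d dvd y \<and> y dvd x * d"
      by (metis dvd_refl dvd_trans)
    also have "\<dots> \<longleftrightarrow> \<bar>y\<bar> = \<bar>x * d\<bar>" by (metis zdvd_antisym_abs dvd_refl abs_dvd_iff dvd_abs_iff)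
    finally show ?thesis by (simp add: abs_eq_iff)
  qed
  have "coprime x (x + 1)" "coprime x (x - 1)"
    by (simp_all add: coprime_commute[of x])
  then show ?thesis unfolding eq[OF \<open>coprime x (x + 1)\<close>] eq[OF \<open>coprime x (x - 1)\<close>]
  proof (intro iffI)
    assume "z = x * x"
    then show "(z + x = x * (x + 1) \<or> z + x = - (x * (x + 1))) \<and> (z - x = x * (x - 1) \<or> z - x = - (x * (x - 1)))"
      by (simp add: algebra_simps)
  next
    assume "(z + x = x * (x + 1) \<or> z + x = - (x * (x + 1))) \<and> (z - x = x * (x - 1) \<or> z - x = - (x * (x - 1)))"
    then show "z = x * x"
    proof (elim conjE disjE)
      assume *: "z + x = - (x * (x + 1))" "z - x = - (x * (x - 1))"
      then have "x = 0" by (simp add: algebra_simps)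
      then show ?thesis using * by simp
    qed (auto simp: algebra_simps)
  qed
qed

end

section \<open>The affine model \<open>\<int>[1/k] \<rtimes> \<int>\<close> of \<open>BS(1,k)\<close>\<close>

context baumslag_solitar
begin

text \<open>The exponent is negative because the relator makes b^-1 x b, and not b x b^-1, the
  multiplication of x by k.\<close>

definition gm :: "rat \<times> int \<Rightarrow> rat \<times> int \<Rightarrow> rat \<times> int" where
  "gm g g' = (fst g + e (- snd g) * fst g', snd g + snd g')"

definition gi :: "rat \<times> int \<Rightarrow> rat \<times> int" where
  "gi g = (- e (snd g) * fst g, - snd g)"

definition V :: "(rat \<times> int) set" where "V = R \<times> UNIV"

lemma V_pair [simp]: "(x, m) \<in> V \<longleftrightarrow> x \<in> R"
  by (simp add: V_def)

lemma fst_V [simp]: "g \<in> V \<Longrightarrow> fst g \<in> R"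
  by (auto simp: V_def)

lemma gm_closed [simp]: "g \<in> V \<Longrightarrow> g' \<in> V \<Longrightarrow> gm g g' \<in> V"
  by (auto simp: V_def gm_def)

lemma gi_closed [simp]: "g \<in> V \<Longrightarrow> gi g \<in> V"
  by (auto simp: V_def gi_def)

lemma e_inverse [simp]: "e m * e (- m) = 1" "e (- m) * e m = 1"
  using e_add[of m "- m"] e_add[of "- m" m] by simp_all

lemma e_inverse_left [simp]: "e m * (e (- m) * x) = x" "e (- m) * (e m * x) = x"
  by (simp_all flip: mult.assoc)

lemma gm_assoc: "gm (gm f g) h = gm f (gm g h)"
  using e_add[of "- snd f" "- snd g"] by (simp add: gm_def distrib_left mult.assoc)

lemma gm_unit [simp]: "gm (0, 0) g = g" "gm g (0, 0) = g"
  by (simp_all add: gm_def)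

lemma gm_gi [simp]: "gm g (gi g) = (0, 0)" "gm (gi g) g = (0, 0)"
  by (simp_all add: gm_def gi_def)

lemma gi_gm: "gi (gm g g') = gm (gi g') (gi g)"
  by (simp add: gm_def gi_def e_add algebra_simps)

section \<open>Words in the generators: values, normal forms and the word problem\<close>

fun letter :: "bs_gen \<times> bool \<Rightarrow> rat \<times> int" where
  "letter (GenA, s) = (if s then 1 else - 1, 0)"
| "letter (GenB, s) = (0, if s then 1 else - 1)"

primrec wval :: "bs_gen word \<Rightarrow> rat \<times> int" where
  "wval [] = (0, 0)"
| "wval (l # w) = gm (letter l) (wval w)"

abbreviation rels :: "(bs_gen word \<times> bs_gen word) set" where
  "rels \<equiv> {([(GenB, False), (GenA, True), (GenB, True)], replicate k (GenA, True))}"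

abbreviation weq :: "bs_gen word \<Rightarrow> bs_gen word \<Rightarrow> bool" (infix "\<approx>" 50) where
  "u \<approx> v \<equiv> pres_eq rels u v"

lemma wval_append: "wval (u @ v) = gm (wval u) (wval v)"
  by (induction u) (auto simp: gm_assoc)

lemma letter_inv: "letter (g, \<not> s) = gi (letter (g, s))"
  by (cases g) (auto simp: gi_def)

lemma wval_word_inv: "wval (word_inv w) = gi (wval w)"
proof (induction w)
  case Nil
  then show ?case by (simp add: word_inv_def gi_def)
next
  case (Cons l w)
  obtain g s where l: "l = (g, s)" by (cases l)
  have "word_inv (l # w) = word_inv w @ [(g, \<not> s)]" by (simp add: word_inv_def l)
  then have "wval (word_inv (l # w)) = gm (gi (wval w)) (letter (g, \<not> s))"
    by (simp add: wval_append Cons.IH)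
  then show ?case by (simp only: letter_inv wval.simps gi_gm l)
qed

lemma wval_replicate_A:
  "wval (replicate n (GenA, s)) = (of_nat n * (if s then 1 else - 1), 0)"
  by (induction n) (auto simp: gm_def algebra_simps)

lemma wval_replicate_B:
  "wval (replicate n (GenB, s)) = (0, int n * (if s then 1 else - 1))"
  by (induction n) (auto simp: gm_def)

lemma weq_wval: "u \<approx> v \<Longrightarrow> wval u = wval v"
proof (induction rule: pres_eq.induct)
  case (cancel g s)
  then show ?case by (simp only: wval.simps letter_inv gm_unit gm_gi)
next
  case (rel u v)
  then show ?case by (simp add: wval_replicate_A) (simp add: gm_def)
qed (auto simp: wval_append)

lemmas weq_refl = pres_eq.refl[of rels]
lemmas weq_sym = pres_eq.sym[of rels]
lemmas weq_trans [trans] = pres_eq.trans[of rels]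

lemma weq_append: "u \<approx> u' \<Longrightarrow> v \<approx> v' \<Longrightarrow> u @ v \<approx> u' @ v'"
  using pres_eq.cong[of rels u u' "[]" v] pres_eq.cong[of rels v v' u' "[]"]
  by (auto intro: weq_trans)

lemma weq_Cons: "v \<approx> v' \<Longrightarrow> l # v \<approx> l # v'"
  using weq_append[OF weq_refl, of v v' "[l]"] by simp

lemma weq_cancel: "(g, s) # (g, \<not> s) # w \<approx> w"
  using weq_append[OF pres_eq.cancel weq_refl, of g s w] by simp

definition sg :: "bool \<Rightarrow> int" where "sg s = (if s then 1 else - 1)"

definition apow :: "int \<Rightarrow> bs_gen word" where
  "apow j = replicate (nat \<bar>j\<bar>) (GenA, j > 0)"

lemma apow_sg: "apow (int n * sg s) = replicate n (GenA, s)"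
  by (cases "n = 0") (auto simp: apow_def sg_def abs_mult)

lemma apow_0 [simp]: "apow 0 = []"
  by (simp add: apow_def)

lemma apow_cases: obtains n s where "j = int n * sg s" "apow j = replicate n (GenA, s)"
proof -
  have "j = int (nat \<bar>j\<bar>) * sg (j > 0)" by (auto simp: sg_def)
  then show ?thesis using that[of "nat \<bar>j\<bar>" "j > 0"] by (simp add: apow_def)
qed

lemma A_apow: "(GenA, s) # apow j \<approx> apow (j + sg s)"
proof (rule apow_cases[of j])
  fix n s' assume j: "j = int n * sg s'" "apow j = replicate n (GenA, s')"
  show ?thesis
  proof (cases "s' = s \<or> n = 0")
    case True
    then have "j + sg s = int (Suc n) * sg s" using j by (auto simp: distrib_right)
    then have "apow (j + sg s) = replicate (Suc n) (GenA, s)" by (simp only: apow_sg)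
    then show ?thesis using j True weq_refl by auto
  next
    case False
    then obtain n' where n: "n = Suc n'" by (cases n) auto
    have s': "s' = (\<not> s)" using False by auto
    then have "j + sg s = int n' * sg s'" using j n by (auto simp: sg_def)
    then have "apow (j + sg s) = replicate n' (GenA, s')" by (simp only: apow_sg)
    then show ?thesis using j n s' weq_cancel by simp
  qed
qed

lemma apow_add: "apow i @ apow j \<approx> apow (i + j)"
proof (rule apow_cases[of i])
  fix n s assume i: "i = int n * sg s" "apow i = replicate n (GenA, s)"
  have "replicate n (GenA, s) @ apow j \<approx> apow (j + int n * sg s)"
  proof (induction n)
    case (Suc n)
    then have "(GenA, s) # replicate n (GenA, s) @ apow j \<approx> (GenA, s) # apow (j + int n * sg s)"
      by (rule weq_Cons)
    also have "\<dots> \<approx> apow (j + int n * sg s + sg s)" by (rule A_apow)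
    finally show ?case by (simp add: algebra_simps)
  qed (simp add: weq_refl)
  then show ?thesis using i by (simp add: add.commute)
qed

lemma B_A: "(GenB, False) # [(GenA, s)] \<approx> apow (int k * sg s) @ [(GenB, False)]"
proof -
  have rel: "[(GenB, False), (GenA, True), (GenB, True)] \<approx> apow (int k)"
    using pres_eq.rel[of _ _ rels] apow_sg[of k True] by (simp add: sg_def)
  have rel': "[(GenB, False), (GenA, s), (GenB, True)] \<approx> apow (int k * sg s)"
  proof (cases s)
    case False
    let ?w = "[(GenB, False), (GenA, False), (GenB, True)]"
    \<comment> \<open>For the inverse letter, a^-k a^k is inserted in front and a^k is turned back
      into b^-1 a b, which cancels against b^-1 a^-1 b.\<close>
    have "?w \<approx> apow (- int k + int k) @ ?w" by (simp add: weq_refl)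
    also have "apow (- int k + int k) @ ?w \<approx> (apow (- int k) @ apow (int k)) @ ?w"
      by (rule weq_append[OF weq_sym[OF apow_add] weq_refl])
    also have "\<dots> \<approx> (apow (- int k) @ [(GenB, False), (GenA, True), (GenB, True)]) @ ?w"
      by (intro weq_append weq_refl weq_sym[OF rel])
    also have "\<dots> = apow (- int k) @ (GenB, False) # (GenA, True) # (GenB, True) # (GenB, \<not> True) #
        [(GenA, False), (GenB, True)]" by simp
    also have "\<dots> \<approx> apow (- int k) @ (GenB, False) # (GenA, True) # [(GenA, \<not> True), (GenB, True)]"
      using weq_cancel[of GenB True] by (auto intro!: weq_append weq_Cons weq_refl)
    also have "\<dots> \<approx> apow (- int k) @ (GenB, False) # [(GenB, \<not> False)]"
      using weq_cancel[of GenA True] by (auto intro!: weq_append weq_Cons weq_refl)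
    also have "\<dots> \<approx> apow (- int k) @ []"
      by (intro weq_append weq_cancel weq_refl)
    finally show ?thesis using False by (simp add: sg_def)
  qed (use rel in \<open>simp add: sg_def\<close>)
  have "[(GenB, False), (GenA, s)] \<approx> [(GenB, False), (GenA, s)] @ [(GenB, True), (GenB, \<not> True)]"
    using weq_append[OF weq_refl weq_sym[OF pres_eq.cancel], of "[(GenB, False), (GenA, s)]" GenB True] by simp
  also have "\<dots> = [(GenB, False), (GenA, s), (GenB, True)] @ [(GenB, False)]" by simp
  also have "\<dots> \<approx> apow (int k * sg s) @ [(GenB, False)]"
    by (intro weq_append rel' weq_refl)
  finally show ?thesis .
qed

lemma B_apow: "(GenB, False) # apow j \<approx> apow (int k * j) @ [(GenB, False)]"
proof (rule apow_cases[of j])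
  fix n s assume j: "j = int n * sg s" "apow j = replicate n (GenA, s)"
  have "(GenB, False) # replicate n (GenA, s) \<approx> apow (int k * (int n * sg s)) @ [(GenB, False)]"
  proof (induction n)
    case (Suc n)
    have "(GenB, False) # replicate (Suc n) (GenA, s) = [(GenB, False), (GenA, s)] @ replicate n (GenA, s)"
      by simp
    also have "\<dots> \<approx> (apow (int k * sg s) @ [(GenB, False)]) @ replicate n (GenA, s)"
      by (intro weq_append B_A weq_refl)
    also have "\<dots> = apow (int k * sg s) @ (GenB, False) # replicate n (GenA, s)" by simp
    also have "\<dots> \<approx> apow (int k * sg s) @ apow (int k * (int n * sg s)) @ [(GenB, False)]"
      by (intro weq_append Suc.IH weq_refl)
    also have "\<dots> = (apow (int k * sg s) @ apow (int k * (int n * sg s))) @ [(GenB, False)]" by simp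
    also have "\<dots> \<approx> apow (int k * sg s + int k * (int n * sg s)) @ [(GenB, False)]"
      by (intro weq_append apow_add weq_refl)
    finally show ?case by (simp add: algebra_simps)
  qed (simp add: weq_refl)
  then show ?thesis using j by simp
qed

lemma apow_B: "apow j @ [(GenB, True)] \<approx> (GenB, True) # apow (int k * j)"
proof -
  have "apow j @ [(GenB, True)] \<approx> (GenB, True) # (GenB, \<not> True) # apow j @ [(GenB, True)]"
    by (rule weq_sym[OF weq_cancel])
  also have "\<dots> = (GenB, True) # (((GenB, False) # apow j) @ [(GenB, True)])" by simp
  also have "\<dots> \<approx> (GenB, True) # ((apow (int k * j) @ [(GenB, False)]) @ [(GenB, True)])"
    by (intro weq_Cons weq_append B_apow weq_refl)
  also have "\<dots> = (GenB, True) # apow (int k * j) @ [(GenB, False), (GenB, \<not> False)]" by simp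
  also have "\<dots> \<approx> (GenB, True) # apow (int k * j) @ []"
    by (intro weq_Cons weq_append pres_eq.cancel weq_refl)
  finally show ?thesis by simp
qed

lemma apow_Bs: "apow j @ replicate i (GenB, True) \<approx> replicate i (GenB, True) @ apow (int k ^ i * j)"
proof (induction i arbitrary: j)
  case (Suc i)
  have "apow j @ replicate (Suc i) (GenB, True) = (apow j @ [(GenB, True)]) @ replicate i (GenB, True)" by simp
  also have "\<dots> \<approx> ((GenB, True) # apow (int k * j)) @ replicate i (GenB, True)"
    by (intro weq_append apow_B weq_refl)
  also have "\<dots> = (GenB, True) # (apow (int k * j) @ replicate i (GenB, True))" by simp
  also have "\<dots> \<approx> (GenB, True) # (replicate i (GenB, True) @ apow (int k ^ i * (int k * j)))"
    by (intro weq_Cons Suc.IH)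
  finally show ?case by (simp add: algebra_simps)
qed (simp add: weq_refl)

text \<open>The words b^i a^j b^-l. They are not unique representatives, but a trivial value forces
  j = 0 and i = l, which is all that faithfulness needs.\<close>

definition nf :: "nat \<Rightarrow> int \<Rightarrow> nat \<Rightarrow> bs_gen word" where
  "nf i j l = replicate i (GenB, True) @ apow j @ replicate l (GenB, False)"

text \<open>Letters are prepended. A power of a moves right past b^i by raising its exponent to the
  factor k^i; b^-1 cancels against a leading b or, if there is none, moves past a^j, which becomes
  a^(k j).\<close>

lemma weq_nf: "\<exists>i j l. w \<approx> nf i j l"
proof (induction w)
  case Nil
  then show ?case by (intro exI[of _ 0]) (simp add: nf_def weq_refl)
next
  case (Cons x w)
  then obtain i j l where w: "w \<approx> nf i j l" by blast
  obtain g s where x: "x = (g, s)" by (cases x)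
  show ?case
  proof (cases g)
    case GenA
    have a: "[(GenA, s)] = apow (sg s)" using apow_sg[of 1 s] by simp
    have "x # w \<approx> x # nf i j l" by (rule weq_Cons[OF w])
    also have "\<dots> = (apow (sg s) @ replicate i (GenB, True)) @ apow j @ replicate l (GenB, False)"
      by (simp add: nf_def x GenA a[symmetric])
    also have "\<dots> \<approx> (replicate i (GenB, True) @ apow (int k ^ i * sg s)) @ apow j @ replicate l (GenB, False)"
      by (intro weq_append apow_Bs weq_refl)
    also have "\<dots> = replicate i (GenB, True) @ (apow (int k ^ i * sg s) @ apow j) @ replicate l (GenB, False)"
      by simp
    also have "\<dots> \<approx> nf i (int k ^ i * sg s + j) l"
      unfolding nf_def by (intro weq_append apow_add weq_refl)
    finally show ?thesis by blast
  next
    case GenB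
    show ?thesis
    proof (cases s)
      case True
      then have "x # w \<approx> nf (Suc i) j l" using weq_Cons[OF w, of x] by (simp add: nf_def x GenB)
      then show ?thesis by blast
    next
      case False
      show ?thesis
      proof (cases i)
        case 0
        have "x # w \<approx> x # nf i j l" by (rule weq_Cons[OF w])
        also have "\<dots> = ((GenB, False) # apow j) @ replicate l (GenB, False)"
          by (simp add: nf_def x GenB 0 False)
        also have "\<dots> \<approx> (apow (int k * j) @ [(GenB, False)]) @ replicate l (GenB, False)"
          by (intro weq_append B_apow weq_refl)
        also have "\<dots> = nf 0 (int k * j) (Suc l)" by (simp add: nf_def)
        finally show ?thesis by blast
      next
        case (Suc i')
        have "x # w \<approx> x # nf i j l" by (rule weq_Cons[OF w])
        also have "\<dots> = (GenB, False) # (GenB, \<not> False) # nf i' j l"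
          by (simp add: nf_def x GenB Suc False)
        also have "\<dots> \<approx> nf i' j l" by (rule weq_cancel)
        finally show ?thesis by blast
      qed
    qed
  qed
qed

lemma wval_apow: "wval (apow j) = (of_int j, 0)"
  by (rule apow_cases[of j]) (auto simp: wval_replicate_A sg_def)

lemma wval_nf: "wval (nf i j l) = (e (- int i) * of_int j, int i - int l)"
  by (simp add: nf_def wval_append wval_apow wval_replicate_B) (simp add: gm_def)

text \<open>Faithfulness of the affine model at the identity. The general case reduces to this one
  by multiplying with an inverse word.\<close>

lemma weq_Nil_if: assumes "wval w = (0, 0)" shows "w \<approx> []"
proof -
  obtain i j l where w: "w \<approx> nf i j l" using weq_nf by blast
  have "wval (nf i j l) = (0, 0)" using weq_wval[OF w] assms by simp
  then have j: "j = 0" and l: "l = i" by (auto simp: wval_nf)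
  have "replicate i (GenB, True) @ replicate i (GenB, False) \<approx> []"
  proof (induction i)
    case (Suc i)
    have "replicate (Suc i) (GenB, True) @ replicate (Suc i) (GenB, False) =
      replicate i (GenB, True) @ (GenB, True) # (GenB, \<not> True) # replicate i (GenB, False)"
      by (simp add: replicate_app_Cons_same)
    also have "\<dots> \<approx> replicate i (GenB, True) @ replicate i (GenB, False)"
      by (intro weq_append weq_cancel weq_refl)
    also note Suc.IH
    finally show ?case .
  qed (simp add: weq_refl)
  with w show ?thesis by (auto simp: nf_def j l intro: weq_trans)
qed

lemma word_inv_cancel: "word_inv w @ w \<approx> []"
  by (rule weq_Nil_if) (simp add: wval_append wval_word_inv)

lemma weq_iff_wval: "u \<approx> v \<longleftrightarrow> wval u = wval v"
proof
  assume "wval u = wval v"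
  then have "u @ word_inv v \<approx> []"
    by (intro weq_Nil_if) (simp add: wval_append wval_word_inv)
  have "u @ [] \<approx> u @ word_inv v @ v"
    by (intro weq_append weq_refl weq_sym[OF word_inv_cancel])
  also have "\<dots> = (u @ word_inv v) @ v" by simp
  also have "\<dots> \<approx> [] @ v" by (intro weq_append weq_refl \<open>u @ word_inv v \<approx> []\<close>)
  finally show "u \<approx> v" by simp
qed (rule weq_wval)

section \<open>The presented group viewed inside the affine model\<close>

definition val :: "bs_gen word set \<Rightarrow> rat \<times> int" where
  "val X = wval (pres_rep X)"

lemma BS_simps: "carrier (BS k) = range (pres_class rels)" "interp (BS k) = pres_interp rels"
  by (simp_all add: BS_def presented_group_def carrier_def interp_def)

lemma val_class [simp]: "val (pres_class rels w) = wval w"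
proof -
  have "w \<in> pres_class rels w" by (simp add: pres_class_def weq_refl)
  then have "pres_rep (pres_class rels w) \<in> pres_class rels w"
    unfolding pres_rep_def by (rule someI)
  then show ?thesis unfolding val_def by (simp add: pres_class_def weq_iff_wval)
qed

lemma inj_val: "inj_on val (carrier (BS k))"
proof (rule inj_onI)
  fix X Y assume "X \<in> carrier (BS k)" "Y \<in> carrier (BS k)" "val X = val Y"
  then obtain u v where "X = pres_class rels u" "Y = pres_class rels v" "wval u = wval v"
    by (auto simp: BS_simps)
  then show "X = Y" by (simp add: pres_class_def weq_iff_wval)
qed

lemma wval_V: "wval w \<in> V"
proof (induction w)
  case (Cons l w)
  obtain g s where "l = (g, s)" by (cases l)
  then have "letter l \<in> V" by (cases g) auto
  then show ?case using Cons by simp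
qed simp

lemma val_image: "val ` carrier (BS k) = V"
proof -
  have image: "val ` carrier (BS k) = range wval" by (auto simp: BS_simps image_iff)
  have "g \<in> range wval" if gV: "g \<in> V" for g
  proof -
    obtain x m where g: "g = (x, m)" "x \<in> R" using gV by (cases g) auto
    obtain n j where x: "x * of_nat k ^ n = of_int j" using g(2) by (auto simp: R_def)
    \<comment> \<open>Large enough for x k^i to be an integer and for the number i - m of trailing
      letters b^-1 to be nonnegative.\<close>
    define i where "i = n + nat \<bar>m\<bar>"
    have "m \<le> int i" by (simp add: i_def)
    have "e (- int i) * of_int (j * int k ^ nat \<bar>m\<bar>) = e (- int i) * (x * e (int i))"
      by (simp add: x[symmetric] i_def e_add e_of_nat del: of_nat_add of_nat_nat)
        (simp add: e_add flip: e_of_nat)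
    also have "\<dots> = x" by (simp add: mult.left_commute)
    finally have "wval (nf i (j * int k ^ nat \<bar>m\<bar>) (nat (int i - m))) = g"
      unfolding wval_nf g using \<open>m \<le> int i\<close> by simp
    then show ?thesis by (metis rangeI)
  qed
  then have "V \<subseteq> range wval" by (rule subsetI)
  moreover have "range wval \<subseteq> V" by (rule image_subsetI) (rule wval_V)
  ultimately show ?thesis unfolding image by (rule equalityI[rotated])
qed

lemma val_mul: "val (interp (BS k) GMul [X, Y]) = gm (val X) (val Y)"
  by (simp add: BS_simps wval_append) (simp add: val_def)

lemma val_inv: "val (interp (BS k) GInv [X]) = gi (val X)"
  by (simp add: BS_simps wval_word_inv) (simp add: val_def)

lemma val_one: "val (interp (BS k) GE []) = (0, 0)"
  by (simp add: BS_simps)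

lemma struct_BS: "is_struct grp_arity (BS k)"
  unfolding is_struct_def
proof (intro conjI allI impI)
  show "carrier (BS k) \<noteq> {}" by (simp add: BS_simps)
  fix f xs show "interp (BS k) f xs \<in> carrier (BS k)"
    by (cases f) (auto simp: BS_simps)
qed

end

section \<open>Definability in \<open>\<int>\<close> and in \<open>BS(1,k)\<close>\<close>

lemma struct_Zring: "is_struct ring_arity Zring"
  by (auto simp: is_struct_def Zring_def carrier_def)

interpretation Z: viewed ring_arity Zring "\<lambda>x. x"
  by unfold_locales (auto simp: struct_Zring)

lemma Z_carrier: "carrier Zring = UNIV"
  by (simp add: Zring_def carrier_def)

lemma Z_T_add: "Z.T n s \<Longrightarrow> Z.T n t \<Longrightarrow> Z.T n (\<lambda>\<rho>. s \<rho> + t \<rho>)"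
  by (rule Z.T_app2[where f = RAdd and F = "(+)"]) (auto simp: Zring_def interp_def)

lemma Z_T_mult: "Z.T n s \<Longrightarrow> Z.T n t \<Longrightarrow> Z.T n (\<lambda>\<rho>. s \<rho> * t \<rho>)"
  by (rule Z.T_app2[where f = RMul and F = "(*)"]) (auto simp: Zring_def interp_def)

lemma Z_T_0: "Z.T n (\<lambda>\<rho>. 0)"
  by (rule Z.T_app0[where f = RZero]) (auto simp: Zring_def interp_def)

lemma Z_T_1: "Z.T n (\<lambda>\<rho>. 1)"
  by (rule Z.T_app0[where f = ROne]) (auto simp: Zring_def interp_def)

lemma Z_T_of_nat: "Z.T n (\<lambda>\<rho>. int c)"
proof (induction c)
  case (Suc c)
  then show ?case using Z_T_add[OF Z_T_1 Suc] by (simp add: add.commute)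
qed (simp add: Z_T_0)

lemma Z_ex: "Z.D (Suc n) (\<lambda>\<rho>. R (\<rho> 0) (\<lambda>i. \<rho> (Suc i))) \<Longrightarrow> Z.D n (\<lambda>\<rho>. \<exists>a. R a \<rho>)"
  using Z.D_ex[of n R] by (simp add: Z_carrier)

lemma Z_all: "Z.D (Suc n) (\<lambda>\<rho>. R (\<rho> 0) (\<lambda>i. \<rho> (Suc i))) \<Longrightarrow> Z.D n (\<lambda>\<rho>. \<forall>a. R a \<rho>)"
  using Z.D_all[of n R] by (simp add: Z_carrier)

lemmas Z_intros = Z.D_eq Z.D_neg Z.D_conj Z.D_disj Z.D_imp Z.D_iff Z_ex Z_all
  Z_T_add Z_T_mult Z_T_0 Z_T_1 Z_T_of_nat Z.T_var

lemma Z_dvd: "Z.T (Suc n) (\<lambda>\<rho>. s (\<lambda>i. \<rho> (Suc i))) \<Longrightarrow> Z.T (Suc n) (\<lambda>\<rho>. t (\<lambda>i. \<rho> (Suc i))) \<Longrightarrow>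
    Z.D n (\<lambda>\<rho>. s \<rho> dvd t \<rho>)"
  unfolding dvd_def by (intro Z_ex Z.D_eq Z_T_mult Z.T_var) auto

context baumslag_solitar
begin

lemma Z_kpow: "i < n \<Longrightarrow> Z.D n (\<lambda>\<rho>. kpow k (\<rho> i))"
  unfolding kpow_iff[OF k] by (intro Z_intros Z_dvd) auto

sublocale G: viewed grp_arity "BS k" val
  by unfold_locales (auto simp: struct_BS inj_val)

lemma G_T_mul: "G.T n s \<Longrightarrow> G.T n t \<Longrightarrow> G.T n (\<lambda>\<rho>. gm (s \<rho>) (t \<rho>))"
  by (rule G.T_app2[where f = GMul and F = gm]) (auto simp: val_mul)

lemma G_T_inv: "G.T n t \<Longrightarrow> G.T n (\<lambda>\<rho>. gi (t \<rho>))"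
  by (rule G.T_app1[where f = GInv and F = gi]) (auto simp: val_inv)

lemma G_T_one: "G.T n (\<lambda>\<rho>. (0, 0))"
  by (rule G.T_app0[where f = GE]) (auto simp: val_one)

section \<open>Definable relations on heights in the group\<close>

definition cj :: "rat \<times> int \<Rightarrow> rat \<times> int \<Rightarrow> rat \<times> int" where
  "cj x g = gm (gi g) (gm x g)"

definition com :: "rat \<times> int \<Rightarrow> rat \<times> int \<Rightarrow> rat \<times> int" where
  "com x g = gm (gi x) (cj x g)"

primrec gpow :: "nat \<Rightarrow> rat \<times> int \<Rightarrow> rat \<times> int" where
  "gpow 0 x = (0, 0)"
| "gpow (Suc n) x = gm x (gpow n x)"

lemma cj_closed [simp]: "x \<in> V \<Longrightarrow> g \<in> V \<Longrightarrow> cj x g \<in> V"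
  by (simp add: cj_def)

lemma cj_A: "cj (t, 0) g = (e (snd g) * t, 0)"
  by (simp add: cj_def gm_def gi_def algebra_simps)

text \<open>Commutation with any element of height m is multiplication by \<open>e m - 1\<close> on
  Z[1/k]. This turns the ideal conditions of \<open>dvd_iff_R\<close> and
  \<open>int_multiple_iff_R\<close> into group equations.\<close>

lemma com_A: "com (t, 0) g = ((e (snd g) - 1) * t, 0)"
  by (simp add: com_def cj_A) (simp add: gm_def gi_def algebra_simps)

lemma gpow_A: "gpow n (t, 0) = (of_nat n * t, 0)"
  by (induction n) (auto simp: gm_def algebra_simps)

lemma G_T_cj: "G.T n s \<Longrightarrow> G.T n t \<Longrightarrow> G.T n (\<lambda>\<rho>. cj (s \<rho>) (t \<rho>))"
  unfolding cj_def by (intro G_T_mul G_T_inv)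

lemma G_T_com: "G.T n s \<Longrightarrow> G.T n t \<Longrightarrow> G.T n (\<lambda>\<rho>. com (s \<rho>) (t \<rho>))"
  unfolding com_def by (intro G_T_mul G_T_inv G_T_cj)

lemma G_T_gpow: "G.T n t \<Longrightarrow> G.T n (\<lambda>\<rho>. gpow j (t \<rho>))"
  by (induction j) (auto intro: G_T_mul G_T_one)

lemmas G_ex = G.D_ex[unfolded val_image]
lemmas G_all = G.D_all[unfolded val_image]
lemmas G_cong = G.D_cong[unfolded val_image]

lemmas G_intros = G.D_eq G.D_neg G.D_conj G.D_disj G.D_imp G.D_iff G_ex G_all
  G_T_mul G_T_inv G_T_one G_T_cj G_T_com G_T_gpow G.T_var

text \<open>Z[1/k] is abelian and normal, so its elements commute with all their conjugates.
  Conversely, the conjugate by (1, 0) suffices: commuting with it gives (k^-m - 1)^2 = 0 for the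
  height m.\<close>

lemma in_A_iff: "snd x = 0 \<longleftrightarrow> (\<forall>g\<in>V. gm (cj x g) x = gm x (cj x g))" if "x \<in> V"
proof
  assume "snd x = 0"
  then obtain t where "x = (t, 0)" by (cases x) auto
  then show "\<forall>g\<in>V. gm (cj x g) x = gm x (cj x g)" by (simp add: cj_A) (simp add: gm_def add.commute)
next
  assume "\<forall>g\<in>V. gm (cj x g) x = gm x (cj x g)"
  then have "gm (cj x (1, 0)) x = gm x (cj x (1, 0))" by simp
  then have "(e (- snd x) - 1) * (e (- snd x) - 1) = 0"
    by (cases x) (simp add: cj_def gm_def gi_def algebra_simps)
  then show "snd x = 0" by simp
qed

lemma G_in_A: "i < n \<Longrightarrow> G.D n (\<lambda>\<rho>. snd (\<rho> i) = 0)"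
  by (rule G_cong[where R = "\<lambda>\<rho>. \<forall>g\<in>V. gm (cj (\<rho> i) g) (\<rho> i) = gm (\<rho> i) (cj (\<rho> i) g)"])
    (intro G_intros, simp_all add: in_A_iff)

lemma ex_A: "(\<exists>v\<in>V. snd v = 0 \<and> P v) \<longleftrightarrow> (\<exists>t\<in>R. P (t, 0))"
  by (auto simp: V_def)

lemma all_A: "(\<forall>v\<in>V. snd v = 0 \<longrightarrow> P v) \<longleftrightarrow> (\<forall>t\<in>R. P (t, 0))"
  by (auto simp: V_def)

lemma G_dvd: "i < n \<Longrightarrow> j < n \<Longrightarrow> G.D n (\<lambda>\<rho>. snd (\<rho> i) dvd snd (\<rho> j))"
  by (rule G_cong[where R = "\<lambda>\<rho>. \<forall>u\<in>V. snd u = 0 \<longrightarrow>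
      (\<exists>v\<in>V. snd v = 0 \<and> com u (\<rho> j) = com v (\<rho> i))"], intro G_intros G_in_A)
    (simp_all only: ex_A all_A, simp_all add: com_A dvd_iff_R)

text \<open>As k is a fixed number, multiplication by k on Z[1/k] is a group term. The value at 1
  recovers k^m = k for the height m of c.\<close>

lemma height_1_iff: "snd c = 1 \<longleftrightarrow> (\<forall>u\<in>V. snd u = 0 \<longrightarrow> cj u c = gpow k u)"
proof -
  have "(\<forall>t\<in>R. e (snd c) * t = of_nat k * t) \<longleftrightarrow> e (snd c) = e 1"
  proof
    assume "\<forall>t\<in>R. e (snd c) * t = of_nat k * t"
    from bspec[OF this R_1] show "e (snd c) = e 1" by (simp del: e_eq_iff)
  qed simp
  then show ?thesis unfolding all_A cj_A gpow_A by (simp only: prod.inject simp_thms e_eq_iff)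
qed

lemma G_height_1: "i < n \<Longrightarrow> G.D n (\<lambda>\<rho>. snd (\<rho> i) = 1)"
  unfolding height_1_iff by (intro G_intros G_in_A) auto

text \<open>The definability rules for heights accept variables but no terms. Compound arguments are
  therefore named by a quantifier, and this rule removes it again.\<close>

lemma bex_eq: "t \<in> V \<Longrightarrow> (\<exists>x\<in>V. x = t \<and> P x) \<longleftrightarrow> P t"
  by auto

lemma snd_V: "snd ` V = UNIV"
proof -
  have "R \<noteq> {}" by (metis R_0 empty_iff)
  then show ?thesis by (simp add: V_def snd_image_times)
qed

lemma ball_snd: "(\<forall>w\<in>V. P (snd w)) \<longleftrightarrow> (\<forall>m. P m)"
proof -
  have "(\<forall>m. P m) \<longleftrightarrow> (\<forall>m\<in>snd ` V. P m)" unfolding snd_V by simp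
  then show ?thesis by simp
qed

lemma bex_snd: "(\<exists>w\<in>V. P (snd w)) \<longleftrightarrow> (\<exists>m. P m)"
  using ball_snd[of "\<lambda>m. \<not> P m"] by blast

lemma snd_gm [simp]: "snd (gm g h) = snd g + snd h" and snd_gi [simp]: "snd (gi g) = - snd g"
  by (simp_all add: gm_def gi_def)

text \<open>\<open>square_iff_dvd\<close> moved to heights: every integer is the height of some
  element, products add heights, and any c of height 1 supplies the shifts by 1.\<close>

lemma height_square_iff:
  assumes "x \<in> V" "z \<in> V"
  shows "snd z = snd x * snd x \<longleftrightarrow> (\<exists>c\<in>V. snd c = 1 \<and> (\<exists>xp\<in>V. xp = gm x c \<and> (\<exists>xm\<in>V. xm = gm x (gi c) \<and>
    (\<exists>zp\<in>V. zp = gm z x \<and> (\<exists>zm\<in>V. zm = gm z (gi x) \<and>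
     (\<forall>w\<in>V. snd x dvd snd w \<and> snd xp dvd snd w \<longleftrightarrow> snd zp dvd snd w) \<and>
     (\<forall>w\<in>V. snd x dvd snd w \<and> snd xm dvd snd w \<longleftrightarrow> snd zm dvd snd w))))))" (is "_ \<longleftrightarrow> ?R")
proof -
  have b: "(\<forall>w\<in>V. p dvd snd w \<and> q dvd snd w \<longleftrightarrow> r dvd snd w) \<longleftrightarrow> (\<forall>w. p dvd w \<and> q dvd w \<longleftrightarrow> r dvd w)"
    for p q r by (rule ball_snd)
  have "?R \<longleftrightarrow> (\<exists>c\<in>V. snd c = 1 \<and>
     (\<forall>w\<in>V. snd x dvd snd w \<and> snd x + snd c dvd snd w \<longleftrightarrow> snd z + snd x dvd snd w) \<and>
     (\<forall>w\<in>V. snd x dvd snd w \<and> snd x - snd c dvd snd w \<longleftrightarrow> snd z - snd x dvd snd w))"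
    by (rule bex_cong[OF HOL.refl]) (simp only: bex_eq gm_closed gi_closed assms snd_gm snd_gi add_uminus_conv_diff)
  also have "\<dots> \<longleftrightarrow> snd z = snd x * snd x"
    unfolding square_iff_dvd b using bex_snd[of "\<lambda>c. c = 1 \<and>
     (\<forall>w. snd x dvd w \<and> snd x + c dvd w \<longleftrightarrow> snd z + snd x dvd w) \<and>
     (\<forall>w. snd x dvd w \<and> snd x - c dvd w \<longleftrightarrow> snd z - snd x dvd w)"] by simp
  finally show ?thesis by simp
qed

lemma G_height_square: "i < n \<Longrightarrow> j < n \<Longrightarrow> G.D n (\<lambda>\<rho>. snd (\<rho> j) = snd (\<rho> i) * snd (\<rho> i))"
  by (rule G_cong[OF _ height_square_iff], intro G_intros G_dvd G_height_1) auto

text \<open>Polarisation, (x + y)^2 = x^2 + y^2 + 2 x y. The element d has height x^2 + y^2 + 2 z -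
  (x + y)^2, where x, y, z stand for the heights, and this vanishes exactly when z = x y.\<close>

lemma height_mult_iff:
  assumes "x \<in> V" "y \<in> V" "z \<in> V"
  shows "snd z = snd x * snd y \<longleftrightarrow> (\<exists>s\<in>V. s = gm x y \<and> (\<exists>p\<in>V. snd p = snd x * snd x \<and>
    (\<exists>q\<in>V. snd q = snd y * snd y \<and> (\<exists>r\<in>V. snd r = snd s * snd s \<and>
    (\<exists>d\<in>V. d = gm (gi r) (gm p (gm q (gm z z))) \<and> snd d = 0)))))" (is "_ \<longleftrightarrow> ?R")
proof
  let ?p = "(0 :: rat, snd x * snd x)" and ?q = "(0 :: rat, snd y * snd y)"
  let ?r = "(0 :: rat, (snd x + snd y) * (snd x + snd y))"
  assume "snd z = snd x * snd y"
  then have "snd (gm (gi ?r) (gm ?p (gm ?q (gm z z)))) = 0" by (simp add: algebra_simps)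
  moreover have "gm (gi ?r) (gm ?p (gm ?q (gm z z))) \<in> V" using assms by simp
  ultimately have "\<exists>d\<in>V. d = gm (gi ?r) (gm ?p (gm ?q (gm z z))) \<and> snd d = 0" by blast
  then have "\<exists>r\<in>V. snd r = (snd x + snd y) * (snd x + snd y) \<and>
      (\<exists>d\<in>V. d = gm (gi r) (gm ?p (gm ?q (gm z z))) \<and> snd d = 0)"
    by (intro bexI[of _ ?r]) auto
  then have "\<exists>q\<in>V. snd q = snd y * snd y \<and> (\<exists>r\<in>V. snd r = (snd x + snd y) * (snd x + snd y) \<and>
      (\<exists>d\<in>V. d = gm (gi r) (gm ?p (gm q (gm z z))) \<and> snd d = 0))"
    by (intro bexI[of _ ?q]) auto
  then have "\<exists>p\<in>V. snd p = snd x * snd x \<and> (\<exists>q\<in>V. snd q = snd y * snd y \<and>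
      (\<exists>r\<in>V. snd r = (snd x + snd y) * (snd x + snd y) \<and>
      (\<exists>d\<in>V. d = gm (gi r) (gm p (gm q (gm z z))) \<and> snd d = 0)))"
    by (intro bexI[of _ ?p]) auto
  then show ?R using assms by (intro bexI[of _ "gm x y"]) auto
next
  assume ?R
  then obtain p q r where "snd p = snd x * snd x" "snd q = snd y * snd y"
    "snd r = (snd x + snd y) * (snd x + snd y)" "snd (gm (gi r) (gm p (gm q (gm z z)))) = 0"
    by auto
  then show "snd z = snd x * snd y" by (simp add: algebra_simps)
qed

lemma G_height_mult: "i < n \<Longrightarrow> j < n \<Longrightarrow> l < n \<Longrightarrow> G.D n (\<lambda>\<rho>. snd (\<rho> l) = snd (\<rho> i) * snd (\<rho> j))"
  by (rule G_cong[OF _ height_mult_iff], intro G_intros G_height_square G_in_A) auto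

text \<open>In multiplicative notation, y = a^n with n the height of c: the bridge that carries
  integers from heights to the cyclic group of a.\<close>

definition mul :: "rat \<times> int \<Rightarrow> rat \<times> int \<Rightarrow> rat \<times> int \<Rightarrow> bool" where
  "mul a c y \<longleftrightarrow> snd a = 0 \<and> snd y = 0 \<and> fst y = of_int (snd c) * fst a"

definition cyc :: "rat \<times> int \<Rightarrow> rat \<times> int \<Rightarrow> bool" where
  "cyc a y \<longleftrightarrow> snd a = 0 \<and> snd y = 0 \<and> (\<exists>n. fst y = of_int n * fst a)"

text \<open>\<open>int_multiple_iff_R\<close> with both multiplications by \<open>e m - 1\<close>
  written as commutators with m, and the one by \<open>e l - 1\<close> as a commutator with l.
  Quantifiers over elements act as quantifiers over heights because only heights occur.\<close>

lemma mul_iff: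
  assumes "a \<in> V" "c \<in> V" "y \<in> V"
  shows "mul a c y \<longleftrightarrow> snd a = 0 \<and> snd y = 0 \<and> (\<forall>m\<in>V. \<forall>l\<in>V. snd l = snd m * snd c \<longrightarrow>
    (\<exists>t\<in>V. snd t = 0 \<and> com a l = com (gm y (com t m)) m))"
proof (cases "snd a = 0 \<and> snd y = 0")
  case True
  then obtain \<alpha> \<eta> where ay: "a = (\<alpha>, 0)" "y = (\<eta>, 0)" "\<alpha> \<in> R" "\<eta> \<in> R"
    using assms by (cases a, cases y) auto
  have com2: "com (gm y (com (t, 0) m)) m = ((e (snd m) - 1) * (\<eta> + (e (snd m) - 1) * t), 0)" for t m
  proof -
    have "gm y (com (t, 0) m) = (\<eta> + (e (snd m) - 1) * t, 0)"
      by (simp add: com_A ay) (simp add: gm_def)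
    then show ?thesis by (simp only: com_A)
  qed
  have "(\<forall>m\<in>V. \<forall>l\<in>V. snd l = snd m * snd c \<longrightarrow>
    (\<exists>t\<in>V. snd t = 0 \<and> com a l = com (gm y (com t m)) m)) \<longleftrightarrow>
    (\<forall>m\<in>V. \<forall>l\<in>V. snd l = snd m * snd c \<longrightarrow>
    (\<exists>t\<in>R. (e (snd l) - 1) * \<alpha> = (e (snd m) - 1) * (\<eta> + (e (snd m) - 1) * t)))"
    unfolding ex_A com2 by (simp add: ay com_A)
  also have "\<dots> \<longleftrightarrow> (\<forall>m l. l = m * snd c \<longrightarrow>
    (\<exists>t\<in>R. (e l - 1) * \<alpha> = (e m - 1) * (\<eta> + (e m - 1) * t)))"
    by (subst ball_snd, subst ball_snd) (rule HOL.refl)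
  also have "\<dots> \<longleftrightarrow> \<eta> = of_int (snd c) * \<alpha>"
    by (rule int_multiple_iff_R[OF ay(3,4)])
  finally show ?thesis unfolding mul_def by (simp add: ay)
qed (auto simp: mul_def)

lemma G_mul: "i < n \<Longrightarrow> j < n \<Longrightarrow> l < n \<Longrightarrow> G.D n (\<lambda>\<rho>. mul (\<rho> i) (\<rho> j) (\<rho> l))"
  by (rule G_cong[OF _ mul_iff], intro G_intros G_height_mult G_in_A) auto

lemma cyc_iff: "cyc a y \<longleftrightarrow> (\<exists>c\<in>V. mul a c y)"
  unfolding cyc_def mul_def using bex_snd[of "\<lambda>n. snd a = 0 \<and> snd y = 0 \<and> fst y = of_int n * fst a"]
  by auto

lemma G_cyc: "i < n \<Longrightarrow> j < n \<Longrightarrow> G.D n (\<lambda>\<rho>. cyc (\<rho> i) (\<rho> j))"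
  unfolding cyc_iff by (intro G_intros G_mul) auto

text \<open>Every element of Z[1/k] has a conjugate in the cyclic group of a. Conjugation multiplies
  by powers of k and so clears denominators, which makes generation as a Z[1/k]-module a first-order
  condition.\<close>

definition basis :: "rat \<times> int \<Rightarrow> rat \<times> int \<Rightarrow> bool" where
  "basis a b \<longleftrightarrow> snd a = 0 \<and> snd b = 1 \<and> (\<forall>y\<in>V. snd y = 0 \<longrightarrow> (\<exists>w\<in>V. cyc a (cj y w)))"

lemma basis_iff: "basis a b \<longleftrightarrow> snd a = 0 \<and> snd b = 1 \<and>
    (\<forall>y\<in>V. snd y = 0 \<longrightarrow> (\<exists>w\<in>V. \<exists>z\<in>V. z = cj y w \<and> cyc a z))"
proof -
  have "(\<exists>w\<in>V. cyc a (cj y w)) \<longleftrightarrow> (\<exists>w\<in>V. \<exists>z\<in>V. z = cj y w \<and> cyc a z)" if "y \<in> V" for y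
    using that by (intro bex_cong) (simp_all add: bex_eq)
  then show ?thesis by (simp add: basis_def)
qed

lemma G_basis: "i < n \<Longrightarrow> j < n \<Longrightarrow> G.D n (\<lambda>\<rho>. basis (\<rho> i) (\<rho> j))"
  unfolding basis_iff by (intro G_intros G_in_A G_height_1 G_cyc) auto

end

section \<open>The two interpretations\<close>

context baumslag_solitar
begin

definition lg :: "int \<Rightarrow> int" where "lg z = (THE m. e m = of_int z)"

text \<open>Negative exponents drop out, since \<open>e m\<close> then lies strictly between 0 and
  1.\<close>

lemma kpow_iff_e: "kpow k z \<longleftrightarrow> (\<exists>m. e m = of_int z)"
proof
  assume "kpow k z"
  then obtain n where "z = int k ^ n" by (auto simp: kpow_def)
  then show "\<exists>m. e m = of_int z" by (intro exI[of _ "int n"]) (simp add: e_of_nat)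
next
  assume "\<exists>m. e m = of_int z"
  then obtain m where m: "e m = of_int z" by blast
  have "m \<ge> 0"
  proof (rule ccontr)
    assume "\<not> m \<ge> 0"
    then have "e m < e 0" unfolding e_def using k by (intro power_int_strict_increasing) auto
    then show False using m e_pos[of m] by simp
  qed
  then have "e m = of_int (int k ^ nat m)" using e_of_nat[of "nat m"] by simp
  then have "z = int k ^ nat m" using m by (simp only: of_int_eq_iff)
  then show "kpow k z" unfolding kpow_def by blast
qed

lemma lg_eq: "e m = of_int z \<Longrightarrow> lg z = m"
  unfolding lg_def by (rule the_equality) (auto simp flip: e_eq_iff)

lemma e_lg: "kpow k z \<Longrightarrow> e (lg z) = of_int z"
  using lg_eq by (auto simp: kpow_iff_e)

lemma kpow_pos: "kpow k z \<Longrightarrow> z > 0"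
  using k by (auto simp: kpow_def)

text \<open>The triple \<open>[i, p, q]\<close> codes \<open>(i/q, log\<^sub>k (p/q))\<close>.\<close>
definition dec :: "int list \<Rightarrow> rat \<times> int" where
  "dec u = (of_int (u ! 0) / of_int (u ! 2), lg (u ! 1) - lg (u ! 2))"

definition UZ :: "int list set" where
  "UZ = {u. length u = 3 \<and> kpow k (u ! 1) \<and> kpow k (u ! 2)}"

lemma length_3: "length u = 3 \<longleftrightarrow> (\<exists>x y z. u = [x, y, z])"
  by (auto simp: length_Suc_conv numeral_3_eq_3)

lemma UZ_3 [simp]: "[i, p, q] \<in> UZ \<longleftrightarrow> kpow k p \<and> kpow k q"
  by (simp add: UZ_def)

lemma dec_3: "kpow k p \<Longrightarrow> kpow k q \<Longrightarrow>
    fst (dec [i, p, q]) = of_int i / of_int q \<and> e (snd (dec [i, p, q])) = of_int p / of_int q"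
  using e_add[of "lg p - lg q" "lg q"] kpow_pos[of q] by (simp add: dec_def e_lg field_simps)

text \<open>Comparing powers of k instead of heights turns equations between codes into equations of
  fractions, which can be cross-multiplied.\<close>

lemma pair_eq_iff: "g = g' \<longleftrightarrow> fst g = fst g' \<and> e (snd g) = e (snd g')"
  by (simp add: prod_eq_iff)

lemma e_snd_gm: "e (snd (gm g g')) = e (snd g) * e (snd g')" and e_snd_gi: "e (snd (gi g)) = inverse (e (snd g))"
  by (simp_all add: e_add e_minus)

lemma fst_gm: "fst (gm g g') = fst g + inverse (e (snd g)) * fst g'" and fst_gi: "fst (gi g) = - e (snd g) * fst g"
  by (simp_all add: gm_def gi_def e_minus)

lemma dec_eq_iff:
  assumes "kpow k p" "kpow k q" "kpow k p'" "kpow k q'"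
  shows "dec [i, p, q] = dec [i', p', q'] \<longleftrightarrow> i * q' = i' * q \<and> p * q' = p' * q"
proof -
  have "q \<noteq> 0" "q' \<noteq> 0" using kpow_pos[OF assms(2)] kpow_pos[OF assms(4)] by auto
  then have "dec [i, p, q] = dec [i', p', q'] \<longleftrightarrow>
      (of_int (i * q') :: rat) = of_int (i' * q) \<and> (of_int (p * q') :: rat) = of_int (p' * q)"
    unfolding pair_eq_iff using dec_3[OF assms(1,2), of i] dec_3[OF assms(3,4), of i']
    by (simp add: frac_eq_eq)
  then show ?thesis by (simp only: of_int_eq_iff)
qed

text \<open>The factor k^-m of the left argument is q/p, so the first component is i/q + (q/p)
  (i'/q'). Cross-multiplication gives polynomial equations.\<close>

lemma gm_dec_iff:
  assumes "kpow k p" "kpow k q" "kpow k p'" "kpow k q'" "kpow k p''" "kpow k q''"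
  shows "gm (dec [i, p, q]) (dec [i', p', q']) = dec [i'', p'', q''] \<longleftrightarrow>
    i'' * (q * (p * q')) = q'' * (i * (p * q') + q * (q * i')) \<and> p'' * (q * q') = p * p' * q''"
proof -
  have ne: "p \<noteq> 0" "q \<noteq> 0" "q' \<noteq> 0" "q'' \<noteq> 0"
    using kpow_pos[OF assms(1)] kpow_pos[OF assms(2)] kpow_pos[OF assms(4)] kpow_pos[OF assms(6)] by auto
  have "gm (dec [i, p, q]) (dec [i', p', q']) = dec [i'', p'', q''] \<longleftrightarrow>
     (of_int i / of_int q + of_int q / of_int p * (of_int i' / of_int q') = (of_int i'' / of_int q'' :: rat)) \<and>
     (of_int p / of_int q * (of_int p' / of_int q') = (of_int p'' / of_int q'' :: rat))"
    unfolding pair_eq_iff e_snd_gm fst_gm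
    using dec_3[OF assms(1,2), of i] dec_3[OF assms(3,4), of i'] dec_3[OF assms(5,6), of i''] by simp
  also have "of_int i / of_int q + of_int q / of_int p * (of_int i' / of_int q') =
     (of_int (i * (p * q') + q * (q * i')) / of_int (q * (p * q')) :: rat)"
    using ne by (simp add: field_simps)
  also have "of_int p / of_int q * (of_int p' / of_int q') = (of_int (p * p') / of_int (q * q') :: rat)"
    using ne by simp
  also have "of_int (i * (p * q') + q * (q * i')) / of_int (q * (p * q')) = (of_int i'' / of_int q'' :: rat) \<longleftrightarrow>
     (of_int ((i * (p * q') + q * (q * i')) * q'') :: rat) = of_int (i'' * (q * (p * q')))"
    using ne by (subst frac_eq_eq) auto
  also have "of_int (p * p') / of_int (q * q') = (of_int p'' / of_int q'' :: rat) \<longleftrightarrow>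
     (of_int (p * p' * q'') :: rat) = of_int (p'' * (q * q'))"
    using ne by (subst frac_eq_eq) auto
  finally show ?thesis unfolding of_int_eq_iff by (auto simp: mult.commute[of q''])
qed

text \<open>The first component, - (p/q) (i/q), is compared through a vanishing sum because the ring
  language has no subtraction.\<close>

lemma gi_dec_iff:
  assumes "kpow k p" "kpow k q" "kpow k p'" "kpow k q'"
  shows "gi (dec [i, p, q]) = dec [i', p', q'] \<longleftrightarrow> i' * (q * q) + q' * (p * i) = 0 \<and> p' * p = q * q'"
proof -
  have ne: "p \<noteq> 0" "q \<noteq> 0" "q' \<noteq> 0"
    using kpow_pos[OF assms(1)] kpow_pos[OF assms(2)] kpow_pos[OF assms(4)] by auto
  have "gi (dec [i, p, q]) = dec [i', p', q'] \<longleftrightarrow>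
     (- (of_int p / of_int q) * (of_int i / of_int q) = (of_int i' / of_int q' :: rat)) \<and>
     (of_int q / of_int p = (of_int p' / of_int q' :: rat))"
    unfolding pair_eq_iff e_snd_gi fst_gi
    using dec_3[OF assms(1,2), of i] dec_3[OF assms(3,4), of i'] by simp
  also have "- (of_int p / of_int q) * (of_int i / of_int q) = (of_int (- (p * i)) / of_int (q * q) :: rat)"
    by simp
  also have "of_int (- (p * i)) / of_int (q * q) = (of_int i' / of_int q' :: rat) \<longleftrightarrow>
     (of_int (- (p * i) * q') :: rat) = of_int (i' * (q * q))"
    using ne by (subst frac_eq_eq) auto
  also have "of_int q / of_int p = (of_int p' / of_int q' :: rat) \<longleftrightarrow>
     (of_int (q * q') :: rat) = of_int (p' * p)"
    using ne by (subst frac_eq_eq) auto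
  finally show ?thesis unfolding of_int_eq_iff by (auto simp: algebra_simps)
qed

lemma one_dec_iff:
  assumes "kpow k p" "kpow k q"
  shows "(0, 0) = dec [i, p, q] \<longleftrightarrow> i = 0 \<and> p = q"
  using dec_3[OF assms, of i] kpow_pos[OF assms(2)] unfolding pair_eq_iff by auto

lemma dec_onto: "dec ` UZ = V"
proof
  show "dec ` UZ \<subseteq> V"
  proof (rule image_subsetI)
    fix u assume "u \<in> UZ"
    then have "fst (dec u) = of_int (u ! 0) * e (- lg (u ! 2))"
      by (simp add: UZ_def dec_def e_minus e_lg field_simps)
    then have "fst (dec u) \<in> R" by simp
    then show "dec u \<in> V" by (cases "dec u") simp
  qed
  show "V \<subseteq> dec ` UZ"
  proof
    fix g assume g: "g \<in> V"
    obtain x m where xm: "g = (x, m)" by (cases g)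
    then obtain n i where i: "x * of_nat k ^ n = of_int i" using g by (auto simp: R_def)
    \<comment> \<open>The denominator q = k^N must make x q an integer and also leave N + m
      nonnegative, so that p = q k^m is an integer.\<close>
    define N where "N = n + nat \<bar>m\<bar>"
    define p where "p = int k ^ nat (int N + m)"
    define q where "q = int k ^ N"
    define j where "j = i * int k ^ nat \<bar>m\<bar>"
    have N: "int N + m \<ge> 0" by (simp add: N_def)
    have p: "kpow k p" and q: "kpow k q" by (auto simp: kpow_def p_def q_def)
    have "of_int p = e (int N + m)" using e_of_nat[of "nat (int N + m)"] N by (simp add: p_def)
    moreover have "of_int q = e (int N)" by (simp add: q_def e_of_nat)
    ultimately have "lg p = int N + m" "lg q = int N" by (simp_all add: lg_eq)
    moreover have "of_int j = x * of_int q"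
      by (simp add: j_def q_def N_def power_add i[symmetric])
    then have "of_int j / of_int q = x" using kpow_pos[OF q] by simp
    ultimately have "dec [j, p, q] = g" by (simp add: dec_def xm)
    then show "g \<in> dec ` UZ" using p q by (metis UZ_3 image_eqI)
  qed
qed

section \<open>Automorphisms attached to a basis\<close>

text \<open>The automorphism with \<open>(1, 0) \<mapsto> a\<close> and \<open>(0, 1) \<mapsto> b\<close>, if \<open>(a, b)\<close> is a basis.  Over \<open>\<rat>\<close> it is a
  dilation followed by a conjugation with a translation.\<close>
definition sig :: "rat \<times> int \<Rightarrow> rat \<times> int \<Rightarrow> rat \<times> int \<Rightarrow> rat \<times> int" where
  "sig a b g = (fst a * fst g + fst b / (1 - e (- 1)) * (1 - e (- snd g)), snd g)"

lemma snd_sig [simp]: "snd (sig a b g) = snd g"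
  by (simp add: sig_def)

lemma sig_gm: "gm (sig a b g) (sig a b g') = sig a b (gm g g')"
proof -
  define c where "c = fst b / (1 - e (- 1))"
  have "e (- snd g - snd g') = e (- snd g) * e (- snd g')" using e_add[of "- snd g" "- snd g'"] by simp
  then show ?thesis by (simp add: sig_def gm_def c_def[symmetric] algebra_simps)
qed

lemma sig_gi: "gi (sig a b g) = sig a b (gi g)"
proof -
  define c where "c = fst b / (1 - e (- 1))"
  have "e (snd g) * (c * e (- snd g)) = c" by (simp add: mult.left_commute)
  then show ?thesis by (simp add: sig_def gi_def c_def[symmetric] algebra_simps)
qed

lemma sig_0 [simp]: "sig a b (0, 0) = (0, 0)"
  by (simp add: sig_def)

lemma basisD:
  assumes "basis a b" "a \<in> V" "b \<in> V"
  shows "fst a \<noteq> 0" "snd a = 0" "snd b = 1"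
    "\<And>y. y \<in> R \<Longrightarrow> \<exists>m n. e m * y = of_int n * fst a"
proof -
  show a: "snd a = 0" "snd b = 1" using assms(1) by (auto simp: basis_def)
  show ex: "\<exists>m n. e m * y = of_int n * fst a" if y: "y \<in> R" for y
  proof -
    have "\<forall>t\<in>R. \<exists>w\<in>V. cyc a (cj (t, 0) w)"
      using assms(1) unfolding basis_def all_A by blast
    from bspec[OF this y] obtain w where "cyc a (cj (y, 0) w)" by (elim bexE)
    then show ?thesis by (auto simp: cyc_def cj_A)
  qed
  show "fst a \<noteq> 0" using ex[OF R_1] by auto
qed

lemma sig_inj:
  assumes "basis a b" "a \<in> V" "b \<in> V"
  shows "sig a b g = sig a b g' \<longleftrightarrow> g = g'"
  using basisD(1)[OF assms] by (auto simp: sig_def prod_eq_iff)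

lemma e_ne_1: "1 - e (- 1) \<noteq> 0"
  using e_eq_1[of "- 1"] by simp

text \<open>1 - k^-1 need not be a unit of Z[1/k], but it divides 1 - k^m because -1 divides m. So
  the conjugation by a rational translation preserves Z[1/k] even if the translation vector lies
  outside.\<close>

lemma translation_R: "\<beta> \<in> R \<Longrightarrow> \<beta> / (1 - e (- 1)) * (1 - e m) \<in> R"
proof -
  assume \<beta>: "\<beta> \<in> R"
  have "\<forall>t\<in>R. \<exists>s\<in>R. (e m - 1) * t = (e (- 1) - 1) * s"
    using dvd_iff_R[of m "- 1"] by simp
  from bspec[OF this R_1] obtain s where s: "s \<in> R" "(e m - 1) * 1 = (e (- 1) - 1) * s"
    by (elim bexE)
  have "1 - e m = (1 - e (- 1)) * s" using s(2) by (simp add: algebra_simps)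
  then have "\<beta> / (1 - e (- 1)) * (1 - e m) = \<beta> * s" using e_ne_1 by simp
  then show ?thesis using \<beta> s by simp
qed

lemma sig_V: "a \<in> V \<Longrightarrow> b \<in> V \<Longrightarrow> g \<in> V \<Longrightarrow> sig a b g \<in> V"
  unfolding sig_def V_pair by (intro R_add R_mult translation_R fst_V)

text \<open>The dilation by \<open>fst a\<close> is onto exactly because a generates: some k^m y is
  an integer multiple of \<open>fst a\<close>, and k^m can be divided out in Z[1/k].\<close>

lemma sig_onto:
  assumes "basis a b" "a \<in> V" "b \<in> V"
  shows "sig a b ` V = V"
proof
  show "sig a b ` V \<subseteq> V" using sig_V assms by blast
  show "V \<subseteq> sig a b ` V"
  proof
    fix g assume g: "g \<in> V"
    define y where "y = fst g - fst b / (1 - e (- 1)) * (1 - e (- snd g))"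
    have "y \<in> R" using g assms translation_R by (simp add: y_def)
    then obtain m n where mn: "e m * y = of_int n * fst a" using basisD(4)[OF assms] by blast
    have "y = e (- m) * (of_int n * fst a)" unfolding mn[symmetric] by simp
    then have "fst a * (e (- m) * of_int n) = y" by (simp add: algebra_simps)
    then have "sig a b (e (- m) * of_int n, snd g) = g"
      by (simp add: sig_def y_def prod_eq_iff)
    moreover have "(e (- m) * of_int n, snd g) \<in> V" by simp
    ultimately show "g \<in> sig a b ` V" by (metis image_eqI)
  qed
qed

section \<open>Reading codes with respect to a basis\<close>

definition ival :: "rat \<times> int \<Rightarrow> bs_gen word set" where
  "ival g = inv_into (carrier (BS k)) val g"

lemma val_ival [simp]: "g \<in> V \<Longrightarrow> val (ival g) = g"
  unfolding ival_def using val_image by (metis f_inv_into_f)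

lemma ival_carrier [simp]: "g \<in> V \<Longrightarrow> ival g \<in> carrier (BS k)"
  unfolding ival_def using val_image by (metis inv_into_into)

lemma val_V [simp]: "X \<in> carrier (BS k) \<Longrightarrow> val X \<in> V"
  using val_image by blast

lemma ival_val [simp]: "X \<in> carrier (BS k) \<Longrightarrow> ival (val X) = X"
  unfolding ival_def by (rule inv_into_f_f[OF inj_val])

lemma eq_ival_iff: "X \<in> carrier (BS k) \<Longrightarrow> g \<in> V \<Longrightarrow> X = ival g \<longleftrightarrow> val X = g"
  by auto

definition num :: "rat \<times> int \<Rightarrow> rat \<times> int \<Rightarrow> int" where
  "num a y = (THE n. fst y = of_int n * fst a)"

lemma num_eq: "fst a \<noteq> 0 \<Longrightarrow> fst y = of_int n * fst a \<Longrightarrow> num a y = n"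
  unfolding num_def by (rule the_equality) auto

lemma cyc_num: "fst a \<noteq> 0 \<Longrightarrow> cyc a y \<Longrightarrow> y = (of_int (num a y) * fst a, 0)"
  by (auto simp: cyc_def prod_eq_iff num_eq)

lemma cyc_num_iff:
  assumes "fst a \<noteq> 0" "snd a = 0"
  shows "cyc a y \<and> num a y = x \<longleftrightarrow> y = (of_int x * fst a, 0)"
proof
  assume "cyc a y \<and> num a y = x"
  then show "y = (of_int x * fst a, 0)" using cyc_num[OF assms(1)] by blast
next
  assume "y = (of_int x * fst a, 0)"
  then show "cyc a y \<and> num a y = x"
    using num_eq[OF assms(1), of y x] assms(2) by (auto simp: cyc_def)
qed

text \<open>The centraliser of b is the image of the axis of pure heights under the automorphism. It
  is the cyclic group of b, which is thus definable from b.\<close>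

lemma commute_basis_iff:
  assumes "basis a b" "a \<in> V" "b \<in> V"
  shows "gm h b = gm b h \<longleftrightarrow> h = sig a b (0, snd h)"
proof -
  have "gm h b = gm b h \<longleftrightarrow> fst h * (1 - e (- 1)) = fst b * (1 - e (- snd h))"
    using basisD(3)[OF assms] by (simp add: gm_def algebra_simps)
  also have "\<dots> \<longleftrightarrow> fst h = fst b / (1 - e (- 1)) * (1 - e (- snd h))"
    using e_ne_1 by (simp add: field_simps)
  finally show ?thesis by (simp add: sig_def prod_eq_iff)
qed

text \<open>That y2 and y1 are conjugate to a says that their exponents q and p are powers of k. The
  conjugator w acts as multiplication by q, so y is i/q times a in Z[1/k]; h commutes with b and
  takes q to p, so it is the power of b with exponent log p - log q. The decoded element is y
  h.\<close>

lemma decode_iff: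
  assumes B: "basis a b" "a \<in> V" "b \<in> V" and y: "cyc a y0" "cyc a y1" "cyc a y2"
  shows "(\<exists>w\<in>V. cj a w = y2 \<and> (\<exists>w'\<in>V. cj a w' = y1) \<and> (\<exists>y\<in>V. snd y = 0 \<and> cj y w = y0 \<and>
      (\<exists>h\<in>V. gm h b = gm b h \<and> cj y2 h = y1 \<and> g = gm y h))) \<longleftrightarrow>
    kpow k (num a y1) \<and> kpow k (num a y2) \<and> sig a b (dec [num a y0, num a y1, num a y2]) = g"
proof -
  note a = basisD[OF B]
  define i p q where "i = num a y0" "p = num a y1" "q = num a y2"
  define \<alpha> where "\<alpha> = fst a"
  have \<alpha>: "\<alpha> \<noteq> 0" "\<alpha> \<in> R" "a = (\<alpha>, 0)" using a B by (auto simp: \<alpha>_def prod_eq_iff)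
  have ys: "y0 = (of_int i * \<alpha>, 0)" "y1 = (of_int p * \<alpha>, 0)" "y2 = (of_int q * \<alpha>, 0)"
    using cyc_num[OF a(1)] y by (auto simp: i_p_q_def \<alpha>_def)
  have cja: "cj a w = (of_int n * \<alpha>, 0) \<longleftrightarrow> e (snd w) = of_int n" for w n
    using \<alpha> by (simp add: cj_A)
  show ?thesis unfolding i_p_q_def[symmetric]
  proof
    assume "\<exists>w\<in>V. cj a w = y2 \<and> (\<exists>w'\<in>V. cj a w' = y1) \<and> (\<exists>y\<in>V. snd y = 0 \<and> cj y w = y0 \<and>
      (\<exists>h\<in>V. gm h b = gm b h \<and> cj y2 h = y1 \<and> g = gm y h))"
    then obtain w w' y h where *: "cj a w = y2" "cj a w' = y1" "snd y = 0" "cj y w = y0"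
      "gm h b = gm b h" "cj y2 h = y1" "g = gm y h" by blast
    have w: "e (snd w) = of_int q" "e (snd w') = of_int p" using *(1,2) by (simp_all add: ys cja)
    then have kp: "kpow k p" "kpow k q" by (auto simp: kpow_iff_e)
    have q: "(of_int q :: rat) \<noteq> 0" using kpow_pos[OF kp(2)] by simp
    obtain \<eta> where \<eta>: "y = (\<eta>, 0)" using *(3) by (cases y) auto
    have "of_int q * \<eta> = of_int i * \<alpha>" using *(4) by (simp add: \<eta> cj_A ys w)
    then have \<eta>': "\<eta> = \<alpha> * (of_int i / of_int q)" using q by (simp add: field_simps)
    have "e (snd h) * of_int q = of_int p" using *(6) \<alpha> by (simp add: ys cj_A)
    then have "e (snd h) = of_int p / of_int q" using q by (simp add: eq_divide_eq)
    also have "\<dots> = e (snd (dec [i, p, q]))" using dec_3[OF kp, of i] by simp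
    finally have h: "snd h = snd (dec [i, p, q])" by simp
    have "g = gm y (sig a b (0, snd h))" using *(5,7) commute_basis_iff[OF B] by metis
    also have "\<dots> = sig a b (dec [i, p, q])"
      using dec_3[OF kp, of i] by (simp add: \<eta> \<eta>' h gm_def sig_def \<alpha>(3))
    finally show "kpow k p \<and> kpow k q \<and> sig a b (dec [i, p, q]) = g" using kp by simp
  next
    assume *: "kpow k p \<and> kpow k q \<and> sig a b (dec [i, p, q]) = g"
    then have kp: "kpow k p" "kpow k q" and g: "g = sig a b (dec [i, p, q])" by auto
    have q: "(of_int q :: rat) \<noteq> 0" using kpow_pos[OF kp(2)] by simp
    define h where "h = sig a b (0, snd (dec [i, p, q]))"
    define \<eta> where "\<eta> = \<alpha> * (of_int i / of_int q)"
    \<comment> \<open>Division by q is multiplication by a unit of Z[1/k], so the quotient stays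
      inside.\<close>
    have "\<eta> = \<alpha> * of_int i * e (- lg q)" using e_lg[OF kp(2)] by (simp add: \<eta>_def e_minus field_simps)
    then have \<eta>: "\<eta> \<in> R" using \<alpha> by simp
    have "(0, lg q) \<in> V" "cj a (0, lg q) = y2" "(0, lg p) \<in> V" "cj a (0, lg p) = y1"
      using e_lg kp by (simp_all add: ys cja)
    moreover have "(\<eta>, 0) \<in> V" "snd (\<eta>, 0) = 0" "cj (\<eta>, 0) (0, lg q) = y0"
      using \<eta> e_lg[OF kp(2)] q by (simp_all add: cj_A ys) (simp add: \<eta>_def)
    moreover have "h \<in> V" using sig_V[OF B(2,3)] by (simp add: h_def)
    moreover have "gm h b = gm b h" unfolding commute_basis_iff[OF B] by (simp add: h_def)
    moreover have "cj y2 h = y1"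
      using dec_3[OF kp, of i] q by (simp add: ys cj_A h_def)
    moreover have "g = gm (\<eta>, 0) h"
      using dec_3[OF kp, of i] by (simp add: g h_def \<eta>_def gm_def sig_def \<alpha>(3))
    ultimately show "\<exists>w\<in>V. cj a w = y2 \<and> (\<exists>w'\<in>V. cj a w' = y1) \<and> (\<exists>y\<in>V. snd y = 0 \<and> cj y w = y0 \<and>
      (\<exists>h\<in>V. gm h b = gm b h \<and> cj y2 h = y1 \<and> g = gm y h))" by blast
  qed
qed

text \<open>On elements of height 0 the automorphism is the dilation by \<open>fst a\<close>. Both
  the decoded element and a' carry this factor, so x is the ratio of i/q to i0/q0, whatever the
  basis (a, b).\<close>

lemma cyc_sig_iff:
  assumes B: "basis a b" "a \<in> V" "b \<in> V" and B': "basis a' b'" "a' \<in> V" "b' \<in> V"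
    and p: "kpow k p" "kpow k q" "kpow k p0" "kpow k q0"
    and a': "sig a b (dec [i0, p0, q0]) = a'"
  shows "cyc a' (sig a b (dec [i, p, q])) \<and> num a' (sig a b (dec [i, p, q])) = x \<longleftrightarrow>
    p = q \<and> i * q0 = x * (i0 * q)"
proof -
  have ne: "(of_int q :: rat) \<noteq> 0" "(of_int q0 :: rat) \<noteq> 0" using kpow_pos p by auto
  have \<alpha>: "fst a \<noteq> 0" "fst a' \<noteq> 0" "snd a' = 0" using basisD B B' by auto
  have "snd (dec [i0, p0, q0]) = 0" using a' \<alpha>(3) by auto
  then have fa': "fst a' = fst a * (of_int i0 / of_int q0)"
    using a' dec_3[OF p(3,4), of i0] by (auto simp: sig_def)
  have "snd (dec [i, p, q]) = 0 \<longleftrightarrow> e (snd (dec [i, p, q])) = 1" by simp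
  also have "\<dots> \<longleftrightarrow> p = q" using dec_3[OF p(1,2), of i] ne by (auto simp del: e_eq_1)
  finally have s: "snd (dec [i, p, q]) = 0 \<longleftrightarrow> p = q" .
  have "cyc a' (sig a b (dec [i, p, q])) \<and> num a' (sig a b (dec [i, p, q])) = x \<longleftrightarrow>
     snd (sig a b (dec [i, p, q])) = 0 \<and> fst (sig a b (dec [i, p, q])) = of_int x * fst a'"
    unfolding cyc_num_iff[OF \<alpha>(2,3)] by (auto simp: prod_eq_iff)
  also have "\<dots> \<longleftrightarrow> p = q \<and> fst a * (of_int i / of_int q) = of_int x * fst a'"
    using s dec_3[OF p(1,2), of i] by (auto simp: sig_def)
  also have "of_int x * fst a' = fst a * (of_int (x * i0) / of_int q0)"
    by (simp add: fa')
  also have "fst a * (of_int i / of_int q) = fst a * (of_int (x * i0) / of_int q0) \<longleftrightarrow>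
      (of_int i / of_int q :: rat) = of_int (x * i0) / of_int q0"
    by (rule mult_left_cancel[OF \<alpha>(1)])
  also have "\<dots> \<longleftrightarrow> (of_int (i * q0) :: rat) = of_int (x * (i0 * q))"
    using ne by (subst frac_eq_eq) (auto simp: mult.assoc)
  finally show ?thesis by (simp only: of_int_eq_iff)
qed

lemma standard_basis: "basis (1, 0) (0, 1)"
  unfolding basis_def all_A
proof (intro conjI ballI)
  fix t assume "t \<in> R"
  then obtain n i where "t * of_nat k ^ n = of_int i" by (auto simp: R_def)
  then show "\<exists>w\<in>V. cyc (1, 0) (cj (t, 0) w)"
    by (intro bexI[of _ "(0, int n)"]) (auto simp: cyc_def cj_A e_of_nat mult.commute)
qed simp_all

end

section \<open>Assembling the bi-interpretation\<close>

text \<open>Variables 3 j, 3 j + 1 and 3 j + 2 hold the j-th triple, the last triple being the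
  result. The equations are the right sides of \<open>gm_dec_iff\<close>, \<open>gi_dec_iff\<close>
  and \<open>one_dec_iff\<close>.\<close>

definition graph_BS :: "nat \<Rightarrow> grp_sym \<Rightarrow> (nat \<Rightarrow> int) \<Rightarrow> bool" where
  "graph_BS k Q = (case Q of
     GMul \<Rightarrow> (\<lambda>\<rho>. kpow k (\<rho> 1) \<and> kpow k (\<rho> 2) \<and> kpow k (\<rho> 4) \<and> kpow k (\<rho> 5) \<and>
       kpow k (\<rho> 7) \<and> kpow k (\<rho> 8) \<and>
       \<rho> 6 * (\<rho> 2 * (\<rho> 1 * \<rho> 5)) = \<rho> 8 * (\<rho> 0 * (\<rho> 1 * \<rho> 5) + \<rho> 2 * (\<rho> 2 * \<rho> 3)) \<and>
       \<rho> 7 * (\<rho> 2 * \<rho> 5) = \<rho> 1 * \<rho> 4 * \<rho> 8)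
   | GInv \<Rightarrow> (\<lambda>\<rho>. kpow k (\<rho> 1) \<and> kpow k (\<rho> 2) \<and> kpow k (\<rho> 4) \<and> kpow k (\<rho> 5) \<and>
       \<rho> 3 * (\<rho> 2 * \<rho> 2) + \<rho> 5 * (\<rho> 1 * \<rho> 0) = 0 \<and> \<rho> 4 * \<rho> 1 = \<rho> 2 * \<rho> 5)
   | GE \<Rightarrow> (\<lambda>\<rho>. kpow k (\<rho> 1) \<and> kpow k (\<rho> 2) \<and> \<rho> 0 = 0 \<and> \<rho> 1 = \<rho> 2))"

context baumslag_solitar
begin

text \<open>Arguments come first, then the result, then the basis; its element a is
  \<open>\<rho> 3\<close> for binary symbols and \<open>\<rho> 1\<close> for constants. Products are
  formed on heights and carried to powers of a by \<open>mul\<close>.\<close>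

definition graph_Z :: "ring_sym \<Rightarrow> (nat \<Rightarrow> rat \<times> int) \<Rightarrow> bool" where
  "graph_Z Q = (case Q of
     RAdd \<Rightarrow> (\<lambda>\<rho>. cyc (\<rho> 3) (\<rho> 0) \<and> cyc (\<rho> 3) (\<rho> 1) \<and> cyc (\<rho> 3) (\<rho> 2) \<and> gm (\<rho> 0) (\<rho> 1) = \<rho> 2)
   | RMul \<Rightarrow> (\<lambda>\<rho>. \<exists>c0\<in>V. \<exists>c1\<in>V. \<exists>c2\<in>V. mul (\<rho> 3) c0 (\<rho> 0) \<and> mul (\<rho> 3) c1 (\<rho> 1) \<and>
       mul (\<rho> 3) c2 (\<rho> 2) \<and> snd c2 = snd c0 * snd c1)
   | RZero \<Rightarrow> (\<lambda>\<rho>. cyc (\<rho> 1) (\<rho> 0) \<and> (0, 0) = \<rho> 0)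
   | ROne \<Rightarrow> (\<lambda>\<rho>. cyc (\<rho> 1) (\<rho> 0) \<and> \<rho> 1 = \<rho> 0))"

text \<open>Variables 0 to 2 form the code, 3 is the decoded element, and 4 and 5 are the basis (a,
  b).\<close>

definition decode :: "(nat \<Rightarrow> rat \<times> int) \<Rightarrow> bool" where
  "decode \<rho> \<longleftrightarrow> cyc (\<rho> 4) (\<rho> 0) \<and> cyc (\<rho> 4) (\<rho> 1) \<and> cyc (\<rho> 4) (\<rho> 2) \<and>
     (\<exists>w\<in>V. cj (\<rho> 4) w = \<rho> 2 \<and> (\<exists>w'\<in>V. cj (\<rho> 4) w' = \<rho> 1) \<and> (\<exists>y\<in>V. snd y = 0 \<and> cj y w = \<rho> 0 \<and>
      (\<exists>h\<in>V. gm h (\<rho> 5) = gm (\<rho> 5) h \<and> cj (\<rho> 2) h = \<rho> 1 \<and> \<rho> 3 = gm y h)))"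

lemma D_graph_BS: "Z.D ((grp_arity Q + 1) * 3 + 0) (graph_BS k Q)"
  unfolding graph_BS_def by (cases Q; simp only: grp_sym.case; intro Z_intros Z_kpow; simp)

lemma D_graph_Z: "G.D ((ring_arity Q + 1) * 1 + 2) (graph_Z Q)"
  unfolding graph_Z_def
  by (cases Q; simp only: ring_sym.case; intro G_intros G_cyc G_mul G_height_mult; simp)

lemma D_decode: "G.D 6 decode"
  unfolding decode_def by (intro G_intros G_cyc G_in_A) auto

lemma tuples_Z: "xs \<in> tuples Zring m \<longleftrightarrow> length xs = m"
  by (simp add: tuples_def Z_carrier)

lemma codes_exist:
  obtains \<Gamma> \<Delta> \<psi> \<theta>A \<theta>B where
    "cdim \<Gamma> = 3" "cpar \<Gamma> = 0" "guarded_code grp_arity ring_arity \<Gamma>"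
    "\<And>xs. xs \<in> tuples Zring 3 \<Longrightarrow> holds Zring xs (cU \<Gamma>) \<longleftrightarrow> kpow k (xs ! 1) \<and> kpow k (xs ! 2)"
    "\<And>xs. xs \<in> tuples Zring 6 \<Longrightarrow> holds Zring xs (cE \<Gamma>) \<longleftrightarrow>
      kpow k (xs ! 1) \<and> kpow k (xs ! 2) \<and> kpow k (xs ! 4) \<and> kpow k (xs ! 5) \<and>
      xs ! 0 * xs ! 5 = xs ! 3 * xs ! 2 \<and> xs ! 1 * xs ! 5 = xs ! 4 * xs ! 2"
    "\<And>Q xs. xs \<in> tuples Zring ((grp_arity Q + 1) * 3) \<Longrightarrow> holds Zring xs (cQ \<Gamma> Q) \<longleftrightarrow> graph_BS k Q (\<lambda>i. xs ! i)"
    "cdim \<Delta> = 1" "cpar \<Delta> = 2" "guarded_code ring_arity grp_arity \<Delta>"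
    "\<And>xs. xs \<in> tuples (BS k) 3 \<Longrightarrow> holds (BS k) xs (cU \<Delta>) \<longleftrightarrow> cyc (val (xs ! 1)) (val (xs ! 0))"
    "\<And>xs. xs \<in> tuples (BS k) 4 \<Longrightarrow> holds (BS k) xs (cE \<Delta>) \<longleftrightarrow>
      cyc (val (xs ! 2)) (val (xs ! 0)) \<and> val (xs ! 0) = val (xs ! 1)"
    "\<And>Q xs. xs \<in> tuples (BS k) (ring_arity Q + 3) \<Longrightarrow> holds (BS k) xs (cQ \<Delta> Q) \<longleftrightarrow> graph_Z Q (\<lambda>i. val (xs ! i))"
    "guarded grp_arity 2 \<psi>"
    "\<And>xs. xs \<in> tuples (BS k) 2 \<Longrightarrow> holds (BS k) xs \<psi> \<longleftrightarrow> basis (val (xs ! 0)) (val (xs ! 1))"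
    "formula_of grp_arity 6 \<theta>A" "\<And>xs. xs \<in> tuples (BS k) 6 \<Longrightarrow> holds (BS k) xs \<theta>A \<longleftrightarrow> decode (\<lambda>i. val (xs ! i))"
    "formula_of ring_arity 10 \<theta>B"
    "\<And>xs. xs \<in> tuples Zring 10 \<Longrightarrow> holds Zring xs \<theta>B \<longleftrightarrow>
      kpow k (xs ! 1) \<and> kpow k (xs ! 2) \<and> xs ! 1 = xs ! 2 \<and> xs ! 0 * xs ! 6 = xs ! 3 * (xs ! 4 * xs ! 2)"
proof -
  have "Z.D 3 (\<lambda>\<rho>. kpow k (\<rho> 1) \<and> kpow k (\<rho> 2))"
    by (intro Z_intros Z_kpow) auto
  then obtain uG where uG: "guarded ring_arity 3 uG"
    "\<And>xs. xs \<in> tuples Zring 3 \<Longrightarrow> holds Zring xs uG \<longleftrightarrow> kpow k (xs ! 1) \<and> kpow k (xs ! 2)"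
    by (rule Z.D_guarded) blast
  have "Z.D 6 (\<lambda>\<rho>. kpow k (\<rho> 1) \<and> kpow k (\<rho> 2) \<and> kpow k (\<rho> 4) \<and> kpow k (\<rho> 5) \<and>
      \<rho> 0 * \<rho> 5 = \<rho> 3 * \<rho> 2 \<and> \<rho> 1 * \<rho> 5 = \<rho> 4 * \<rho> 2)"
    by (intro Z_intros Z_kpow) auto
  then obtain eG where eG: "guarded ring_arity 6 eG"
    "\<And>xs. xs \<in> tuples Zring 6 \<Longrightarrow> holds Zring xs eG \<longleftrightarrow>
      kpow k (xs ! 1) \<and> kpow k (xs ! 2) \<and> kpow k (xs ! 4) \<and> kpow k (xs ! 5) \<and>
      xs ! 0 * xs ! 5 = xs ! 3 * xs ! 2 \<and> xs ! 1 * xs ! 5 = xs ! 4 * xs ! 2"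
    by (rule Z.D_guarded) blast
  have "\<exists>\<phi>. guarded ring_arity ((grp_arity Q + 1) * 3 + 0) \<phi> \<and> (\<forall>xs\<in>tuples Zring ((grp_arity Q + 1) * 3 + 0).
      holds Zring xs \<phi> \<longleftrightarrow> graph_BS k Q (\<lambda>i. xs ! i))" for Q
    by (rule Z.D_guarded[OF D_graph_BS[of Q]]) blast
  then obtain qG where qG: "\<And>Q. guarded ring_arity ((grp_arity Q + 1) * 3) (qG Q)"
    "\<And>Q xs. xs \<in> tuples Zring ((grp_arity Q + 1) * 3) \<Longrightarrow> holds Zring xs (qG Q) \<longleftrightarrow> graph_BS k Q (\<lambda>i. xs ! i)"
    by (simp only: add_0_right) metis
  have "G.D 3 (\<lambda>\<rho>. cyc (\<rho> 1) (\<rho> 0))" by (intro G_cyc) auto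
  then obtain uD where uD: "guarded grp_arity 3 uD"
    "\<And>xs. xs \<in> tuples (BS k) 3 \<Longrightarrow> holds (BS k) xs uD \<longleftrightarrow> cyc (val (xs ! 1)) (val (xs ! 0))"
    by (rule G.D_guarded) blast
  have "G.D 4 (\<lambda>\<rho>. cyc (\<rho> 2) (\<rho> 0) \<and> \<rho> 0 = \<rho> 1)" by (intro G_intros G_cyc) auto
  then obtain eD where eD: "guarded grp_arity 4 eD"
    "\<And>xs. xs \<in> tuples (BS k) 4 \<Longrightarrow> holds (BS k) xs eD \<longleftrightarrow>
      cyc (val (xs ! 2)) (val (xs ! 0)) \<and> val (xs ! 0) = val (xs ! 1)"
    by (rule G.D_guarded) blast
  have "\<exists>\<phi>. guarded grp_arity ((ring_arity Q + 1) * 1 + 2) \<phi> \<and> (\<forall>xs\<in>tuples (BS k) ((ring_arity Q + 1) * 1 + 2).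
      holds (BS k) xs \<phi> \<longleftrightarrow> graph_Z Q (\<lambda>i. val (xs ! i)))" for Q
    by (rule G.D_guarded[OF D_graph_Z[of Q]]) blast
  then obtain qD where qD: "\<And>Q. guarded grp_arity ((ring_arity Q + 1) * 1 + 2) (qD Q)"
    "\<And>Q xs. xs \<in> tuples (BS k) ((ring_arity Q + 1) * 1 + 2) \<Longrightarrow> holds (BS k) xs (qD Q) \<longleftrightarrow> graph_Z Q (\<lambda>i. val (xs ! i))"
    by metis
  have "G.D 2 (\<lambda>\<rho>. basis (\<rho> 0) (\<rho> 1))" by (intro G_basis) auto
  then obtain \<psi> where \<psi>: "guarded grp_arity 2 \<psi>"
    "\<And>xs. xs \<in> tuples (BS k) 2 \<Longrightarrow> holds (BS k) xs \<psi> \<longleftrightarrow> basis (val (xs ! 0)) (val (xs ! 1))"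
    by (rule G.D_guarded) blast
  obtain \<theta>A where \<theta>A: "formula_of grp_arity 6 \<theta>A"
    "\<And>xs. xs \<in> tuples (BS k) 6 \<Longrightarrow> holds (BS k) xs \<theta>A \<longleftrightarrow> decode (\<lambda>i. val (xs ! i))"
    by (rule G.D_formula[OF D_decode]) blast
  \<comment> \<open>Variables 0 to 2 are the triple of the decoded power of a', 3 is the integer x,
    and 4 to 6 and 7 to 9 are the triples of the basis (a', b').\<close>
  have "Z.D 10 (\<lambda>\<rho>. kpow k (\<rho> 1) \<and> kpow k (\<rho> 2) \<and> \<rho> 1 = \<rho> 2 \<and> \<rho> 0 * \<rho> 6 = \<rho> 3 * (\<rho> 4 * \<rho> 2))"
    by (intro Z_intros Z_kpow) auto
  then obtain \<theta>B where \<theta>B: "formula_of ring_arity 10 \<theta>B"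
    "\<And>xs. xs \<in> tuples Zring 10 \<Longrightarrow> holds Zring xs \<theta>B \<longleftrightarrow>
      kpow k (xs ! 1) \<and> kpow k (xs ! 2) \<and> xs ! 1 = xs ! 2 \<and> xs ! 0 * xs ! 6 = xs ! 3 * (xs ! 4 * xs ! 2)"
    by (rule Z.D_formula) blast
  show ?thesis
    by (rule that[of "\<lparr>cdim = 3, cpar = 0, cU = uG, cE = eG, cQ = qG\<rparr>" "\<lparr>cdim = 1, cpar = 2, cU = uD, cE = eD, cQ = qD\<rparr>" \<psi> \<theta>A \<theta>B])
      (use uG eG qG uD eD qD \<psi> \<theta>A \<theta>B in \<open>simp_all add: guarded_code_def eval_nat_numeral\<close>)
qed


lemma dec_V [simp]: "u \<in> UZ \<Longrightarrow> dec u \<in> V"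
  using dec_onto by blast

lemma interp_carrier:
  "length xs = grp_arity Q \<Longrightarrow> set xs \<subseteq> carrier (BS k) \<Longrightarrow> interp (BS k) Q xs \<in> carrier (BS k)"
  using struct_BS by (simp add: is_struct_def)

text \<open>The graphs are those of the standard decoding \<open>dec\<close>. An automorphism
  preserves them, so the same code without parameters has a twisted coordinate map for every
  basis.\<close>

lemma coord_map_BS_in_Z:
  assumes \<Gamma>: "cdim \<Gamma> = 3" "cpar \<Gamma> = 0"
    "\<And>xs. xs \<in> tuples Zring 3 \<Longrightarrow> holds Zring xs (cU \<Gamma>) \<longleftrightarrow> kpow k (xs ! 1) \<and> kpow k (xs ! 2)"
    "\<And>xs. xs \<in> tuples Zring 6 \<Longrightarrow> holds Zring xs (cE \<Gamma>) \<longleftrightarrow>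
      kpow k (xs ! 1) \<and> kpow k (xs ! 2) \<and> kpow k (xs ! 4) \<and> kpow k (xs ! 5) \<and>
      xs ! 0 * xs ! 5 = xs ! 3 * xs ! 2 \<and> xs ! 1 * xs ! 5 = xs ! 4 * xs ! 2"
    "\<And>Q xs. xs \<in> tuples Zring ((grp_arity Q + 1) * 3) \<Longrightarrow> holds Zring xs (cQ \<Gamma> Q) \<longleftrightarrow> graph_BS k Q (\<lambda>i. xs ! i)"
    and B: "basis a b" "a \<in> V" "b \<in> V"
  shows Uset_BS_in_Z: "Uset \<Gamma> Zring [] = UZ" (is ?U)
    and "coord_map grp_arity \<Gamma> Zring [] (BS k) (\<lambda>u. ival (sig a b (dec u)))" (is ?map)
proof -
  let ?M = "\<lambda>u. ival (sig a b (dec u))"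
  show U: ?U using \<Gamma>(3) by (auto simp: Uset_def UZ_def \<Gamma>(1) tuples_Z)
  have sV: "sig a b (dec u) \<in> V" if "u \<in> UZ" for u using sig_V[OF B(2,3)] that by simp
  have onto: "?M ` UZ = carrier (BS k)"
  proof -
    have "?M ` UZ = ival ` sig a b ` dec ` UZ" by (simp add: image_image)
    also have "\<dots> = ival ` V" by (simp only: dec_onto sig_onto[OF B])
    also have "\<dots> = carrier (BS k)" unfolding val_image[symmetric] image_image by simp
    finally show ?thesis .
  qed
  have M_eq: "?M u = ?M v \<longleftrightarrow> dec u = dec v" if "u \<in> UZ" "v \<in> UZ" for u v
    using sV[OF that(1)] sV[OF that(2)] sig_inj[OF B] by (metis val_ival)
  have E: "holds Zring (u @ v @ []) (cE \<Gamma>) \<longleftrightarrow> u \<in> UZ \<and> v \<in> UZ \<and> ?M u = ?M v"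
    if l: "length u = 3" "length v = 3" for u v
  proof -
    obtain i p q i' p' q' where uv: "u = [i, p, q]" "v = [i', p', q']"
      using l by (auto simp: length_3)
    have "holds Zring (u @ v @ []) (cE \<Gamma>) \<longleftrightarrow> (u \<in> UZ \<and> v \<in> UZ) \<and> i * q' = i' * q \<and> p * q' = p' * q"
      by (subst \<Gamma>(4)) (auto simp: uv tuples_Z)
    also have "\<dots> \<longleftrightarrow> (u \<in> UZ \<and> v \<in> UZ) \<and> dec u = dec v"
      using dec_eq_iff[of p q p' q' i i'] by (auto simp: uv)
    finally show ?thesis using M_eq by auto
  qed
  have Q: "holds Zring (concat xss @ []) (cQ \<Gamma> Q) \<longleftrightarrow>
      (\<forall>u\<in>set xss. u \<in> UZ) \<and> interp (BS k) Q (map ?M (butlast xss)) = ?M (last xss)"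
    if len: "length xss = grp_arity Q + 1" and xss: "\<forall>u\<in>set xss. length u = 3" for Q xss
  proof -
    have "length (concat xss) = (grp_arity Q + 1) * 3"
      using length_concat_const[of xss 3] xss len by simp
    then have "holds Zring (concat xss @ []) (cQ \<Gamma> Q) \<longleftrightarrow> graph_BS k Q (\<lambda>i. concat xss ! i)"
      using \<Gamma>(5)[of "concat xss @ []" Q] by (simp add: tuples_Z)
    also have "\<dots> \<longleftrightarrow> (\<forall>u\<in>set xss. u \<in> UZ) \<and> interp (BS k) Q (map ?M (butlast xss)) = ?M (last xss)"
    proof (cases Q)
      case GMul
      then obtain u v w where "xss = [u, v, w]" using len by (auto simp: length_Suc_conv numeral_2_eq_2)
      then obtain i p q i' p' q' i'' p'' q'' where x: "xss = [[i, p, q], [i', p', q'], [i'', p'', q'']]"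
        using xss by (auto simp: length_3)
      show ?thesis
      proof (cases "\<forall>u\<in>set xss. u \<in> UZ")
        case True
        then have pw: "kpow k p" "kpow k q" "kpow k p'" "kpow k q'" "kpow k p''" "kpow k q''"
          by (auto simp: x)
        have "interp (BS k) GMul [?M [i, p, q], ?M [i', p', q']] = ?M [i'', p'', q''] \<longleftrightarrow>
            gm (dec [i, p, q]) (dec [i', p', q']) = dec [i'', p'', q'']"
          using pw by (subst eq_ival_iff) (auto simp: interp_carrier val_mul sV sig_gm sig_inj[OF B])
        then show ?thesis unfolding gm_dec_iff[OF pw] using pw by (simp add: x GMul graph_BS_def)
      qed (auto simp: x GMul graph_BS_def)
    next
      case GInv
      then obtain u v where "xss = [u, v]" using len by (auto simp: length_Suc_conv)
      then obtain i p q i' p' q' where x: "xss = [[i, p, q], [i', p', q']]"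
        using xss by (auto simp: length_3)
      show ?thesis
      proof (cases "\<forall>u\<in>set xss. u \<in> UZ")
        case True
        then have pw: "kpow k p" "kpow k q" "kpow k p'" "kpow k q'"
          by (auto simp: x)
        have "interp (BS k) GInv [?M [i, p, q]] = ?M [i', p', q'] \<longleftrightarrow>
            gi (dec [i, p, q]) = dec [i', p', q']"
          using pw by (subst eq_ival_iff) (auto simp: interp_carrier val_inv sV sig_gi sig_inj[OF B])
        then show ?thesis unfolding gi_dec_iff[OF pw] using pw by (simp add: x GInv graph_BS_def)
      qed (auto simp: x GInv graph_BS_def)
    next
      case GE
      then obtain u where "xss = [u]" using len by (auto simp: length_Suc_conv)
      then obtain i p q where x: "xss = [[i, p, q]]"
        using xss by (auto simp: length_3)
      show ?thesis
      proof (cases "\<forall>u\<in>set xss. u \<in> UZ")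
        case True
        then have pw: "kpow k p" "kpow k q" by (auto simp: x)
        have "interp (BS k) GE [] = ?M [i, p, q] \<longleftrightarrow> sig a b (0, 0) = sig a b (dec [i, p, q])"
          using pw by (subst eq_ival_iff) (auto simp: interp_carrier val_one sV)
        then show ?thesis unfolding sig_inj[OF B] one_dec_iff[OF pw] using pw by (simp add: x GE graph_BS_def)
      qed (auto simp: x GE graph_BS_def)
    qed
    finally show ?thesis .
  qed
  show ?map unfolding coord_map_def U \<Gamma>(1,2) using onto E Q by (auto simp: tuples_Z)
qed

text \<open>Since \<open>fst (val A)\<close> is not 0, each integer n has the single code A^n, and
  the equivalence relation of the code is equality.\<close>

lemma coord_map_Z_in_BS:
  assumes \<Delta>: "cdim \<Delta> = 1" "cpar \<Delta> = 2"
    "\<And>xs. xs \<in> tuples (BS k) 3 \<Longrightarrow> holds (BS k) xs (cU \<Delta>) \<longleftrightarrow> cyc (val (xs ! 1)) (val (xs ! 0))"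
    "\<And>xs. xs \<in> tuples (BS k) 4 \<Longrightarrow> holds (BS k) xs (cE \<Delta>) \<longleftrightarrow>
      cyc (val (xs ! 2)) (val (xs ! 0)) \<and> val (xs ! 0) = val (xs ! 1)"
    "\<And>Q xs. xs \<in> tuples (BS k) (ring_arity Q + 3) \<Longrightarrow> holds (BS k) xs (cQ \<Delta> Q) \<longleftrightarrow> graph_Z Q (\<lambda>i. val (xs ! i))"
    and q: "A \<in> carrier (BS k)" "B \<in> carrier (BS k)" "basis (val A) (val B)"
  shows Uset_Z_in_BS: "Uset \<Delta> (BS k) [A, B] = {[Y] | Y. Y \<in> carrier (BS k) \<and> cyc (val A) (val Y)}" (is ?U)
    and "coord_map ring_arity \<Delta> (BS k) [A, B] Zring (\<lambda>ys. num (val A) (val (ys ! 0)))" (is ?map)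
proof -
  let ?D = "\<lambda>ys. num (val A) (val (ys ! 0))" and ?C = "carrier (BS k)"
  let ?UD = "{[Y] | Y. Y \<in> ?C \<and> cyc (val A) (val Y)}"
  have a: "fst (val A) \<noteq> 0" "snd (val A) = 0" using basisD[OF q(3)] q(1,2) by auto
  have tup1: "xs \<in> tuples (BS k) (Suc 0) \<longleftrightarrow> (\<exists>X\<in>?C. xs = [X])" for xs
    by (auto simp: tuples_def length_Suc_conv)
  show U: ?U
  proof -
    have "holds (BS k) ([Y] @ [A, B]) (cU \<Delta>) \<longleftrightarrow> cyc (val A) (val Y)" if "Y \<in> ?C" for Y
      using \<Delta>(3)[of "[Y] @ [A, B]"] that q by (simp add: tuples_def)
    then show ?thesis by (auto simp: Uset_def \<Delta>(1) tup1)
  qed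
  have [simp]: "[Y] \<in> ?UD \<longleftrightarrow> Y \<in> ?C \<and> cyc (val A) (val Y)" for Y by simp
  have onto: "?D ` ?UD = carrier Zring"
  proof -
    have "z \<in> ?D ` ?UD" for z
    proof -
      let ?y = "(of_int z * fst (val A), 0) :: rat \<times> int"
      have y: "?y \<in> V" using q(1) by simp
      have "cyc (val A) ?y \<and> num (val A) ?y = z" unfolding cyc_num_iff[OF a] ..
      then show ?thesis using y by (intro image_eqI[of _ _ "[ival ?y]"]) auto
    qed
    then show ?thesis by (auto simp: Z_carrier)
  qed
  have E: "holds (BS k) ([X] @ [Y] @ [A, B]) (cE \<Delta>) \<longleftrightarrow> [X] \<in> ?UD \<and> [Y] \<in> ?UD \<and> ?D [X] = ?D [Y]"
    if "X \<in> ?C" "Y \<in> ?C" for X Y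
  proof -
    have "holds (BS k) ([X] @ [Y] @ [A, B]) (cE \<Delta>) \<longleftrightarrow> cyc (val A) (val X) \<and> val X = val Y"
      using \<Delta>(4)[of "[X] @ [Y] @ [A, B]"] that q by (simp add: tuples_def)
    also have "\<dots> \<longleftrightarrow> [X] \<in> ?UD \<and> [Y] \<in> ?UD \<and> ?D [X] = ?D [Y]"
      using that cyc_num[OF a(1)] by (auto intro: box_equals) (metis cyc_num a(1))
    finally show ?thesis .
  qed
  have Q: "holds (BS k) (concat xss @ [A, B]) (cQ \<Delta> Q) \<longleftrightarrow>
      (\<forall>xs\<in>set xss. xs \<in> ?UD) \<and> interp Zring Q (map ?D (butlast xss)) = ?D (last xss)"
    if len: "length xss = ring_arity Q + 1" and xss: "\<forall>xs\<in>set xss. \<exists>X\<in>?C. xs = [X]" for Q xss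
  proof -
    obtain Xs where Xs: "xss = map (\<lambda>X. [X]) Xs" "set Xs \<subseteq> ?C"
    proof
      show "xss = map (\<lambda>X. [X]) (map hd xss)" using xss by (induction xss) auto
      show "set (map hd xss) \<subseteq> ?C" using xss by auto
    qed
    have "holds (BS k) (concat xss @ [A, B]) (cQ \<Delta> Q) \<longleftrightarrow> graph_Z Q (\<lambda>i. val ((Xs @ [A, B]) ! i))"
      using \<Delta>(5)[of "concat xss @ [A, B]" Q] len Xs q by (simp add: tuples_def)
    also have "\<dots> \<longleftrightarrow> (\<forall>xs\<in>set xss. xs \<in> ?UD) \<and> interp Zring Q (map ?D (butlast xss)) = ?D (last xss)"
    proof (cases "\<forall>X\<in>set Xs. cyc (val A) (val X)")
      case False
      \<comment> \<open>Each case of \<open>graph_Z\<close> forces all arguments and the result into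
        the cyclic group, for products through \<open>mul\<close> and
        \<open>cyc_iff\<close>.\<close>
      then have "\<not> graph_Z Q (\<lambda>i. val ((Xs @ [A, B]) ! i))"
        using len Xs by (cases Q) (auto simp: graph_Z_def cyc_iff length_Suc_conv numeral_2_eq_2 numeral_3_eq_3)
      then show ?thesis using False Xs by auto
    next
      case True
      have v: "val X = (of_int (num (val A) (val X)) * fst (val A), 0)" if "X \<in> set Xs" for X
        using cyc_num[OF a(1)] True that by blast
      have UD: "\<forall>xs\<in>set xss. xs \<in> ?UD" using True Xs by auto
      show ?thesis
      proof (cases Q)
        case RAdd
        then obtain X Y Z where X: "Xs = [X, Y, Z]"
          using len Xs by (auto simp: length_Suc_conv numeral_2_eq_2)
        define x y z where "x = num (val A) (val X)" "y = num (val A) (val Y)" "z = num (val A) (val Z)"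
        have "gm (val X) (val Y) = val Z \<longleftrightarrow> of_int (x + y) * fst (val A) = of_int z * fst (val A)"
          using v[of X] v[of Y] v[of Z] by (simp add: X x_y_z_def gm_def prod_eq_iff distrib_right)
        also have "\<dots> \<longleftrightarrow> x + y = z" using a(1) by (simp only: mult_cancel_right of_int_eq_iff simp_thms)
        finally show ?thesis using True UD
          by (simp add: X Xs RAdd graph_Z_def Zring_def interp_def x_y_z_def numeral_3_eq_3)
      next
        case RMul
        then obtain X Y Z where X: "Xs = [X, Y, Z]"
          using len Xs by (auto simp: length_Suc_conv numeral_2_eq_2)
        define x y z where "x = num (val A) (val X)" "y = num (val A) (val Y)" "z = num (val A) (val Z)"
        have m: "mul (val A) c (val W) \<longleftrightarrow> num (val A) (val W) = snd c" if "W \<in> set Xs" for W c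
          using True that cyc_num_iff[OF a, of "val W" "snd c"] a(2) by (auto simp: mul_def prod_eq_iff)
        have "graph_Z Q (\<lambda>i. val ((Xs @ [A, B]) ! i)) \<longleftrightarrow>
           (\<exists>c0\<in>V. \<exists>c1\<in>V. \<exists>c2\<in>V. x = snd c0 \<and> y = snd c1 \<and> z = snd c2 \<and> snd c2 = snd c0 * snd c1)"
          using m[of X] m[of Y] m[of Z] by (simp add: X RMul graph_Z_def x_y_z_def numeral_3_eq_3)
        also have "\<dots> \<longleftrightarrow> x * y = z"
        proof
          assume "x * y = z"
          then show "\<exists>c0\<in>V. \<exists>c1\<in>V. \<exists>c2\<in>V. x = snd c0 \<and> y = snd c1 \<and> z = snd c2 \<and> snd c2 = snd c0 * snd c1"
            by (intro bexI[of _ "(0, x)"] bexI[of _ "(0, y)"] bexI[of _ "(0, z)"]) auto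
        qed auto
        finally show ?thesis using UD
          by (simp add: X Xs RMul Zring_def interp_def x_y_z_def)
      next
        case RZero
        then obtain X where X: "Xs = [X]" using len Xs by (auto simp: length_Suc_conv)
        have "(0, 0) = val X \<longleftrightarrow> 0 = num (val A) (val X)"
          using v[of X] a(1) by (auto simp: X prod_eq_iff)
        then show ?thesis using True UD
          by (simp add: X Xs RZero graph_Z_def Zring_def interp_def)
      next
        case ROne
        then obtain X where X: "Xs = [X]" using len Xs by (auto simp: length_Suc_conv)
        have "val A = val X \<longleftrightarrow> 1 = num (val A) (val X)"
          using v[of X] a by (auto simp: X prod_eq_iff)
        then show ?thesis using True UD
          by (simp add: X Xs ROne graph_Z_def Zring_def interp_def)
      qed
    qed
    finally show ?thesis .
  qed
  have par: "[A, B] \<in> tuples (BS k) 2" using q by (simp add: tuples_def)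
  show ?map unfolding coord_map_def U \<Delta>(1,2)
  proof (intro conjI ballI allI impI)
    fix xs ys assume "xs \<in> tuples (BS k) 1" "ys \<in> tuples (BS k) 1"
    then obtain X Y where "X \<in> ?C" "Y \<in> ?C" "xs = [X]" "ys = [Y]" by (auto simp: tup1)
    then show "holds (BS k) (xs @ ys @ [A, B]) (cE \<Delta>) \<longleftrightarrow> xs \<in> ?UD \<and> ys \<in> ?UD \<and> ?D xs = ?D ys"
      using E by blast
  next
    fix Q xss assume "length xss = ring_arity Q + 1 \<and> (\<forall>xs\<in>set xss. xs \<in> tuples (BS k) 1)"
    then show "holds (BS k) (concat xss @ [A, B]) (cQ \<Delta> Q) \<longleftrightarrow>
      (\<forall>xs\<in>set xss. xs \<in> ?UD) \<and> interp Zring Q (map ?D (butlast xss)) = ?D (last xss)"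
      by (intro Q) (auto simp: tup1)
  qed (use par onto in auto)
qed

text \<open>The twist is chosen so that the two remaining definability conditions become
  \<open>decode_iff\<close>, for the group, and \<open>cyc_sig_iff\<close>, for the
  integers.\<close>

lemma biinterpretable_BS_Z: "strongly_regularly_biinterpretable grp_arity (BS k) ring_arity Zring"
proof (rule codes_exist)
  fix \<Gamma> :: "(grp_sym, ring_sym) code" and \<Delta> :: "(ring_sym, grp_sym) code" and \<psi> \<theta>A \<theta>B
  assume \<Gamma>: "cdim \<Gamma> = 3" "cpar \<Gamma> = 0" and gG: "guarded_code grp_arity ring_arity \<Gamma>"
    and \<Gamma>': "\<And>xs. xs \<in> tuples Zring 3 \<Longrightarrow> holds Zring xs (cU \<Gamma>) \<longleftrightarrow> kpow k (xs ! 1) \<and> kpow k (xs ! 2)"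
    "\<And>xs. xs \<in> tuples Zring 6 \<Longrightarrow> holds Zring xs (cE \<Gamma>) \<longleftrightarrow>
      kpow k (xs ! 1) \<and> kpow k (xs ! 2) \<and> kpow k (xs ! 4) \<and> kpow k (xs ! 5) \<and>
      xs ! 0 * xs ! 5 = xs ! 3 * xs ! 2 \<and> xs ! 1 * xs ! 5 = xs ! 4 * xs ! 2"
    "\<And>Q xs. xs \<in> tuples Zring ((grp_arity Q + 1) * 3) \<Longrightarrow> holds Zring xs (cQ \<Gamma> Q) \<longleftrightarrow> graph_BS k Q (\<lambda>i. xs ! i)"
    and \<Delta>: "cdim \<Delta> = 1" "cpar \<Delta> = 2" and gD: "guarded_code ring_arity grp_arity \<Delta>"
    and \<Delta>': "\<And>xs. xs \<in> tuples (BS k) 3 \<Longrightarrow> holds (BS k) xs (cU \<Delta>) \<longleftrightarrow> cyc (val (xs ! 1)) (val (xs ! 0))"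
    "\<And>xs. xs \<in> tuples (BS k) 4 \<Longrightarrow> holds (BS k) xs (cE \<Delta>) \<longleftrightarrow>
      cyc (val (xs ! 2)) (val (xs ! 0)) \<and> val (xs ! 0) = val (xs ! 1)"
    "\<And>Q xs. xs \<in> tuples (BS k) (ring_arity Q + 3) \<Longrightarrow> holds (BS k) xs (cQ \<Delta> Q) \<longleftrightarrow> graph_Z Q (\<lambda>i. val (xs ! i))"
    and \<psi>: "guarded grp_arity 2 \<psi>"
    "\<And>xs. xs \<in> tuples (BS k) 2 \<Longrightarrow> holds (BS k) xs \<psi> \<longleftrightarrow> basis (val (xs ! 0)) (val (xs ! 1))"
    and \<theta>A: "formula_of grp_arity 6 \<theta>A" "\<And>xs. xs \<in> tuples (BS k) 6 \<Longrightarrow> holds (BS k) xs \<theta>A \<longleftrightarrow> decode (\<lambda>i. val (xs ! i))"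
    and \<theta>B: "formula_of ring_arity 10 \<theta>B"
    "\<And>xs. xs \<in> tuples Zring 10 \<Longrightarrow> holds Zring xs \<theta>B \<longleftrightarrow>
      kpow k (xs ! 1) \<and> kpow k (xs ! 2) \<and> xs ! 1 = xs ! 2 \<and> xs ! 0 * xs ! 6 = xs ! 3 * (xs ! 4 * xs ! 2)"
  let ?C = "carrier (BS k)" and ?Psi = "defset (BS k) (cpar \<Delta>) \<psi>"
  define M where "M q u = ival (sig (val (q ! 0)) (val (q ! 1)) (dec u))" for q u
  define N where "N q ys = num (val (q ! 0)) (val (ys ! 0))" for q ys
  have Psi: "\<exists>A B. q = [A, B] \<and> A \<in> ?C \<and> B \<in> ?C \<and> basis (val A) (val B)" if "q \<in> ?Psi" for q
  proof -
    have "q \<in> tuples (BS k) 2" "basis (val (q ! 0)) (val (q ! 1))"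
      using that \<psi>(2) by (auto simp: defset_def \<Delta>(2))
    then show ?thesis by (auto simp: tuples_def length_Suc_conv numeral_2_eq_2)
  qed
  have UG: "Uset \<Gamma> Zring [] = UZ"
    by (rule Uset_BS_in_Z[OF \<Gamma> \<Gamma>' standard_basis]) auto
  have UD: "Uset \<Delta> (BS k) [A, B] = {[Y] | Y. Y \<in> ?C \<and> cyc (val A) (val Y)}"
    if "A \<in> ?C" "B \<in> ?C" "basis (val A) (val B)" for A B
    by (rule Uset_Z_in_BS[OF \<Delta> \<Delta>' that])
  have ch3: "chunks (Suc 0) 3 [x, y, z] = [[x], [y], [z]]" for x y z :: "bs_gen word set"
    by (simp add: chunks_def numeral_3_eq_3)
  show ?thesis
  proof (rule strongly_regularly_biinterpretableI)
    show "is_struct grp_arity (BS k)" "is_struct ring_arity Zring"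
      by (rule struct_BS, rule struct_Zring)
    show "guarded_code grp_arity ring_arity \<Gamma>" "cpar \<Gamma> = 0" "guarded_code ring_arity grp_arity \<Delta>"
      by (fact gG \<Gamma> gD)+
    \<comment> \<open>A tautology without free variables is required here, and \<open>TT\<close> has
      one.\<close>
    show "formula_of ring_arity 0 (Ex 0 (Eq (Var 0) (Var 0)))" "holds Zring [] (Ex 0 (Eq (Var 0) (Var 0)))"
      by (auto simp: formula_of_def holds_def Z_carrier)
    show "guarded grp_arity (cpar \<Delta>) \<psi>" using \<psi>(1) \<Delta>(2) by simp
    show "[ival (1, 0), ival (0, 1)] \<in> ?Psi"
      using \<psi>(2)[of "[ival (1, 0), ival (0, 1)]"] standard_basis by (simp add: defset_def tuples_def \<Delta>(2))
    show "formula_of grp_arity (cdim \<Gamma> * cdim \<Delta> + 1 + cpar \<Delta>) \<theta>A" using \<theta>A(1) by (simp add: \<Gamma> \<Delta>)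
    show "formula_of ring_arity (cdim \<Gamma> * cdim \<Delta> + 1 + cpar \<Delta> * cdim \<Gamma>) \<theta>B" using \<theta>B(1) by (simp add: \<Gamma> \<Delta>)
    show "coord_map grp_arity \<Gamma> Zring [] (BS k) (M q)" if "q \<in> ?Psi" for q
      unfolding M_def using Psi[OF that] by (intro coord_map_BS_in_Z(2)[OF \<Gamma> \<Gamma>']) auto
    show "coord_map ring_arity \<Delta> (BS k) q Zring (N q)" if q: "q \<in> ?Psi" for q
    proof -
      obtain A B where "q = [A, B]" "A \<in> ?C" "B \<in> ?C" "basis (val A) (val B)"
        using Psi[OF q] by blast
      moreover have "N [A, B] = (\<lambda>ys. num (val A) (val (ys ! 0)))" by (rule ext) (simp add: N_def)
      ultimately show ?thesis using coord_map_Z_in_BS(2)[OF \<Delta> \<Delta>', of A B] by simp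
    qed
    show "defines_map (BS k) \<theta>A (cdim \<Gamma> * cdim \<Delta>) q
      {u \<in> tuples (BS k) (cdim \<Gamma> * cdim \<Delta>). set (chunks (cdim \<Delta>) (cdim \<Gamma>) u) \<subseteq> Uset \<Delta> (BS k) q \<and>
         map (N q) (chunks (cdim \<Delta>) (cdim \<Gamma>) u) \<in> Uset \<Gamma> Zring []}
      (\<lambda>u. M q (map (N q) (chunks (cdim \<Delta>) (cdim \<Gamma>) u)))" if q: "q \<in> ?Psi" for q
    proof -
      obtain A B where A: "q = [A, B]" "A \<in> ?C" "B \<in> ?C" "basis (val A) (val B)"
        using Psi[OF q] by blast
      note bas = A(4) val_V[OF A(2)] val_V[OF A(3)]
      let ?n = "\<lambda>Y. num (val A) (val Y)"
      have "holds (BS k) ([Y0, Y1, Y2] @ [X] @ [A, B]) \<theta>A \<longleftrightarrow>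
        (cyc (val A) (val Y0) \<and> cyc (val A) (val Y1) \<and> cyc (val A) (val Y2) \<and>
          [?n Y0, ?n Y1, ?n Y2] \<in> UZ) \<and> M q [?n Y0, ?n Y1, ?n Y2] = X"
        if Y: "Y0 \<in> ?C" "Y1 \<in> ?C" "Y2 \<in> ?C" "X \<in> ?C" for Y0 Y1 Y2 X
      proof -
        have "holds (BS k) ([Y0, Y1, Y2] @ [X] @ [A, B]) \<theta>A \<longleftrightarrow>
           decode (\<lambda>i. val (([Y0, Y1, Y2] @ [X] @ [A, B]) ! i))"
          by (rule \<theta>A(2)) (use Y A in \<open>simp add: tuples_def\<close>)
        also have "\<dots> \<longleftrightarrow> (cyc (val A) (val Y0) \<and> cyc (val A) (val Y1) \<and> cyc (val A) (val Y2)) \<and>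
          kpow k (?n Y1) \<and> kpow k (?n Y2) \<and> sig (val A) (val B) (dec [?n Y0, ?n Y1, ?n Y2]) = val X"
          using decode_iff[OF bas, of "val Y0" "val Y1" "val Y2" "val X"]
          by (auto simp: decode_def eval_nat_numeral)
        also have "\<dots> \<longleftrightarrow> (cyc (val A) (val Y0) \<and> cyc (val A) (val Y1) \<and> cyc (val A) (val Y2) \<and>
          [?n Y0, ?n Y1, ?n Y2] \<in> UZ) \<and> M q [?n Y0, ?n Y1, ?n Y2] = X"
        proof (cases "[?n Y0, ?n Y1, ?n Y2] \<in> UZ")
          case True
          then have "sig (val A) (val B) (dec [?n Y0, ?n Y1, ?n Y2]) \<in> V"
            by (intro sig_V bas dec_V)
          then have "M q [?n Y0, ?n Y1, ?n Y2] = X \<longleftrightarrow> sig (val A) (val B) (dec [?n Y0, ?n Y1, ?n Y2]) = val X"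
            using eq_ival_iff[OF Y(4)]
            by (simp add: M_def A(1) eq_commute[of _ X] eq_commute[of _ "val X"])
          then show ?thesis using True by auto
        qed auto
        finally show ?thesis .
      qed
      then show ?thesis
        by (auto simp: defines_map_def \<Gamma> \<Delta> UG UD A tuples_def length_3 ch3 N_def)
    qed
    show "defines_map Zring \<theta>B (cdim \<Gamma> * cdim \<Delta>) qq
      {u \<in> tuples Zring (cdim \<Delta> * cdim \<Gamma>). set (chunks (cdim \<Gamma>) (cdim \<Delta>) u) \<subseteq> Uset \<Gamma> Zring [] \<and>
         map (M q) (chunks (cdim \<Gamma>) (cdim \<Delta>) u) \<in> Uset \<Delta> (BS k) q'}
      (\<lambda>u. N q' (map (M q) (chunks (cdim \<Gamma>) (cdim \<Delta>) u)))"
      if q: "q \<in> ?Psi" "q' \<in> ?Psi" and qq: "length qq = cpar \<Delta> * cdim \<Gamma>"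
        "set (chunks (cdim \<Gamma>) (cpar \<Delta>) qq) \<subseteq> Uset \<Gamma> Zring []"
        "map (M q) (chunks (cdim \<Gamma>) (cpar \<Delta>) qq) = q'" for q q' qq
    proof -
      obtain A B where A: "q = [A, B]" "A \<in> ?C" "B \<in> ?C" "basis (val A) (val B)"
        using Psi[OF q(1)] by blast
      obtain A' B' where A': "q' = [A', B']" "A' \<in> ?C" "B' \<in> ?C" "basis (val A') (val B')"
        using Psi[OF q(2)] by blast
      note bas = A(4) val_V[OF A(2)] val_V[OF A(3)]
      note bas' = A'(4) val_V[OF A'(2)] val_V[OF A'(3)]
      have sV: "sig (val A) (val B) (dec u) \<in> V" if "u \<in> UZ" for u
        by (intro sig_V bas dec_V that)
      obtain i0 p0 q0 i1 p1 q1 where c: "qq = [i0, p0, q0, i1, p1, q1]"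
        using qq(1) by (auto simp: \<Gamma> \<Delta> length_Suc_conv eval_nat_numeral)
      have "chunks 3 2 qq = [[i0, p0, q0], [i1, p1, q1]]"
        by (simp add: c chunks_def numeral_2_eq_2 numeral_3_eq_3)
      then have z: "[i0, p0, q0] \<in> UZ" "M q [i0, p0, q0] = A'"
        using qq(2,3) by (auto simp: \<Gamma> \<Delta> UG A'(1))
      \<comment> \<open>The codes in \<open>qq\<close> are read with the twist of \<open>q\<close>,
        so A' is the image of its first triple under the automorphism of \<open>q\<close>, as
        \<open>cyc_sig_iff\<close> requires.\<close>
      then have a': "sig (val A) (val B) (dec [i0, p0, q0]) = val A'"
        using val_ival[OF sV[OF z(1)]] by (simp add: M_def A(1))
      have "holds Zring ([i, p, r] @ [x] @ qq) \<theta>B \<longleftrightarrow> ([i, p, r] \<in> UZ \<and> cyc (val A') (val (M q [i, p, r]))) \<and>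
          num (val A') (val (M q [i, p, r])) = x" for i p r x
      proof -
        have "holds Zring ([i, p, r] @ [x] @ qq) \<theta>B \<longleftrightarrow> [i, p, r] \<in> UZ \<and> p = r \<and> i * q0 = x * (i0 * r)"
          by (subst \<theta>B(2)) (auto simp: tuples_Z c eval_nat_numeral)
        also have "\<dots> \<longleftrightarrow> [i, p, r] \<in> UZ \<and> cyc (val A') (sig (val A) (val B) (dec [i, p, r])) \<and>
          num (val A') (sig (val A) (val B) (dec [i, p, r])) = x"
          using cyc_sig_iff[OF bas bas' _ _ _ _ a', of p r i x] z(1) by auto
        also have "\<dots> \<longleftrightarrow> ([i, p, r] \<in> UZ \<and> cyc (val A') (val (M q [i, p, r]))) \<and>
          num (val A') (val (M q [i, p, r])) = x"
          using sV[of "[i, p, r]"] by (auto simp: M_def A(1))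
        finally show ?thesis .
      qed
      moreover have "M q u \<in> ?C" if "u \<in> UZ" for u
        using sV[OF that] by (simp add: M_def A(1))
      moreover have "chunks 3 (Suc 0) u = [u]" if "length u = 3" for u :: "int list"
        using that by (simp add: chunks_def)
      ultimately show ?thesis
        by (auto simp: defines_map_def \<Gamma> \<Delta> UG UD A' tuples_Z length_3 N_def)
    qed
  qed
qed

end

theorem theorem4p7:
  fixes k :: nat
  assumes "k > 1"
  shows "strongly_regularly_biinterpretable grp_arity (BS k) ring_arity Zring"
proof -
  interpret baumslag_solitar k by unfold_locales (rule assms)
  show ?thesis by (rule biinterpretable_BS_Z)
qed

end
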